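(* Let $k$ be a field, let $\mathcal{H}$ be a properly-connected hypergraph and let $E$ be a splitting edge of $\mathcal{H}$. Let $d=|E|$, let $\mathcal{H}'$ be the sub-hypergraph of $\mathcal{H}$ with edge set $\{H\in\mathcal{H} : \operatorname{dist}_{\mathcal{H}}(E,H)\ge d+1\}$, and let $t=|N(E)|$, where $$N(E)=\bigcup_{\{H\in\mathcal{H}\,:\,\operatorname{dist}_{\mathcal{H}}(E,H)=1\}} H\setminus E .$$ Then for all $i\ge 1$ and all $j$, $$\beta_{i,j}(\mathcal{I}(\mathcal{H}))=\beta_{i,j}(\mathcal{I}(\mathcal{H}\setminus E))+\sum_{l=0}^{i}\binom{t}{l}\beta_{i-1-l,\,j-d-l}(\mathcal{I}(\mathcal{H}')),$$ where by convention $\beta_{-1,j}(\mathcal{I}(\mathcal{H}'))=1$ if $j=0$ and $0$ if $j\neq 0$.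
   Context: A simple hypergraph $\mathcal{H}=(\mathcal{X},\mathcal{E})$ consists of a finite set $\mathcal{X}=\{x_1,\dots,x_n\}$ of vertices and a family $\mathcal{E}$ of distinct subsets (edges) with $|E|\ge 2$ for all edges and no edge contained in a different edge; all hypergraphs are simple, and $H\in\mathcal{H}$ means $H$ is an edge. Let $R=k[x_1,\dots,x_n]$, $x^E=\prod_{x\in E}x$, and $\mathcal{I}(\mathcal{H})=(x^E: E\in\mathcal{E})\subseteq R$ (edge ideal; the zero ideal if there are no edges). $\mathcal{H}\setminus E$ is $\mathcal{H}$ with the edge $E$ removed. $\beta_{i,j}(I)$ denotes the graded Betti numbers of the graded $R$-module $I$. $\mathcal{H}$ is $d$-uniform if all edges have cardinality $d$. A chain of length $n$ is a sequence $(E_0,x_1,E_1,\dots,x_n,E_n)$ with $x_1,\dots,x_n$ distinct vertices, $E_0,\dots,E_n$ distinct edges, $x_1\in E_0$, $x_n\in E_n$, and $x_k,x_{k+1}\in E_k$ for $1\le k\le n-1$. In a $d$-uniform hypergraph it is proper if $|E_i\cap E_{i+1}|=d-1$ for all $i$, and a proper chain is irredundant if no proper subsequence is a proper chain from $E_0$ to $E_n$. $\operatorname{dist}_{\mathcal{H}}(E,E')$ is the minimum length of a proper irredundant chain from $E$ to $E'$ ($\infty$ if none exists). A $d$-uniform hypergraph is properly-connected if $\operatorname{dist}_{\mathcal{H}}(E,E')=d-|E\cap E'|$ for all edges $E,E'$ with $E\cap E'\ne\emptyset$. For a monomial ideal $I$ let $\mathcal{G}(I)$ be its minimal set of monomial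 generators. $I=J+K$ with $J,K$ nonzero monomial ideals is a splitting if (1) $\mathcal{G}(I)$ is the disjoint union of $\mathcal{G}(J)$ and $\mathcal{G}(K)$; and (2) there is a function $\mathcal{G}(J\cap K)\to\mathcal{G}(J)\times\mathcal{G}(K)$, $w\mapsto(\phi(w),\psi(w))$, such that $w=\operatorname{lcm}(\phi(w),\psi(w))$ for all $w$, and for every nonempty $S\subseteq\mathcal{G}(J\cap K)$ both $\operatorname{lcm}(\phi(S))$ and $\operatorname{lcm}(\psi(S))$ strictly divide $\operatorname{lcm}(S)$. An edge $E$ is a splitting edge of $\mathcal{H}$ if $\mathcal{I}(\mathcal{H})=(x^E)+\mathcal{I}(\mathcal{H}\setminus E)$ is a splitting. *)

theory Defs
  imports
    Complex_Main
    "HOL-Library.Poly_Mapping"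
    "HOL-Library.Multiset"
    "HOL-Library.Sublist"
    "HOL-Library.Extended_Nat"
begin

section \<open>Simple hypergraphs\<close>

text \<open>
  The vertex set is the universe of a finite type \<open>'v\<close>; a hypergraph is given by its
  set of edges.
\<close>

definition simple_hypergraph :: "'v::finite set set \<Rightarrow> bool" where
  "simple_hypergraph H \<longleftrightarrow>
     (\<forall>E\<in>H. card E \<ge> 2) \<and> (\<forall>E\<in>H. \<forall>F\<in>H. E \<subseteq> F \<longrightarrow> E = F)"

definition uniform :: "nat \<Rightarrow> 'v::finite set set \<Rightarrow> bool" where
  "uniform d H \<longleftrightarrow> (\<forall>E\<in>H. card E = d)"

text \<open>
  A sequence \<open>(E\<^sub>0, x\<^sub>1, E\<^sub>1, \<dots>, x\<^sub>n, E\<^sub>n)\<close> is encoded as the edge \<open>E\<^sub>0\<close> together with the list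
  \<open>[(x\<^sub>1, E\<^sub>1), \<dots>, (x\<^sub>n, E\<^sub>n)]\<close>, whose length is the length \<open>n\<close> of the chain.
\<close>

definition chain_edges :: "'v set \<Rightarrow> ('v \<times> 'v set) list \<Rightarrow> 'v set list" where
  "chain_edges E0 ps = E0 # map snd ps"

definition chain_verts :: "('v \<times> 'v set) list \<Rightarrow> 'v list" where
  "chain_verts ps = map fst ps"

text \<open>
  Below, \<open>chain_verts ps ! k\<close> is the vertex \<open>x\<^sub>k\<^sub>+\<^sub>1\<close>; the conditions \<open>x\<^sub>1 \<in> E\<^sub>0\<close>, \<open>x\<^sub>n \<in> E\<^sub>n\<close> and
  \<open>x\<^sub>k, x\<^sub>k\<^sub>+\<^sub>1 \<in> E\<^sub>k\<close> (\<open>1 \<le> k \<le> n - 1\<close>) together say that \<open>x\<^sub>k\<^sub>+\<^sub>1 \<in> E\<^sub>k \<inter> E\<^sub>k\<^sub>+\<^sub>1\<close> for all \<open>0 \<le> k < n\<close>.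
\<close>

definition is_chain ::
  "'v::finite set set \<Rightarrow> 'v set \<Rightarrow> 'v set \<Rightarrow> ('v \<times> 'v set) list \<Rightarrow> bool" where
  "is_chain H E E' ps \<longleftrightarrow>
     set (chain_edges E ps) \<subseteq> H \<and> last (chain_edges E ps) = E' \<and>
     distinct (chain_verts ps) \<and> distinct (chain_edges E ps) \<and>
     (\<forall>k<length ps. chain_verts ps ! k \<in> chain_edges E ps ! k \<and>
                    chain_verts ps ! k \<in> chain_edges E ps ! Suc k)"

definition proper_chain ::
  "nat \<Rightarrow> 'v::finite set set \<Rightarrow> 'v set \<Rightarrow> 'v set \<Rightarrow> ('v \<times> 'v set) list \<Rightarrow> bool" where
  "proper_chain d H E E' ps \<longleftrightarrow> is_chain H E E' ps \<and>
     (\<forall>k<length ps. card (chain_edges E ps ! k \<inter> chain_edges E ps ! Suc k) = d - 1)"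

text \<open>The alternating sequence itself, used to speak of its subsequences.\<close>

definition chain_seq :: "'v set \<Rightarrow> ('v \<times> 'v set) list \<Rightarrow> ('v set + 'v) list" where
  "chain_seq E0 ps = Inl E0 # concat (map (\<lambda>(x, E). [Inr x, Inl E]) ps)"

definition irredundant_chain ::
  "nat \<Rightarrow> 'v::finite set set \<Rightarrow> 'v set \<Rightarrow> 'v set \<Rightarrow> ('v \<times> 'v set) list \<Rightarrow> bool" where
  "irredundant_chain d H E E' ps \<longleftrightarrow> proper_chain d H E E' ps \<and>
     (\<nexists>qs. proper_chain d H E E' qs \<and> strict_subseq (chain_seq E qs) (chain_seq E ps))"

text \<open>The infimum of the empty set in \<open>enat\<close> is \<open>\<infinity>\<close>.\<close>

definition edge_dist :: "nat \<Rightarrow> 'v::finite set set \<Rightarrow> 'v set \<Rightarrow> 'v set \<Rightarrow> enat" where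
  "edge_dist d H E E' = Inf {enat (length ps) |ps. irredundant_chain d H E E' ps}"

definition properly_connected :: "'v::finite set set \<Rightarrow> bool" where
  "properly_connected H \<longleftrightarrow> (\<exists>d. uniform d H \<and>
     (\<forall>E\<in>H. \<forall>E'\<in>H. E \<inter> E' \<noteq> {} \<longrightarrow> edge_dist d H E E' = enat (d - card (E \<inter> E'))))"

definition edge_nbhd :: "nat \<Rightarrow> 'v::finite set set \<Rightarrow> 'v set \<Rightarrow> 'v set" where
  "edge_nbhd d H E = (\<Union>F\<in>{F\<in>H. edge_dist d H E F = 1}. F - E)"


section \<open>Monomial ideals and splittings\<close>

text \<open>
  A monomial in the variables \<open>'v\<close> is represented by the finite multiset of its variables:
  the product of monomials is the sum of multisets, divisibility is \<open>\<subseteq>#\<close>, the least common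
  multiple is \<open>\<union>#\<close> (\<open>Sup\<close> for sets of monomials), and the degree is \<open>size\<close>. The
  polynomial ring over \<open>'k\<close> is the monoid algebra of the multisets.
\<close>

type_synonym ('v, 'k) mpoly = "'v multiset \<Rightarrow>\<^sub>0 'k"

definition monom :: "'v::finite multiset \<Rightarrow> ('v, 'k::field) mpoly" where
  "monom m = Poly_Mapping.single m 1"

definition indet :: "'v::finite \<Rightarrow> ('v, 'k::field) mpoly" where
  "indet x = monom {#x#}"

definition ideal_gen :: "('v::finite, 'k::field) mpoly set \<Rightarrow> ('v, 'k) mpoly set" where
  "ideal_gen S = module.span (*) S"

definition monomial_ideal :: "('v::finite, 'k::field) mpoly set \<Rightarrow> bool" where
  "monomial_ideal I \<longleftrightarrow> (\<exists>S. I = ideal_gen (monom ` S))"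

definition min_gens :: "('v::finite, 'k::field) mpoly set \<Rightarrow> 'v multiset set" where
  "min_gens I = (THE G. ideal_gen (monom ` G) = I \<and> (\<forall>G'. G' \<subset> G \<longrightarrow> ideal_gen (monom ` G') \<noteq> I))"

definition is_splitting ::
  "('v::finite, 'k::field) mpoly set \<Rightarrow> ('v, 'k) mpoly set \<Rightarrow> ('v, 'k) mpoly set \<Rightarrow> bool" where
  "is_splitting I J K \<longleftrightarrow>
     monomial_ideal I \<and> monomial_ideal J \<and> monomial_ideal K \<and> J \<noteq> {0} \<and> K \<noteq> {0} \<and>
     I = {a + b |a b. a \<in> J \<and> b \<in> K} \<and>
     min_gens I = min_gens J \<union> min_gens K \<and> min_gens J \<inter> min_gens K = {} \<and>
     (\<exists>\<phi> \<psi>.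
        (\<forall>w\<in>min_gens (J \<inter> K).
           \<phi> w \<in> min_gens J \<and> \<psi> w \<in> min_gens K \<and> w = \<phi> w \<union># \<psi> w) \<and>
        (\<forall>S. S \<noteq> {} \<and> S \<subseteq> min_gens (J \<inter> K) \<longrightarrow>
           Sup (\<phi> ` S) \<subset># Sup S \<and> Sup (\<psi> ` S) \<subset># Sup S))"

definition edge_mono :: "'v::finite set \<Rightarrow> ('v, 'k::field) mpoly" where
  "edge_mono E = (\<Prod>x\<in>E. indet x)"

definition edge_ideal :: "'v::finite set set \<Rightarrow> ('v, 'k::field) mpoly set" where
  "edge_ideal H = ideal_gen (edge_mono ` H)"

text \<open>The type argument fixes the coefficient field of the ideals.\<close>

definition splitting_edge :: "'k::field itself \<Rightarrow> 'v::finite set set \<Rightarrow> 'v set \<Rightarrow> bool" where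
  "splitting_edge _ H E \<longleftrightarrow> E \<in> H \<and>
     is_splitting (edge_ideal H :: ('v, 'k) mpoly set) (ideal_gen {edge_mono E}) (edge_ideal (H - {E}))"


section \<open>Minimal graded free resolutions and graded Betti numbers\<close>

text \<open>
  Elements of free modules are finitely supported coordinate vectors indexed by \<open>nat\<close>; the
  free module with basis \<open>B\<close> consists of the vectors supported on \<open>B\<close>. If the basis
  vector \<open>b\<close> has degree \<open>D b\<close>, this is the graded module \<open>\<Oplus>\<^sub>b R(-D b)\<close>.
\<close>

type_synonym ('v, 'k) vec = "nat \<Rightarrow>\<^sub>0 ('v, 'k) mpoly"

definition vec_scale :: "('v::finite, 'k::field) mpoly \<Rightarrow> ('v, 'k) vec \<Rightarrow> ('v, 'k) vec" where
  "vec_scale p u = Poly_Mapping.map ((*) p) u"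

definition free_mod :: "nat set \<Rightarrow> ('v::finite, 'k::field) vec set" where
  "free_mod B = {u. Poly_Mapping.keys u \<subseteq> B}"

definition homog :: "int \<Rightarrow> ('v::finite, 'k::field) mpoly set" where
  "homog j = {p. \<forall>m\<in>Poly_Mapping.keys p. int (size m) = j}"

definition free_homog :: "nat set \<Rightarrow> (nat \<Rightarrow> int) \<Rightarrow> int \<Rightarrow> ('v::finite, 'k::field) vec set" where
  "free_homog B D j = {u \<in> free_mod B. \<forall>b\<in>B. Poly_Mapping.lookup u b \<in> homog (j - D b)}"

definition irrelevant_ideal :: "('v::finite, 'k::field) mpoly set" where
  "irrelevant_ideal = ideal_gen (range indet)"

text \<open>
  \<open>\<dots> \<longrightarrow> F\<^sub>2 \<longrightarrow> F\<^sub>1 \<longrightarrow> F\<^sub>0 \<longrightarrow> I \<longrightarrow> 0\<close>, where \<open>F\<^sub>i\<close> is free on \<open>B i\<close> with degrees \<open>D i\<close>,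
  \<open>\<epsilon> : F\<^sub>0 \<longrightarrow> I\<close> and \<open>\<delta> i : F\<^sub>i\<^sub>+\<^sub>1 \<longrightarrow> F\<^sub>i\<close>. The maps are module homomorphisms on all
  coordinate vectors, which is no restriction because \<open>free_mod (B i)\<close> is a direct summand.
  Finite rank of the \<open>F\<^sub>i\<close> is not demanded: \<open>R\<close> is Noetherian and \<open>I\<close> is finitely
  generated, so minimality forces it.
\<close>

locale minimal_graded_free_resolution =
  fixes I :: "('v::finite, 'k::field) mpoly set"
    and B :: "nat \<Rightarrow> nat set"
    and D :: "nat \<Rightarrow> nat \<Rightarrow> int"
    and \<delta> :: "nat \<Rightarrow> ('v, 'k) vec \<Rightarrow> ('v, 'k) vec"
    and \<epsilon> :: "('v, 'k) vec \<Rightarrow> ('v, 'k) mpoly"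
  assumes hom_aug: "module_hom vec_scale (*) \<epsilon>"
    and hom_diff: "module_hom vec_scale vec_scale (\<delta> i)"
    and degree_aug: "\<epsilon> ` free_homog (B 0) (D 0) j \<subseteq> homog j"
    and degree_diff:
      "\<delta> i ` free_homog (B (Suc i)) (D (Suc i)) j \<subseteq> free_homog (B i) (D i) j"
    and surj_aug: "\<epsilon> ` free_mod (B 0) = I"
    and exact_aug: "{u \<in> free_mod (B 0). \<epsilon> u = 0} = \<delta> 0 ` free_mod (B 1)"
    and exact_diff:
      "{u \<in> free_mod (B (Suc i)). \<delta> i u = 0} = \<delta> (Suc i) ` free_mod (B (Suc (Suc i)))"
    and minimal:
      "u \<in> free_mod (B (Suc i)) \<Longrightarrow> Poly_Mapping.lookup (\<delta> i u) b \<in> irrelevant_ideal"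

text \<open>
  \<open>betti I i j\<close> is the number of summands \<open>R(-j)\<close> of \<open>F\<^sub>i\<close> in a minimal graded free
  resolution of the homogeneous ideal \<open>I\<close>; it does not depend on the resolution.
\<close>

definition betti :: "('v::finite, 'k::field) mpoly set \<Rightarrow> nat \<Rightarrow> int \<Rightarrow> nat" where
  "betti I i j = (THE n. \<exists>B D \<delta> \<epsilon>. minimal_graded_free_resolution I B D \<delta> \<epsilon> \<and>
                                 n = card {b \<in> B i. D i b = j})"

text \<open>
  The extension to homological degree \<open>-1\<close> by the convention \<open>\<beta>\<^sub>-\<^sub>1\<^sub>,\<^sub>0 = 1\<close> and
  \<open>\<beta>\<^sub>-\<^sub>1\<^sub>,\<^sub>j = 0\<close> for \<open>j \<noteq> 0\<close>, which also applies to the zero ideal.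
\<close>

definition betti_ext :: "('v::finite, 'k::field) mpoly set \<Rightarrow> int \<Rightarrow> int \<Rightarrow> nat" where
  "betti_ext I i j =
     (if i \<ge> 0 then betti I (nat i) j else if i = -1 \<and> j = 0 then 1 else 0)"

end

theory Submission
  imports Defs "HOL-Library.Countable_Set"
begin

text \<open>
  Let \<open>\<mm>\<close> be the irrelevant ideal. A minimal resolution of an ideal \<open>I \<subseteq> \<mm>\<close>, continued by \<open>R\<close>, is a minimal resolution of
  \<open>R/I\<close>. So the Betti numbers of \<open>I\<close> are those of \<open>R/I\<close>, shifted by one homological degree, and the convention for
  \<open>\<beta>\<^sub>-\<^sub>1\<close> says that the resolution of \<open>R/I\<close> begins with \<open>R\<close>. The proof computes with \<open>R/I\<close> throughout.

  Put \<open>m = x\<^sup>E\<close>, \<open>K = I(H - {E})\<close> and \<open>L = (K : m)\<close>, so that \<open>I(H) = K + (m)\<close>. Multiplication by \<open>m\<close> gives an exact sequence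
  \<open>0 \<longrightarrow> R/L(-d) \<longrightarrow> R/K \<longrightarrow> R/I(H) \<longrightarrow> 0\<close>. Lift this multiplication to a chain map \<open>f\<close> between the minimal resolutions of
  \<open>R/L\<close> and \<open>R/K\<close>. The mapping cone of \<open>f\<close> resolves \<open>R/I(H)\<close>, and it is minimal if the entries of \<open>f\<close> lie in \<open>\<mm>\<close>
  (\<open>mapping_cone\<close>); in this case the Betti numbers of \<open>R/K\<close> and the shifted ones of \<open>R/L\<close> add up to those of \<open>R/I(H)\<close>.

  The splitting provides such an \<open>f\<close> (\<open>quotient_betti_splitting\<close>). The ideal \<open>L\<close> is generated by the quotients \<open>w/m\<close>,
  where \<open>w\<close> ranges over the minimal generators of \<open>(m) \<inter> K\<close>. Between Taylor resolutions, \<open>w/m \<mapsto> \<psi>(w)\<close> induces an explicit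
  lift whose coefficients are the quotients of \<open>lcm(w\<^sub>1, \<dots>, w\<^sub>n)\<close> by \<open>lcm(\<psi>(w\<^sub>1), \<dots>, \<psi>(w\<^sub>n))\<close>. Strict divisibility
  puts them into \<open>\<mm>\<close>, and composition with comparison maps to and from the minimal resolutions leaves them there.

  Proper connectedness identifies \<open>L\<close>: it is generated by the variables in \<open>N(E)\<close> and by the edges of \<open>H'\<close>, and these
  edges avoid \<open>N(E)\<close> (\<open>colon_generators\<close>, \<open>far_edge_disjoint\<close>). To adjoin a variable that does not occur in the other
  generators is again a mapping cone, over multiplication by the variable. Doing this \<open>t\<close> times produces the binomial
  coefficients (\<open>quotient_betti_variables\<close>).

  Betti numbers are read off from any minimal resolution, so one also needs that minimal resolutions exist
  (\<open>minimal_resolution_exists\<close>) and that their ranks are unique (\<open>minimal_resolution_rank_unique\<close>).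
\<close>

abbreviation "lookup \<equiv> Poly_Mapping.lookup"
abbreviation "keys \<equiv> Poly_Mapping.keys"
abbreviation "single \<equiv> Poly_Mapping.single"

section \<open>Free modules and linear extension\<close>

definition vscale :: "'a::comm_ring_1 \<Rightarrow> ('b \<Rightarrow>\<^sub>0 'a) \<Rightarrow> ('b \<Rightarrow>\<^sub>0 'a)" where
  "vscale p u = Poly_Mapping.map ((*) p) u"

lemma lookup_vscale [simp]: "lookup (vscale p u) b = p * lookup u b"
  by (simp add: vscale_def map.rep_eq when_def)

lemma vscale_module: "module (vscale :: 'a::comm_ring_1 \<Rightarrow> ('b \<Rightarrow>\<^sub>0 'a) \<Rightarrow> _)"
  by unfold_locales (auto intro!: poly_mapping_eqI simp: lookup_add algebra_simps)

interpretation vm: module "vscale :: 'a::comm_ring_1 \<Rightarrow> ('b \<Rightarrow>\<^sub>0 'a) \<Rightarrow> _"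
  by (rule vscale_module)

lemma vscale_single: "vscale p (single b q) = single b (p * q)"
  by (rule poly_mapping_eqI) (auto simp: lookup_single when_def)

lemma keys_vscale: "keys (vscale p u) \<subseteq> keys u"
  by (auto simp: in_keys_iff)

lemma sum_single_eq:
  assumes "finite S" "keys u \<subseteq> S"
  shows "(\<Sum>b\<in>S. single b (lookup u b)) = (u :: 'b \<Rightarrow>\<^sub>0 'a::comm_monoid_add)"
proof (rule poly_mapping_eqI)
  fix k
  have "lookup (\<Sum>b\<in>S. single b (lookup u b)) k = (\<Sum>b\<in>S. if b = k then lookup u b else 0)"
    by (simp add: lookup_sum lookup_single when_def)
  also have "\<dots> = lookup u k"
    using assms by (auto simp: sum.delta in_keys_iff)
  finally show "lookup (\<Sum>b\<in>S. single b (lookup u b)) k = lookup u k" .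
qed

text \<open>
  Homomorphisms between free modules are given by their columns, the images \<open>f b\<close> of the basis
  vectors; every homomorphism arises in this way by \<open>hom_eq_lin\<close>.
\<close>

definition lin :: "('b \<Rightarrow> ('c \<Rightarrow>\<^sub>0 'a)) \<Rightarrow> ('b \<Rightarrow>\<^sub>0 'a) \<Rightarrow> ('c \<Rightarrow>\<^sub>0 'a::comm_ring_1)" where
  "lin f u = (\<Sum>b\<in>keys u. vscale (lookup u b) (f b))"

lemma lin_superset:
  assumes "finite S" "keys u \<subseteq> S"
  shows "lin f u = (\<Sum>b\<in>S. vscale (lookup u b) (f b))"
  unfolding lin_def
  by (rule sum.mono_neutral_left) (use assms in \<open>auto simp: in_keys_iff\<close>)

lemma lookup_lin: "lookup (lin f u) c = (\<Sum>b\<in>keys u. lookup u b * lookup (f b) c)"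
  by (simp add: lin_def lookup_sum)

lemma lin_zero [simp]: "lin f 0 = 0"
  by (simp add: lin_def)

lemma lin_add: "lin f (u + v) = lin f u + lin f v"
proof -
  let ?S = "keys u \<union> keys v"
  have "lin f (u + v) = (\<Sum>b\<in>?S. vscale (lookup (u + v) b) (f b))"
    by (rule lin_superset) (use keys_add[of u v] in auto)
  also have "\<dots> = (\<Sum>b\<in>?S. vscale (lookup u b) (f b)) + (\<Sum>b\<in>?S. vscale (lookup v b) (f b))"
    by (simp add: lookup_add vm.scale_left_distrib sum.distrib)
  also have "\<dots> = lin f u + lin f v"
    by (subst (1 2) lin_superset[of ?S]) auto
  finally show ?thesis .
qed

lemma lin_vscale: "lin f (vscale p u) = vscale p (lin f u)"
  by (subst lin_superset[of "keys u"])
    (auto simp: keys_vscale vm.scale_sum_right lin_def)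

lemma lin_hom: "module_hom vscale vscale (lin f)"
  by (simp add: module_hom_iff vscale_module lin_add lin_vscale)

lemma lin_minus: "lin f (- u) = - lin f u"
  by (rule module_hom.neg[OF lin_hom])

lemma lin_diff: "lin f (u - v) = lin f u - lin f v"
  by (rule module_hom.diff[OF lin_hom])

lemma lin_sum: "lin f (sum g A) = (\<Sum>a\<in>A. lin f (g a))"
  by (rule module_hom.sum[OF lin_hom])

lemma lin_single [simp]: "lin f (single b p) = vscale p (f b)"
  by (subst lin_superset[of "{b}"]) auto

lemma hom_eq_lin:
  assumes "module_hom vscale vscale h"
  shows "h u = lin (\<lambda>b. h (single b 1)) u"
proof -
  have "h u = h (\<Sum>b\<in>keys u. vscale (lookup u b) (single b 1))"
    by (simp add: vscale_single sum_single_eq)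
  also have "\<dots> = (\<Sum>b\<in>keys u. vscale (lookup u b) (h (single b 1)))"
    using assms by (simp add: module_hom.sum module_hom.scale)
  finally show ?thesis by (simp add: lin_def)
qed

lemma lin_lin: "lin f (lin g u) = lin (\<lambda>b. lin f (g b)) u"
  by (simp add: lin_def[of g] lin_sum lin_vscale) (simp add: lin_def[of "\<lambda>b. lin f (g b)"])

lemma lin_cong: "(\<And>b. b \<in> keys u \<Longrightarrow> f b = g b) \<Longrightarrow> lin f u = lin g u"
  by (simp add: lin_def)

lemma lin_single_id [simp]: "lin (\<lambda>b. single b 1) u = u"
  by (simp add: lin_def vscale_single sum_single_eq)

lemma lin_fun_add: "lin (\<lambda>b. f b + g b) u = lin f u + lin g u"
  by (simp add: lin_def vm.scale_right_distrib sum.distrib)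

lemma lin_fun_diff: "lin (\<lambda>b. f b - g b) u = lin f u - lin g u"
  by (simp add: lin_def vm.scale_right_diff_distrib sum_subtractf)

lemma lin_fun_zero [simp]: "lin (\<lambda>b. 0) u = 0"
  by (simp add: lin_def)

lemma lin_fun_vscale: "lin (\<lambda>b. vscale p (f b)) u = vscale p (lin f u)"
  by (simp add: lin_def vm.scale_sum_right mult.commute)

definition free :: "'b set \<Rightarrow> ('b \<Rightarrow>\<^sub>0 'a::comm_ring_1) set" where
  "free X = {u. keys u \<subseteq> X}"

lemma free_subspace: "vm.subspace (free X)"
  unfolding free_def
  by (rule vm.subspaceI) (auto simp: subset_iff in_keys_iff lookup_add, metis add.right_neutral, metis mult_zero_right)

lemmas free_rules =
  vm.subspace_0[OF free_subspace] vm.subspace_add[OF free_subspace]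
  vm.subspace_scale[OF free_subspace] vm.subspace_neg[OF free_subspace]
  vm.subspace_diff[OF free_subspace] vm.subspace_sum[OF free_subspace]

lemma single_free: "b \<in> X \<Longrightarrow> single b p \<in> free X"
  by (auto simp: free_def)

lemma lin_in_subspace:
  assumes "vm.subspace V" "\<And>b. b \<in> keys u \<Longrightarrow> f b \<in> V"
  shows "lin f u \<in> V"
  unfolding lin_def using assms by (intro vm.subspace_sum vm.subspace_scale)

lemma lin_free: "u \<in> free X \<Longrightarrow> (\<And>b. b \<in> X \<Longrightarrow> f b \<in> free Y) \<Longrightarrow> lin f u \<in> free Y"
  by (rule lin_in_subspace[OF free_subspace]) (auto simp: free_def)

lemma lin_free_cong: "u \<in> free X \<Longrightarrow> (\<And>b. b \<in> X \<Longrightarrow> f b = g b) \<Longrightarrow> lin f u = lin g u"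
  by (rule lin_cong) (auto simp: free_def)

section \<open>Constant terms\<close>

definition const :: "('v multiset \<Rightarrow>\<^sub>0 'k::field) \<Rightarrow> 'k" where
  "const p = lookup p {#}"

lemma const_simps [simp]:
  "const 0 = 0" "const 1 = 1" "const (- p) = - const p"
  "const (p + q) = const p + const q" "const (p - q) = const p - const q"
  by (simp_all add: const_def lookup_add lookup_minus lookup_one)

lemma const_sum: "const (sum f A) = (\<Sum>a\<in>A. const (f a))"
  by (simp add: const_def lookup_sum)

lemma const_single: "const (single m a) = (if m = {#} then a else 0)"
  by (simp add: const_def lookup_single when_def)

lemma const_mult [simp]: "const (p * q) = const p * const q"
proof -
  have "p * q = (\<Sum>a\<in>keys p. single a (lookup p a)) * (\<Sum>b\<in>keys q. single b (lookup q b))"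
    by (simp add: sum_single_eq)
  then have "const (p * q) = (\<Sum>a\<in>keys p. \<Sum>b\<in>keys q. const (single a (lookup p a) * single b (lookup q b)))"
    by (simp only: sum_product const_sum)
  also have "\<dots> = (\<Sum>a\<in>keys p. \<Sum>b\<in>keys q. const (single a (lookup p a)) * const (single b (lookup q b)))"
    by (intro sum.cong refl) (auto simp: mult_single const_single)
  also have "\<dots> = const (\<Sum>a\<in>keys p. single a (lookup p a)) * const (\<Sum>b\<in>keys q. single b (lookup q b))"
    by (simp only: sum_product const_sum)
  finally show ?thesis
    by (simp add: sum_single_eq)
qed

text \<open>
  The vectors with all coordinates in the irrelevant ideal \<open>\<mm>\<close>, which is the set of polynomials
  without constant term (\<open>irrelevant_ideal_const\<close>).
\<close>

definition mfree :: "('b \<Rightarrow>\<^sub>0 ('v multiset \<Rightarrow>\<^sub>0 'k::field)) set" where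
  "mfree = {u. \<forall>b. const (lookup u b) = 0}"

lemma mfree_subspace: "vm.subspace mfree"
  unfolding mfree_def by (rule vm.subspaceI) (auto simp: lookup_add)

lemma lin_mfree: "u \<in> mfree \<Longrightarrow> lin f u \<in> mfree"
  by (auto simp: mfree_def lookup_lin const_sum)

lemma lin_columns_mfree:
  "u \<in> free X \<Longrightarrow> (\<And>b. b \<in> X \<Longrightarrow> f b \<in> mfree) \<Longrightarrow> lin f u \<in> mfree"
  by (rule lin_in_subspace[OF mfree_subspace]) (auto simp: free_def)

section \<open>Grading\<close>

definition hpart :: "int \<Rightarrow> ('v multiset \<Rightarrow>\<^sub>0 'k::field) \<Rightarrow> ('v multiset \<Rightarrow>\<^sub>0 'k)" where
  "hpart j p = Poly_Mapping.mapp (\<lambda>m c. if int (size m) = j then c else 0) p"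

lemma lookup_hpart: "lookup (hpart j p) m = (if int (size m) = j then lookup p m else 0)"
  by (auto simp: hpart_def lookup_mapp when_def in_keys_iff)

lemma homog_iff: "p \<in> homog j \<longleftrightarrow> (\<forall>m. lookup p m \<noteq> 0 \<longrightarrow> int (size m) = j)"
  by (auto simp: homog_def in_keys_iff)

lemma hpart_homog: "hpart j p \<in> homog j"
  by (simp add: homog_iff lookup_hpart)

lemma hpart_id: "p \<in> homog i \<Longrightarrow> hpart j p = (if i = j then p else 0)"
  by (rule poly_mapping_eqI) (auto simp: homog_iff lookup_hpart)

lemma hpart_add: "hpart j (p + q) = hpart j p + hpart j q"
  by (rule poly_mapping_eqI) (simp add: lookup_hpart lookup_add)

lemma hpart_zero [simp]: "hpart j 0 = 0"
  by (rule poly_mapping_eqI) (simp add: lookup_hpart)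

lemma homog_add: "p \<in> homog j \<Longrightarrow> q \<in> homog j \<Longrightarrow> p + q \<in> homog j"
  unfolding homog_iff lookup_add by (metis add.right_neutral)

lemma homog_zero [simp]: "0 \<in> homog j"
  by (simp add: homog_def)

lemma homog_single: "int (size m) = j \<Longrightarrow> single m a \<in> homog j"
  by (auto simp: homog_def)

lemma homog_minus: "p \<in> homog j \<Longrightarrow> - p \<in> homog j"
  by (simp add: homog_iff)

lemma homog_mult: "p \<in> homog i \<Longrightarrow> q \<in> homog j \<Longrightarrow> p * q \<in> homog (i + j)"
  using keys_mult[of p q] by (fastforce simp: homog_def)

lemma hpart_mult_homog:
  assumes "q \<in> homog i"
  shows "hpart j (p * q) = hpart (j - i) p * q"
proof -
  have "hpart j ((\<Sum>m\<in>S. single m (lookup p m)) * q) = hpart (j - i) (\<Sum>m\<in>S. single m (lookup p m)) * q"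
    if "finite S" for S
    using that
  proof (induction S)
    case (insert m S)
    have "single m (lookup p m) * q \<in> homog (int (size m) + i)"
      by (intro homog_mult assms homog_single) simp
    then have "hpart j (single m (lookup p m) * q) = hpart (j - i) (single m (lookup p m)) * q"
      by (subst hpart_id, assumption, subst hpart_id[of _ "int (size m)"]) (auto intro: homog_single)
    then show ?case using insert by (simp add: distrib_right hpart_add)
  qed simp
  from this[of "keys p"] show ?thesis by (simp add: sum_single_eq)
qed

definition hvec :: "'b set \<Rightarrow> ('b \<Rightarrow> int) \<Rightarrow> int \<Rightarrow> ('b \<Rightarrow>\<^sub>0 ('v::finite multiset \<Rightarrow>\<^sub>0 'k::field)) set" where
  "hvec X D j = {u \<in> free X. \<forall>b. lookup u b \<in> homog (j - D b)}"

definition hcomp :: "('b \<Rightarrow> int) \<Rightarrow> int \<Rightarrow> ('b \<Rightarrow>\<^sub>0 ('v::finite multiset \<Rightarrow>\<^sub>0 'k::field)) \<Rightarrow> ('b \<Rightarrow>\<^sub>0 ('v multiset \<Rightarrow>\<^sub>0 'k))" where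
  "hcomp D j u = Poly_Mapping.mapp (\<lambda>b p. hpart (j - D b) p) u"

lemma lookup_hcomp: "lookup (hcomp D j u) b = hpart (j - D b) (lookup u b)"
  by (auto simp: hcomp_def lookup_mapp when_def in_keys_iff)

lemma hcomp_add: "hcomp D j (u + v) = hcomp D j u + hcomp D j v"
  by (rule poly_mapping_eqI) (simp add: lookup_hcomp lookup_add hpart_add)

lemma hcomp_zero [simp]: "hcomp D j 0 = 0"
  by (rule poly_mapping_eqI) (simp add: lookup_hcomp)

lemma hcomp_sum: "hcomp D j (sum f A) = (\<Sum>a\<in>A. hcomp D j (f a))"
  by (induction A rule: infinite_finite_induct) (auto simp: hcomp_add)

lemma hcomp_free: "u \<in> free X \<Longrightarrow> hcomp D j u \<in> free X"
  by (auto simp: free_def in_keys_iff lookup_hcomp) (metis hpart_zero in_keys_iff subsetD)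

lemma hcomp_hvec: "u \<in> free X \<Longrightarrow> hcomp D j u \<in> hvec X D j"
  by (auto simp: hvec_def hcomp_free lookup_hcomp hpart_homog)

lemma hvec_free: "u \<in> hvec X D j \<Longrightarrow> u \<in> free X"
  by (simp add: hvec_def)

lemma hcomp_id: "u \<in> hvec X D i \<Longrightarrow> hcomp D j u = (if i = j then u else 0)"
proof (rule poly_mapping_eqI)
  fix k assume "u \<in> hvec X D i"
  then have "lookup u k \<in> homog (i - D k)" by (simp add: hvec_def)
  from hpart_id[OF this, of "j - D k"]
  show "lookup (hcomp D j u) k = lookup (if i = j then u else 0) k"
    by (simp add: lookup_hcomp)
qed

lemma hvec_add: "u \<in> hvec X D j \<Longrightarrow> v \<in> hvec X D j \<Longrightarrow> u + v \<in> hvec X D j"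
  by (simp add: hvec_def lookup_add homog_add free_rules)

lemma hvec_zero [simp]: "0 \<in> hvec X D j"
  by (simp add: hvec_def free_rules)

lemma hvec_sum: "(\<And>a. a \<in> A \<Longrightarrow> f a \<in> hvec X D j) \<Longrightarrow> sum f A \<in> hvec X D j"
  by (induction A rule: infinite_finite_induct) (auto simp: hvec_add)

lemma hvec_minus: "u \<in> hvec X D j \<Longrightarrow> - u \<in> hvec X D j"
  by (simp add: hvec_def homog_minus free_rules)

lemma hvec_vscale: "p \<in> homog i \<Longrightarrow> u \<in> hvec X D j \<Longrightarrow> vscale p u \<in> hvec X D (i + j)"
  using homog_mult[of p i] by (auto simp: hvec_def free_rules add_diff_eq[symmetric])

lemma hvec_single: "b \<in> X \<Longrightarrow> p \<in> homog i \<Longrightarrow> single b p \<in> hvec X D (i + D b)"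
  by (auto simp: hvec_def single_free lookup_single when_def)

lemma lin_hvec:
  assumes "u \<in> hvec X D j" "\<And>b. b \<in> X \<Longrightarrow> f b \<in> hvec Y D' (D b + e)"
  shows "lin f u \<in> hvec Y D' (j + e)"
  unfolding lin_def
proof (rule hvec_sum)
  fix b assume "b \<in> keys u"
  then have "b \<in> X" "lookup u b \<in> homog (j - D b)"
    using assms(1) by (auto simp: hvec_def free_def)
  from hvec_vscale[OF this(2) assms(2)[OF this(1)]]
  show "vscale (lookup u b) (f b) \<in> hvec Y D' (j + e)" by (simp add: algebra_simps)
qed

lemma hcomp_lin:
  assumes "u \<in> free X" "\<And>b. b \<in> X \<Longrightarrow> f b \<in> hvec Y D' (D b + e)"
  shows "hcomp D' (j + e) (lin f u) = lin f (hcomp D j u)"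
proof -
  have *: "hcomp D' (j + e) (vscale (lookup u b) (f b)) = vscale (hpart (j - D b) (lookup u b)) (f b)"
    if "b \<in> keys u" for b
  proof (rule poly_mapping_eqI)
    fix c
    have "lookup (f b) c \<in> homog (D b + e - D' c)"
      using assms that by (auto simp: hvec_def free_def)
    from hpart_mult_homog[OF this, of "j + e - D' c" "lookup u b"]
    show "lookup (hcomp D' (j + e) (vscale (lookup u b) (f b))) c =
        lookup (vscale (hpart (j - D b) (lookup u b)) (f b)) c"
      by (simp add: lookup_hcomp)
  qed
  have "hcomp D' (j + e) (lin f u) = (\<Sum>b\<in>keys u. vscale (hpart (j - D b) (lookup u b)) (f b))"
    by (simp add: lin_def hcomp_sum *)
  also have "\<dots> = lin f (hcomp D j u)"
    by (subst lin_superset[of "keys u"]) (auto simp: lookup_hcomp in_keys_iff)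
  finally show ?thesis .
qed

lemma sum_hcomp: "\<exists>J. finite J \<and> (\<Sum>j\<in>J. hcomp D j u) = u"
proof -
  let ?J = "\<Union>b\<in>keys u. (\<lambda>m. int (size m) + D b) ` keys (lookup u b)"
  have "(\<Sum>j\<in>?J. hcomp D j u) = u"
  proof (intro poly_mapping_eqI)
    fix b m
    have fin: "finite ?J" by simp
    have "lookup (lookup (\<Sum>j\<in>?J. hcomp D j u) b) m =
        (\<Sum>j\<in>?J. if int (size m) + D b = j then lookup (lookup u b) m else 0)"
      unfolding lookup_sum lookup_hcomp lookup_hpart by (intro sum.cong refl) auto
    also have "\<dots> = (if int (size m) + D b \<in> ?J then lookup (lookup u b) m else 0)"
      by (rule sum.delta'[OF fin])
    also have "\<dots> = lookup (lookup u b) m"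
      by (cases "lookup (lookup u b) m = 0"; force simp: in_keys_iff)
    finally show "lookup (lookup (\<Sum>j\<in>?J. hcomp D j u) b) m = lookup (lookup u b) m" .
  qed
  then show ?thesis by (intro exI[of _ ?J]) simp
qed

section \<open>Graded resolutions and comparison maps\<close>

text \<open>
  The map \<open>F\<^sub>n\<^sub>+\<^sub>1 \<longrightarrow> F\<^sub>n\<close> has the columns \<open>c n\<close>, so the index is that of the target. The index type of
  the bases is arbitrary: besides \<open>nat\<close>, sum types are needed for mapping cones, and lists for the Taylor
  complex.
\<close>

locale graded_complex =
  fixes X :: "nat \<Rightarrow> 'b set" and D :: "nat \<Rightarrow> 'b \<Rightarrow> int"
    and c :: "nat \<Rightarrow> 'b \<Rightarrow> ('b \<Rightarrow>\<^sub>0 ('v::finite multiset \<Rightarrow>\<^sub>0 'k::field))"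
  assumes column: "b \<in> X (Suc n) \<Longrightarrow> c n b \<in> hvec (X n) (D n) (D (Suc n) b)"
    and column_column: "b \<in> X (Suc (Suc n)) \<Longrightarrow> lin (c n) (c (Suc n) b) = 0"
begin

lemma column_free: "b \<in> X (Suc n) \<Longrightarrow> c n b \<in> free (X n)"
  using column hvec_free by blast

lemma boundary_free: "u \<in> free (X (Suc n)) \<Longrightarrow> lin (c n) u \<in> free (X n)"
  by (erule lin_free) (rule column_free)

lemma boundary_boundary:
  assumes "u \<in> free (X (Suc (Suc n)))"
  shows "lin (c n) (lin (c (Suc n)) u) = 0"
proof -
  have "lin (\<lambda>b. lin (c n) (c (Suc n) b)) u = lin (\<lambda>b. 0) u"
    by (rule lin_free_cong[OF assms]) (rule column_column)
  then show ?thesis by (simp add: lin_lin)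
qed

lemma boundary_hvec: "u \<in> hvec (X (Suc n)) (D (Suc n)) j \<Longrightarrow> lin (c n) u \<in> hvec (X n) (D n) j"
  using lin_hvec[of u "X (Suc n)" "D (Suc n)" j "c n" "X n" "D n" 0] column by simp

lemma boundary_hcomp:
  "u \<in> free (X (Suc n)) \<Longrightarrow> lin (c n) (hcomp (D (Suc n)) j u) = hcomp (D n) j (lin (c n) u)"
  using hcomp_lin[of u "X (Suc n)" "c n" "X n" "D n" "D (Suc n)" 0 j] column by simp

end

text \<open>
  A resolution of \<open>R/I\<close> that begins with \<open>F\<^sub>0 = R\<close>. Cutting off \<open>F\<^sub>0\<close> leaves a resolution of the ideal \<open>I\<close>.
\<close>

locale graded_resolution = graded_complex X D c
  for X :: "nat \<Rightarrow> 'b set" and D :: "nat \<Rightarrow> 'b \<Rightarrow> int"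
    and c :: "nat \<Rightarrow> 'b \<Rightarrow> ('b \<Rightarrow>\<^sub>0 ('v::finite multiset \<Rightarrow>\<^sub>0 'k::field))" +
  fixes I :: "('v, 'k) mpoly set" and pt :: 'b
  assumes base: "X 0 = {pt}" and base_degree: "D 0 pt = 0"
    and image: "lin (c 0) ` free (X 1) = single pt ` I"
    and exact: "u \<in> free (X (Suc n)) \<Longrightarrow> lin (c n) u = 0 \<Longrightarrow>
      \<exists>w\<in>free (X (Suc (Suc n))). lin (c (Suc n)) w = u"
begin

lemma homogeneous_preimage:
  assumes "z \<in> hvec (X n) (D n) j" "w \<in> free (X (Suc n))" "lin (c n) w = z"
  shows "\<exists>w\<in>hvec (X (Suc n)) (D (Suc n)) j. lin (c n) w = z"
  by (rule bexI[of _ "hcomp (D (Suc n)) j w"])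
    (use assms in \<open>simp_all add: boundary_hcomp hcomp_hvec hcomp_id\<close>)

end

locale minimal_resolution = graded_resolution +
  assumes minimal_column: "b \<in> X (Suc n) \<Longrightarrow> c n b \<in> mfree"
begin

lemma boundary_mfree: "u \<in> free (X (Suc n)) \<Longrightarrow> lin (c n) u \<in> mfree"
  by (erule lin_columns_mfree) (rule minimal_column)

end

text \<open>
  Since the source is free and the target exact, the columns can be chosen one homological degree after
  the other; homogeneous components of preimages make them homogeneous.
\<close>

lemma comparison_map:
  fixes X :: "nat \<Rightarrow> 'b set" and Y :: "nat \<Rightarrow> 'c set"
    and c :: "nat \<Rightarrow> 'b \<Rightarrow> ('b \<Rightarrow>\<^sub>0 ('v::finite multiset \<Rightarrow>\<^sub>0 'k::field))"
  assumes P: "graded_resolution X D c I pt" and Q: "graded_resolution Y D' c' J pt'"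
    and m: "m \<in> homog e" and IJ: "\<And>p. p \<in> I \<Longrightarrow> p * m \<in> J"
  obtains f :: "nat \<Rightarrow> 'b \<Rightarrow> ('c \<Rightarrow>\<^sub>0 ('v multiset \<Rightarrow>\<^sub>0 'k))"
  where "f 0 pt = single pt' m"
    and "\<And>n b. b \<in> X n \<Longrightarrow> f n b \<in> hvec (Y n) (D' n) (D n b + e)"
    and "\<And>n b. b \<in> X (Suc n) \<Longrightarrow> lin (c' n) (f (Suc n) b) = lin (f n) (c n b)"
proof -
  interpret P: graded_resolution X D c I pt by fact
  interpret Q: graded_resolution Y D' c' J pt' by fact
  \<comment> \<open>\<open>good n g\<close>: the columns \<open>g\<close> in degree \<open>n\<close> admit columns in degree \<open>n + 1\<close>; this is what the recursion preserves.\<close>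
  define good where "good n g \<longleftrightarrow> (\<forall>b\<in>X n. g b \<in> hvec (Y n) (D' n) (D n b + e)) \<and>
      (n = 0 \<longrightarrow> g pt = single pt' m) \<and>
      (\<forall>b\<in>X (Suc n). \<exists>w\<in>free (Y (Suc n)). lin (c' n) w = lin g (c n b))"
    for n and g :: "'b \<Rightarrow> ('c \<Rightarrow>\<^sub>0 ('v multiset \<Rightarrow>\<^sub>0 'k))"
  have "\<exists>f. \<forall>n. good n (f n) \<and> (\<forall>b\<in>X (Suc n). lin (c' n) (f (Suc n) b) = lin (f n) (c n b))"
  proof (rule dependent_nat_choice)
    let ?g = "\<lambda>_. single pt' m"
    have "?g b \<in> hvec (Y 0) (D' 0) (D 0 b + e)" if "b \<in> X 0" for b
      using that hvec_single[of pt' "Y 0" m e "D' 0"] m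
      by (simp add: P.base Q.base P.base_degree Q.base_degree)
    moreover have "\<exists>w\<in>free (Y (Suc 0)). lin (c' 0) w = lin ?g (c 0 b)" if b: "b \<in> X (Suc 0)" for b
    proof -
      have "lin (c 0) (single b 1) \<in> lin (c 0) ` free (X 1)"
        using b by (intro imageI single_free) simp
      then obtain p where p: "p \<in> I" "c 0 b = single pt p"
        unfolding P.image by auto
      have "single pt' (p * m) \<in> lin (c' 0) ` free (Y 1)"
        unfolding Q.image using IJ[OF p(1)] by simp
      then show ?thesis by (auto simp: p vscale_single)
    qed
    ultimately show "\<exists>g. good 0 g"
      unfolding good_def by (intro exI[of _ ?g]) auto
  next
    fix g n assume g: "good n g"
    have "\<forall>b\<in>X (Suc n). \<exists>w\<in>hvec (Y (Suc n)) (D' (Suc n)) (D (Suc n) b + e). lin (c' n) w = lin g (c n b)"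
    proof
      fix b assume b: "b \<in> X (Suc n)"
      from g b obtain w where w: "w \<in> free (Y (Suc n))" "lin (c' n) w = lin g (c n b)"
        by (auto simp: good_def)
      have "lin g (c n b) \<in> hvec (Y n) (D' n) (D (Suc n) b + e)"
        by (rule lin_hvec[OF P.column[OF b]]) (use g in \<open>auto simp: good_def\<close>)
      from Q.homogeneous_preimage[OF this w]
      show "\<exists>w\<in>hvec (Y (Suc n)) (D' (Suc n)) (D (Suc n) b + e). lin (c' n) w = lin g (c n b)" .
    qed
    then obtain h where h: "\<And>b. b \<in> X (Suc n) \<Longrightarrow> h b \<in> hvec (Y (Suc n)) (D' (Suc n)) (D (Suc n) b + e)"
      "\<And>b. b \<in> X (Suc n) \<Longrightarrow> lin (c' n) (h b) = lin g (c n b)"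
      by metis
    have "\<exists>w\<in>free (Y (Suc (Suc n))). lin (c' (Suc n)) w = lin h (c (Suc n) b)"
      if b: "b \<in> X (Suc (Suc n))" for b
    proof (rule Q.exact)
      show "lin h (c (Suc n) b) \<in> free (Y (Suc n))"
        by (rule lin_free[OF P.column_free[OF b]]) (use h(1) hvec_free in blast)
      have "lin (c' n) (lin h (c (Suc n) b)) = lin (\<lambda>b. lin (c' n) (h b)) (c (Suc n) b)"
        by (rule lin_lin)
      also have "\<dots> = lin (\<lambda>b. lin g (c n b)) (c (Suc n) b)"
        by (rule lin_free_cong[OF P.column_free[OF b]]) (rule h(2))
      also have "\<dots> = lin g (lin (c n) (c (Suc n) b))"
        by (rule lin_lin[symmetric])
      also have "\<dots> = 0" by (simp add: P.column_column[OF b])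
      finally show "lin (c' n) (lin h (c (Suc n) b)) = 0" .
    qed
    then show "\<exists>h. good (Suc n) h \<and> (\<forall>b\<in>X (Suc n). lin (c' n) (h b) = lin g (c n b))"
      using h by (intro exI[of _ h]) (auto simp: good_def)
  qed
  then obtain f where f: "\<And>n. good n (f n)"
    "\<And>n b. b \<in> X (Suc n) \<Longrightarrow> lin (c' n) (f (Suc n) b) = lin (f n) (c n b)" by blast
  show thesis by (rule that[of f]) (use f in \<open>auto simp: good_def\<close>)
qed

text \<open>
  A lift of the identity is homotopic to the identity, and homotopic endomorphisms of a minimal resolution
  agree modulo \<open>\<mm>\<close> because all boundaries lie in \<open>\<mm>F\<close>. No sequence of homotopies has to be chosen:
  in degree \<open>n\<close> it suffices to have one map \<open>s\<close> such that \<open>f - id - \<partial>s\<close> vanishes on boundaries.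
\<close>

lemma (in minimal_resolution) self_map_identity_mod_maximal:
  assumes base_map: "f 0 pt = single pt 1"
    and map: "\<And>n b. b \<in> X n \<Longrightarrow> f n b \<in> free (X n)"
    and chain: "\<And>n b. b \<in> X (Suc n) \<Longrightarrow> lin (c n) (f (Suc n) b) = lin (f n) (c n b)"
    and b: "b \<in> X n"
  shows "f n b - single b 1 \<in> mfree"
proof -
  have step: "\<exists>t. (\<forall>a\<in>X (Suc n). t a \<in> free (X (Suc (Suc n))) \<and>
      lin (c (Suc n)) (t a) = f (Suc n) a - single a 1 - lin s (c n a))"
    if s: "\<forall>a\<in>X n. s a \<in> free (X (Suc n))"
      and van: "\<And>a. a \<in> X (Suc n) \<Longrightarrow>
        lin (f n) (c n a) - c n a - lin (c n) (lin s (c n a)) = 0" for n s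
  proof -
    have "\<exists>w\<in>free (X (Suc (Suc n))). lin (c (Suc n)) w = f (Suc n) a - single a 1 - lin s (c n a)"
      if a: "a \<in> X (Suc n)" for a
    proof (rule exact)
      show "f (Suc n) a - single a 1 - lin s (c n a) \<in> free (X (Suc n))"
        by (intro free_rules map a single_free lin_free[OF column_free[OF a]]) (use s in blast)
      show "lin (c n) (f (Suc n) a - single a 1 - lin s (c n a)) = 0"
        using van[OF a] by (simp add: lin_diff chain[OF a])
    qed
    then show ?thesis by metis
  qed
  have ex: "\<exists>s. (\<forall>a\<in>X n. s a \<in> free (X (Suc n))) \<and>
      (\<forall>a\<in>X (Suc n). lin (f n) (c n a) - c n a - lin (c n) (lin s (c n a)) = 0)" for n
  proof (induction n)
    case 0
    have "lin (f 0) (c 0 a) = c 0 a" if "a \<in> X (Suc 0)" for a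
    proof -
      have "lin (f 0) (c 0 a) = lin (\<lambda>b. single b 1) (c 0 a)"
        by (rule lin_free_cong[OF column_free[OF that]]) (simp add: base base_map)
      then show ?thesis by simp
    qed
    then show ?case by (intro exI[of _ "\<lambda>_. 0"]) (auto simp: free_rules)
  next
    case (Suc n)
    then obtain s where s: "\<forall>a\<in>X n. s a \<in> free (X (Suc n))"
      "\<And>a. a \<in> X (Suc n) \<Longrightarrow> lin (f n) (c n a) - c n a - lin (c n) (lin s (c n a)) = 0"
      by blast
    from step[OF this] obtain t where t: "\<And>a. a \<in> X (Suc n) \<Longrightarrow> t a \<in> free (X (Suc (Suc n)))"
      "\<And>a. a \<in> X (Suc n) \<Longrightarrow> lin (c (Suc n)) (t a) = f (Suc n) a - single a 1 - lin s (c n a)"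
      by blast
    have "lin (f (Suc n)) (c (Suc n) a) - c (Suc n) a - lin (c (Suc n)) (lin t (c (Suc n) a)) = 0"
      if a: "a \<in> X (Suc (Suc n))" for a
    proof -
      have "lin (c (Suc n)) (lin t (c (Suc n) a)) = lin (\<lambda>a. lin (c (Suc n)) (t a)) (c (Suc n) a)"
        by (rule lin_lin)
      also have "\<dots> = lin (\<lambda>a. f (Suc n) a - single a 1 - lin s (c n a)) (c (Suc n) a)"
        by (rule lin_free_cong[OF column_free[OF a]]) (rule t(2))
      also have "\<dots> = lin (f (Suc n)) (c (Suc n) a) - c (Suc n) a - lin s (lin (c n) (c (Suc n) a))"
        by (simp add: lin_fun_diff lin_lin)
      finally show ?thesis by (simp add: column_column[OF a])
    qed
    with t(1) show ?case by blast
  qed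
  show ?thesis
  proof (cases n)
    case 0
    with b show ?thesis by (simp add: base base_map vm.subspace_0[OF mfree_subspace])
  next
    case (Suc k)
    from ex[of k] obtain s where s: "\<forall>a\<in>X k. s a \<in> free (X (Suc k))"
      "\<And>a. a \<in> X (Suc k) \<Longrightarrow> lin (f k) (c k a) - c k a - lin (c k) (lin s (c k a)) = 0"
      by blast
    from step[OF this] b Suc obtain w where w: "w \<in> free (X (Suc n))"
      "lin (c n) w = f n b - single b 1 - lin s (c k b)"
      by blast
    then have "f n b - single b 1 = lin (c n) w + lin s (c k b)" by simp
    also have "\<dots> \<in> mfree"
      using b Suc by (intro vm.subspace_add[OF mfree_subspace] boundary_mfree w lin_mfree minimal_column) simp
    finally show ?thesis .
  qed
qed

text \<open>
  The columns \<open>f b\<close> are linearly independent because a left inverse exists. Finiteness of \<open>B\<close> belongs to the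
  conclusion, since the bases of a resolution may be infinite a priori.
\<close>

lemma left_inverse_matrix_card_le:
  fixes f :: "'b \<Rightarrow> ('c \<Rightarrow>\<^sub>0 'k::field)"
  assumes C: "finite C" and f: "\<And>b. b \<in> B \<Longrightarrow> f b \<in> free C"
    and gf: "\<And>b. b \<in> B \<Longrightarrow> lin g (f b) = single b 1"
  shows "finite B \<and> card B \<le> card C"
proof -
  interpret V: vector_space "vscale :: 'k \<Rightarrow> ('c \<Rightarrow>\<^sub>0 'k) \<Rightarrow> _"
    by (simp add: module_iff_vector_space[symmetric] vscale_module)
  have inj: "inj_on f B"
  proof (rule inj_onI)
    fix b b' assume "b \<in> B" "b' \<in> B" "f b = f b'"
    then have "single b (1::'k) = single b' 1" by (metis gf)
    then show "b = b'" by (metis keys_single singleton_inject zero_neq_one)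
  qed
  have "vm.independent (f ` B)"
    unfolding vm.independent_explicit_module
  proof (intro allI impI)
    fix t u v0 assume t: "finite t" "t \<subseteq> f ` B" "(\<Sum>v\<in>t. vscale (u v) v) = 0" "v0 \<in> t"
    let ?i = "inv_into B f"
    have g: "lin g v = single (?i v) 1" if "v \<in> t" for v
      using that t(2) gf inj by auto
    have "0 = lookup (lin g (\<Sum>v\<in>t. vscale (u v) v)) (?i v0)"
      by (simp add: t(3))
    also have "\<dots> = (\<Sum>v\<in>t. u v * lookup (single (?i v) 1) (?i v0))"
      by (simp add: lin_sum lin_vscale lookup_sum g)
    also have "\<dots> = (\<Sum>v\<in>t. if v = v0 then u v else 0)"
      using t(2,4) inj_on_subset[OF inj_on_inv_into[OF t(2)]]
      by (intro sum.cong refl) (auto simp: lookup_single when_def dest: inj_onD[OF inj_on_inv_into[OF t(2)]])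
    also have "\<dots> = u v0" using t(1,4) by simp
    finally show "u v0 = 0" by simp
  qed
  have "f ` B \<subseteq> vm.span ((\<lambda>b. single b 1) ` C)"
  proof
    fix u assume "u \<in> f ` B"
    then have "u \<in> free C" using f by auto
    have "u = (\<Sum>b\<in>keys u. vscale (lookup u b) (single b 1))"
      by (simp add: vscale_single sum_single_eq)
    also have "\<dots> \<in> vm.span ((\<lambda>b. single b 1) ` C)"
      using \<open>u \<in> free C\<close> by (intro vm.span_sum vm.span_scale vm.span_base) (auto simp: free_def)
    finally show "u \<in> vm.span ((\<lambda>b. single b 1) ` C)" .
  qed
  from V.independent_span_bound[OF _ \<open>vm.independent (f ` B)\<close> this] C
  have "finite (f ` B)" "card (f ` B) \<le> card ((\<lambda>b. single b (1::'k)) ` C)" by auto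
  moreover have "card ((\<lambda>b. single b (1::'k)) ` C) \<le> card C" using C by (rule card_image_le)
  ultimately show ?thesis
    using inj by (simp add: finite_image_iff card_image)
qed

definition const_vec :: "('b \<Rightarrow>\<^sub>0 ('v multiset \<Rightarrow>\<^sub>0 'k::field)) \<Rightarrow> ('b \<Rightarrow>\<^sub>0 'k)" where
  "const_vec u = Poly_Mapping.map const u"

lemma lookup_const_vec: "lookup (const_vec u) b = const (lookup u b)"
  by (simp add: const_vec_def map.rep_eq when_def)

lemma const_vec_lin: "const_vec (lin g u) = lin (\<lambda>b. const_vec (g b)) (const_vec u)"
proof (rule poly_mapping_eqI)
  fix a
  have "keys (const_vec u) \<subseteq> keys u"
    by (auto simp: in_keys_iff lookup_const_vec)
  then have "lin (\<lambda>b. const_vec (g b)) (const_vec u)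
      = (\<Sum>b\<in>keys u. vscale (lookup (const_vec u) b) (const_vec (g b)))"
    by (intro lin_superset) auto
  then show "lookup (const_vec (lin g u)) a = lookup (lin (\<lambda>b. const_vec (g b)) (const_vec u)) a"
    by (simp add: lookup_const_vec lookup_lin lookup_sum const_sum)
qed

text \<open>
  The comparison maps in both directions compose to the identity modulo \<open>\<mm>\<close>, so their matrices of constant
  terms compose to the identity. By homogeneity a constant term can only occur between basis elements of
  the same degree, and the degree \<open>j\<close> blocks compose to the identity as well. Minimality is demanded of one
  resolution only, so that the ranks can also be bounded by those of a Taylor resolution.
\<close>

lemma minimal_resolution_rank_le:
  fixes X :: "nat \<Rightarrow> 'b set" and Y :: "nat \<Rightarrow> 'c set"
    and c :: "nat \<Rightarrow> 'b \<Rightarrow> ('b \<Rightarrow>\<^sub>0 ('v::finite multiset \<Rightarrow>\<^sub>0 'k::field))"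
  assumes P: "minimal_resolution X D c I pt" and Q: "graded_resolution Y D' c' I pt'"
    and fin: "finite {a \<in> Y n. D' n a = j}"
  shows "finite {b \<in> X n. D n b = j} \<and> card {b \<in> X n. D n b = j} \<le> card {a \<in> Y n. D' n a = j}"
proof -
  interpret P: minimal_resolution X D c I pt by fact
  interpret Q: graded_resolution Y D' c' I pt' by fact
  have one: "(1 :: ('v, 'k) mpoly) \<in> homog 0"
    by (simp add: homog_iff lookup_one)
  obtain f where f: "f 0 pt = single pt' 1" "\<And>n b. b \<in> X n \<Longrightarrow> f n b \<in> hvec (Y n) (D' n) (D n b + 0)"
    "\<And>n b. b \<in> X (Suc n) \<Longrightarrow> lin (c' n) (f (Suc n) b) = lin (f n) (c n b)"
    using comparison_map[OF P.graded_resolution_axioms Q.graded_resolution_axioms one] by auto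
  obtain g where g: "g 0 pt' = single pt 1" "\<And>n b. b \<in> Y n \<Longrightarrow> g n b \<in> hvec (X n) (D n) (D' n b + 0)"
    "\<And>n b. b \<in> Y (Suc n) \<Longrightarrow> lin (c n) (g (Suc n) b) = lin (g n) (c' n b)"
    using comparison_map[OF Q.graded_resolution_axioms P.graded_resolution_axioms one] by auto
  have fY: "f n b \<in> free (Y n)" if "b \<in> X n" for n b using f(2)[OF that] hvec_free by blast
  have gX: "g n b \<in> free (X n)" if "b \<in> Y n" for n b using g(2)[OF that] hvec_free by blast
  have gf: "lin (g n) (f n b) - single b 1 \<in> mfree" if "b \<in> X n" for b
  proof (rule P.self_map_identity_mod_maximal[of "\<lambda>n b. lin (g n) (f n b)", OF _ _ _ that])
    show "lin (g 0) (f 0 pt) = single pt 1" by (simp add: f(1) g(1))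
    show "lin (g n) (f n b) \<in> free (X n)" if "b \<in> X n" for n b
      by (rule lin_free[OF fY[OF that]]) (rule gX)
    show "lin (c n) (lin (g (Suc n)) (f (Suc n) b)) = lin (\<lambda>b. lin (g n) (f n b)) (c n b)"
      if b: "b \<in> X (Suc n)" for n b
    proof -
      have "lin (c n) (lin (g (Suc n)) (f (Suc n) b)) = lin (\<lambda>a. lin (g n) (c' n a)) (f (Suc n) b)"
        unfolding lin_lin by (rule lin_free_cong[OF fY[OF b]]) (rule g(3))
      also have "\<dots> = lin (g n) (lin (c' n) (f (Suc n) b))"
        by (rule lin_lin[symmetric])
      also have "\<dots> = lin (\<lambda>b. lin (g n) (f n b)) (c n b)"
        by (simp add: f(3)[OF b] lin_lin)
      finally show ?thesis .
    qed
  qed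
  show ?thesis
  proof (rule left_inverse_matrix_card_le[OF fin, of _ "\<lambda>b. const_vec (f n b)" "\<lambda>a. const_vec (g n a)"])
    fix b assume b: "b \<in> {b \<in> X n. D n b = j}"
    show "const_vec (f n b) \<in> free {a \<in> Y n. D' n a = j}"
      unfolding free_def
    proof (intro CollectI subsetI)
      fix a assume "a \<in> keys (const_vec (f n b))"
      then have ne: "const (lookup (f n b) a) \<noteq> 0" by (simp add: in_keys_iff lookup_const_vec)
      then have "a \<in> keys (f n b)" by (auto simp: in_keys_iff)
      moreover have "f n b \<in> hvec (Y n) (D' n) (D n b)" using f(2)[of b n] b by simp
      ultimately show "a \<in> Y n \<and> D' n a = j"
        using ne b by (fastforce simp: hvec_def free_def homog_iff const_def)
    qed
    show "lin (\<lambda>a. const_vec (g n a)) (const_vec (f n b)) = single b 1"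
    proof (rule poly_mapping_eqI)
      fix x
      have "const (lookup (lin (g n) (f n b) - single b 1) x) = 0"
        using gf b by (simp add: mfree_def)
      then show "lookup (lin (\<lambda>a. const_vec (g n a)) (const_vec (f n b))) x = lookup (single b 1) x"
        by (simp add: const_vec_lin[symmetric] lookup_const_vec lookup_minus lookup_single when_def split: if_splits)
    qed
  qed
qed

lemma minimal_resolution_rank_unique:
  assumes "minimal_resolution X D c I pt" "minimal_resolution Y D' c' I pt'"
  shows "card {b \<in> X n. D n b = j} = card {a \<in> Y n. D' n a = j}"
proof -
  note R = assms[THEN minimal_resolution.axioms(1)]
  show ?thesis
  proof (cases "finite {b \<in> X n. D n b = j}")
    case True
    then show ?thesis
      using minimal_resolution_rank_le[OF assms(1) R(2), of n j] minimal_resolution_rank_le[OF assms(2) R(1), of n j]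
      by auto
  next
    case False
    then show ?thesis
      using minimal_resolution_rank_le[OF assms(1) R(2), of n j] card.infinite by fastforce
  qed
qed

section \<open>Existence of minimal resolutions\<close>

text \<open>
  The coefficient field acts through the constant polynomials; bases and dimensions refer to this action.
\<close>

definition kscale :: "'k \<Rightarrow> ('b \<Rightarrow>\<^sub>0 ('v::finite multiset \<Rightarrow>\<^sub>0 'k::field)) \<Rightarrow> ('b \<Rightarrow>\<^sub>0 ('v multiset \<Rightarrow>\<^sub>0 'k))" where
  "kscale a u = vscale (single {#} a) u"

lemma kscale_vector_space: "vector_space (kscale :: 'k::field \<Rightarrow> ('b \<Rightarrow>\<^sub>0 ('v::finite multiset \<Rightarrow>\<^sub>0 'k)) \<Rightarrow> _)"
  unfolding kscale_def
  by unfold_locales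
    (simp_all add: vm.scale_right_distrib single_add vm.scale_left_distrib mult_single
      single_one[unfolded zero_multiset_def])

interpretation kv: vector_space "kscale :: 'k::field \<Rightarrow> ('b \<Rightarrow>\<^sub>0 ('v::finite multiset \<Rightarrow>\<^sub>0 'k)) \<Rightarrow> _"
  by (rule kscale_vector_space)

lemma vm_subspace_kv: "vm.subspace V \<Longrightarrow> kv.subspace V"
  by (intro kv.subspaceI) (auto simp: kscale_def vm.subspace_0 vm.subspace_add vm.subspace_scale)

lemma hvec_kv_subspace: "kv.subspace (hvec X D j)"
  by (intro kv.subspaceI) (use hvec_vscale[OF homog_single[of "{#}" 0]] in \<open>auto simp: kscale_def hvec_add\<close>)

lemma countable_multisets: "countable (UNIV :: 'v::finite multiset set)"
proof -
  have "range (mset :: 'v list \<Rightarrow> _) = UNIV" by (metis ex_mset surj_def)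
  then show ?thesis by (metis countable_image countableI_type)
qed

text \<open>
  The basis elements of a resolution are natural numbers, hence a set of generators has to be enumerated.
  This is possible because the countably many monomial vectors span a free module of countable rank over
  the field, and any two bases of a vector space are equipotent.
\<close>

lemma independent_countable:
  fixes S :: "('b::countable \<Rightarrow>\<^sub>0 ('v::finite multiset \<Rightarrow>\<^sub>0 'k::field)) set"
  assumes "kv.independent S"
  shows "countable S"
proof -
  let ?T = "(\<lambda>(b, m). single b (single m (1::'k))) ` (UNIV :: ('b \<times> 'v multiset) set)"
  have T: "countable ?T"
    using countable_SIGMA[OF countableI_type[of "UNIV :: 'b set"], of "\<lambda>_. UNIV :: 'v multiset set"]
      countable_multisets by (intro countable_image) simp
  have span: "kv.span ?T = UNIV"
  proof (intro equalityI subsetI UNIV_I)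
    fix u :: "'b \<Rightarrow>\<^sub>0 ('v multiset \<Rightarrow>\<^sub>0 'k)"
    have "u = (\<Sum>b\<in>keys u. single b (\<Sum>m\<in>keys (lookup u b). single m (lookup (lookup u b) m)))"
      by (simp add: sum_single_eq)
    also have "\<dots> = (\<Sum>b\<in>keys u. \<Sum>m\<in>keys (lookup u b). kscale (lookup (lookup u b) m) (single b (single m 1)))"
    proof (rule sum.cong[OF refl])
      fix b :: 'b
      have "single b (\<Sum>m\<in>A. f m) = (\<Sum>m\<in>A. single b (f m))" for A and f :: "'v multiset \<Rightarrow> ('v multiset \<Rightarrow>\<^sub>0 'k)"
        by (induction A rule: infinite_finite_induct) (auto simp: single_add)
      then show "single b (\<Sum>m\<in>keys (lookup u b). single m (lookup (lookup u b) m)) =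
          (\<Sum>m\<in>keys (lookup u b). kscale (lookup (lookup u b) m) (single b (single m 1)))"
        by (simp add: kscale_def vscale_single mult_single)
    qed
    also have "\<dots> \<in> kv.span ?T"
      by (intro kv.span_sum kv.span_scale kv.span_base) auto
    finally show "u \<in> kv.span ?T" .
  qed
  obtain T' where T': "T' \<subseteq> ?T" "kv.independent T'" "?T \<subseteq> kv.span T'"
    by (rule kv.maximal_independent_subset[of ?T])
  obtain C where C: "S \<subseteq> C" "C \<subseteq> UNIV" "kv.independent C" "UNIV \<subseteq> kv.span C"
    by (rule kv.maximal_independent_subset_extend[OF subset_UNIV assms])
  have "kv.span T' = UNIV"
    using kv.span_minimal[OF T'(3) kv.subspace_span] span by auto
  then have "kv.span C = kv.span T'" using C(4) by auto
  from kv.bij_if_span_eq_span_bases[OF C(3) T'(2) this] obtain f where "bij_betw f C T'" by blast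
  then have "countable C"
    using T countable_subset[OF T'(1)] by (metis bij_betw_def countable_image_inj_on)
  then show ?thesis using C(1) countable_subset by blast
qed

text \<open>
  Extend a basis of \<open>N\<close> to a maximal independent subset of \<open>M\<close>; the added vectors \<open>G\<close> are independent modulo \<open>N\<close>. Independence is
  stated for indexed families because the generators are going to be enumerated.
\<close>

lemma independent_complement:
  fixes N M :: "('b::countable \<Rightarrow>\<^sub>0 ('v::finite multiset \<Rightarrow>\<^sub>0 'k::field)) set"
  assumes N: "kv.subspace N" and NM: "N \<subseteq> M"
  shows "\<exists>G\<subseteq>M. countable G \<and> M \<subseteq> {x + y |x y. x \<in> kv.span G \<and> y \<in> N} \<and>
     (\<forall>(T :: nat set) f a. finite T \<and> inj_on f T \<and> f ` T \<subseteq> G \<and> (\<Sum>i\<in>T. kscale (a i) (f i)) \<in> N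
        \<longrightarrow> (\<forall>i\<in>T. a i = 0))"
proof -
  obtain B0 where B0: "B0 \<subseteq> N" "kv.independent B0" "N \<subseteq> kv.span B0"
    by (rule kv.maximal_independent_subset[of N])
  obtain B where B: "B0 \<subseteq> B" "B \<subseteq> M" "kv.independent B" "M \<subseteq> kv.span B"
    by (rule kv.maximal_independent_subset_extend[OF subset_trans[OF B0(1) NM] B0(2)])
  have span0: "kv.span B0 = N"
    using kv.span_minimal[OF B0(1) N] B0(3) by auto
  show ?thesis
  proof (intro exI[of _ "B - B0"] conjI allI impI)
    show "B - B0 \<subseteq> M" using B by auto
    show "countable (B - B0)"
      using independent_countable[OF B(3)] by (rule countable_subset[rotated]) auto
    have "B = (B - B0) \<union> B0" using B(1) by auto
    then have "kv.span B = {x + y |x y. x \<in> kv.span (B - B0) \<and> y \<in> kv.span B0}"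
      using kv.span_Un[of "B - B0" B0] by simp
    then show "M \<subseteq> {x + y |x y. x \<in> kv.span (B - B0) \<and> y \<in> N}"
      using B(4) span0 by simp
  next
    fix T :: "nat set" and f a
    assume *: "finite T \<and> inj_on f T \<and> f ` T \<subseteq> B - B0 \<and> (\<Sum>i\<in>T. kscale (a i) (f i)) \<in> N"
    then obtain t r where t: "finite t" "t \<subseteq> B0" "(\<Sum>i\<in>T. kscale (a i) (f i)) = (\<Sum>v\<in>t. kscale (r v) v)"
      unfolding span0[symmetric] kv.span_explicit by auto
    let ?a = "\<lambda>v. if v \<in> f ` T then a (inv_into T f v) else - r v"
    have "(\<Sum>v\<in>f ` T \<union> t. kscale (?a v) v) = (\<Sum>v\<in>f ` T. kscale (?a v) v) + (\<Sum>v\<in>t. kscale (?a v) v)"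
      using * t by (intro sum.union_disjoint) auto
    also have "(\<Sum>v\<in>f ` T. kscale (?a v) v) = (\<Sum>i\<in>T. kscale (a i) (f i))"
      using * by (subst sum.reindex) auto
    also have "(\<Sum>v\<in>t. kscale (?a v) v) = (\<Sum>v\<in>t. - kscale (r v) v)"
      using * t by (intro sum.cong) auto
    also have "(\<Sum>i\<in>T. kscale (a i) (f i)) + (\<Sum>v\<in>t. - kscale (r v) v) = 0"
      by (simp add: t(3) sum_negf)
    finally have sum0: "(\<Sum>v\<in>f ` T \<union> t. kscale (?a v) v) = 0" .
    show "\<forall>i\<in>T. a i = 0"
    proof
      fix i assume i: "i \<in> T"
      have "?a (f i) = 0"
        by (rule kv.independentD[OF B(3) _ _ sum0]) (use i * t B(1) in auto)
      then show "a i = 0" using i * by (simp add: inv_into_f_f)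
    qed
  qed
qed

text \<open>
  This is the graded Nakayama lemma. In degree \<open>j\<close> choose a basis of \<open>M\<^sub>j\<close> modulo the span \<open>N\<^sub>j\<close> of the products
  of variables with elements of \<open>M\<^sub>j\<^sub>-\<^sub>1\<close>. Degrees are bounded below, so these elements generate \<open>M\<close> by induction on the
  degree. In a relation among them, the part of degree \<open>j\<close> expresses a combination of the generators of degree \<open>j\<close>,
  with the constant terms as coefficients, as an element of \<open>N\<^sub>j\<close>; hence the constant terms vanish.
\<close>

lemma minimal_graded_cover:
  fixes M :: "('b::countable \<Rightarrow>\<^sub>0 ('v::finite multiset \<Rightarrow>\<^sub>0 'k::field)) set"
  assumes M: "vm.subspace M" "M \<subseteq> free X" "\<And>u j. u \<in> M \<Longrightarrow> hcomp D j u \<in> M"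
    and D: "\<And>b. b \<in> X \<Longrightarrow> D b \<ge> 0"
  shows "\<exists>(Y :: nat set) D' c. (\<forall>a\<in>Y. D' a \<ge> 0) \<and> (\<forall>a\<in>Y. c a \<in> hvec X D (D' a)) \<and>
    lin c ` free Y = M \<and> (\<forall>u\<in>free Y. lin c u = 0 \<longrightarrow> u \<in> mfree)"
proof -
  define Mj where "Mj j = M \<inter> hvec X D j" for j
  define N where "N j = kv.span {vscale (indet x) u |x u. u \<in> Mj (j - 1)}" for j
  have Mj_sub: "kv.subspace (Mj j)" for j
    unfolding Mj_def by (intro kv.subspace_inter vm_subspace_kv M hvec_kv_subspace)
  have indet: "indet x \<in> homog 1" for x :: 'v
    by (simp add: indet_def monom_def homog_single)
  have N_sub: "kv.subspace (N j)" for j unfolding N_def by simp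
  have NM: "N j \<subseteq> Mj j" for j
    unfolding N_def
  proof (rule kv.span_minimal[OF _ Mj_sub], clarify)
    fix x u assume "u \<in> Mj (j - 1)"
    then show "vscale (indet x) u \<in> Mj j"
      using hvec_vscale[OF indet, of u X D "j - 1" x] M(1) by (simp add: Mj_def vm.subspace_scale)
  qed
  have neg: "Mj j \<subseteq> {0}" if "j < 0" for j
  proof
    fix u assume u: "u \<in> Mj j"
    have "lookup (lookup u b) m = 0" for b m
    proof (cases "b \<in> X")
      case True
      have "lookup u b \<in> homog (j - D b)" using u by (simp add: Mj_def hvec_def)
      moreover have "j - D b \<noteq> int (size m)" using D[OF True] that by simp
      ultimately show ?thesis by (auto simp: homog_iff)
    next
      case False
      then have "lookup u b = 0" using u by (auto simp: Mj_def hvec_def free_def in_keys_iff)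
      then show ?thesis by simp
    qed
    then show "u \<in> {0}" by (auto intro!: poly_mapping_eqI)
  qed
  define R where "R j G \<longleftrightarrow> G \<subseteq> Mj j \<and> countable G \<and> Mj j \<subseteq> {x + y |x y. x \<in> kv.span G \<and> y \<in> N j} \<and>
     (\<forall>(T :: nat set) f a. finite T \<and> inj_on f T \<and> f ` T \<subseteq> G \<and> (\<Sum>i\<in>T. kscale (a i) (f i)) \<in> N j
        \<longrightarrow> (\<forall>i\<in>T. a i = 0))" for j G
  define G where "G j = (SOME G. R j G)" for j
  have "\<exists>G. R j G" for j
    unfolding R_def by (rule independent_complement[OF N_sub NM])
  then have "R j (G j)" for j
    unfolding G_def by (rule someI_ex)
  then have G: "G j \<subseteq> Mj j" "countable (G j)" "Mj j \<subseteq> {x + y |x y. x \<in> kv.span (G j) \<and> y \<in> N j}"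
    and Gind: "finite T \<Longrightarrow> inj_on f T \<Longrightarrow> f ` T \<subseteq> G j \<Longrightarrow> (\<Sum>i\<in>T. kscale (a i) (f i)) \<in> N j \<Longrightarrow> i \<in> T \<Longrightarrow> a i = 0"
    for j and T :: "nat set" and f a i
    unfolding R_def by (blast+)
  \<comment> \<open>Generators are indexed by pairs of a degree and an element, so that degrees can be read off the index.\<close>
  define GG where "GG = {j :: int. j \<ge> 0} \<times> UNIV \<inter> Sigma UNIV G"
  have cGG: "countable GG"
    unfolding GG_def by (rule countable_subset[of _ "Sigma UNIV G"]) (auto intro!: countable_SIGMA G(2))
  define Y where "Y = to_nat_on GG ` GG"
  define D' where "D' y = fst (from_nat_into GG y)" for y
  define c where "c y = snd (from_nat_into GG y)" for y
  have inGG: "from_nat_into GG y \<in> GG" if "y \<in> Y" for y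
    using that cGG by (auto simp: Y_def)
  have inj: "inj_on (from_nat_into GG) Y"
    using cGG by (auto simp: Y_def inj_on_def)
  have cG: "c y \<in> G (D' y)" "D' y \<ge> 0" if "y \<in> Y" for y
    using inGG[OF that] by (auto simp: c_def D'_def GG_def)
  have ex: "\<exists>y\<in>Y. D' y = j \<and> c y = g" if "g \<in> G j" "j \<ge> 0" for j g
  proof -
    have "(j, g) \<in> GG" using that by (auto simp: GG_def)
    then show ?thesis
      using cGG by (intro bexI[of _ "to_nat_on GG (j, g)"]) (auto simp: D'_def c_def Y_def)
  qed
  have cM: "c y \<in> Mj (D' y)" if "y \<in> Y" for y using cG(1)[OF that] G(1) by blast
  have ch: "c y \<in> hvec X D (D' y)" if "y \<in> Y" for y using cM[OF that] by (simp add: Mj_def)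
  let ?im = "lin c ` free Y"
  have im_sub: "vm.subspace ?im"
    by (rule module_hom.subspace_image[OF lin_hom free_subspace])
  have Mj_im: "\<forall>j. j < int n \<longrightarrow> Mj j \<subseteq> ?im" for n
  proof (induction n)
    case 0
    have "(0 :: 'b \<Rightarrow>\<^sub>0 ('v multiset \<Rightarrow>\<^sub>0 'k)) \<in> ?im" by (rule vm.subspace_0[OF im_sub])
    then show ?case using neg by fastforce
  next
    case (Suc n)
    show ?case
    proof (intro allI impI subsetI)
      fix j u assume j: "j < int (Suc n)" and u: "u \<in> Mj j"
      show "u \<in> ?im"
      proof (cases "j < 0")
        case True
        then show ?thesis using neg[OF True] u vm.subspace_0[OF im_sub] by auto
      next
        case False
        obtain x y where xy: "u = x + y" "x \<in> kv.span (G j)" "y \<in> N j" using u G(3) by blast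
        have "G j \<subseteq> ?im"
        proof
          fix g assume "g \<in> G j"
          with False obtain y where "y \<in> Y" "c y = g" using ex[of g j] by auto
          then show "g \<in> ?im"
            by (intro image_eqI[of _ _ "single y 1"]) (auto simp: single_free)
        qed
        then have "x \<in> ?im"
          using xy(2) kv.span_minimal[OF _ vm_subspace_kv[OF im_sub]] by blast
        moreover have "y \<in> ?im"
        proof -
          have "{vscale (indet x) u |x u. u \<in> Mj (j - 1)} \<subseteq> ?im"
          proof clarify
            fix x u assume "u \<in> Mj (j - 1)"
            moreover have "j - 1 < int n" using j by simp
            ultimately have "u \<in> ?im" using Suc by blast
            then show "vscale (indet x) u \<in> ?im" by (rule vm.subspace_scale[OF im_sub])
          qed
          then show ?thesis
            using xy(3) kv.span_minimal[OF _ vm_subspace_kv[OF im_sub]] unfolding N_def by blast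
        qed
        ultimately show ?thesis unfolding xy(1) by (rule vm.subspace_add[OF im_sub])
      qed
    qed
  qed
  show ?thesis
  proof (intro exI[of _ Y] exI[of _ D'] exI[of _ c] conjI ballI impI)
    show "lin c ` free Y = M"
    proof
      show "?im \<subseteq> M"
        using M(1) cM by (auto intro!: lin_in_subspace simp: free_def Mj_def)
      show "M \<subseteq> ?im"
      proof
        fix u assume u: "u \<in> M"
        obtain J where J: "finite J" "(\<Sum>j\<in>J. hcomp D j u) = u" using sum_hcomp by blast
        have "hcomp D j u \<in> ?im" for j
        proof -
          have "hcomp D j u \<in> Mj j" using u M by (auto simp: Mj_def hcomp_hvec)
          moreover have "j < int (nat (j + 1) + 1)" by simp
          ultimately show ?thesis using Mj_im by blast
        qed
        then have "(\<Sum>j\<in>J. hcomp D j u) \<in> ?im" by (intro vm.subspace_sum[OF im_sub])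
        then show "u \<in> ?im" by (simp add: J)
      qed
    qed
  next
    fix u assume u: "u \<in> free Y" "lin c u = 0"
    \<comment> \<open>A monomial of positive degree contains a variable, so its product with an element of lower degree lies in \<open>N j\<close>.\<close>
    have pos: "vscale p v \<in> N j" if p: "p \<in> homog i" "i \<noteq> 0" and v: "v \<in> Mj (j - i)" for p v i j
    proof -
      have "vscale (single m a) v \<in> N j" if m: "int (size m) = i" for m a
      proof -
        obtain x m' where xm: "m = add_mset x m'" using p(2) m by (cases m) auto
        have "vscale (single m' a) v \<in> hvec X D (int (size m') + (j - i))"
          by (rule hvec_vscale) (use v in \<open>auto simp: homog_single Mj_def\<close>)
        moreover have "int (size m') + (j - i) = j - 1" using m by (simp add: xm)
        ultimately have "vscale (single m' a) v \<in> Mj (j - 1)"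
          using v M(1) by (simp add: Mj_def vm.subspace_scale)
        moreover have "vscale (single m a) v = vscale (indet x) (vscale (single m' a) v)"
          by (simp add: indet_def monom_def mult_single xm)
        ultimately show ?thesis unfolding N_def by (intro kv.span_base) blast
      qed
      then have "(\<Sum>m\<in>keys p. vscale (single m (lookup p m)) v) \<in> N j"
        using p(1) by (intro kv.subspace_sum[OF N_sub]) (auto simp: homog_def)
      then show ?thesis by (simp add: vm.scale_sum_left[symmetric] sum_single_eq)
    qed
    show "u \<in> mfree"
      unfolding mfree_def
    proof (intro CollectI allI)
      fix y0
      show "const (lookup u y0) = 0"
      proof (cases "y0 \<in> keys u")
        case True
        define j where "j = D' y0"
        define T where "T = {y \<in> keys u. D' y = j}"
        \<comment> \<open>Split the degree \<open>j\<close> part of the relation according to whether the generator itself has degree \<open>j\<close>.\<close>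
        have "lin c (hcomp D' j u) = hcomp D (j + 0) (lin c u)"
          using hcomp_lin[of u Y c X D D' 0 j] u(1) ch by simp
        then have "0 = lin c (hcomp D' j u)" by (simp add: u)
        also have "\<dots> = (\<Sum>y\<in>keys u. vscale (hpart (j - D' y) (lookup u y)) (c y))"
          by (subst lin_superset[of "keys u"]) (auto simp: lookup_hcomp in_keys_iff)
        also have "\<dots> = (\<Sum>y\<in>T. vscale (hpart (j - D' y) (lookup u y)) (c y)) +
            (\<Sum>y\<in>keys u - T. vscale (hpart (j - D' y) (lookup u y)) (c y))"
          by (subst add.commute, rule sum.subset_diff) (auto simp: T_def)
        also have "(\<Sum>y\<in>T. vscale (hpart (j - D' y) (lookup u y)) (c y)) =
            (\<Sum>y\<in>T. kscale (const (lookup u y)) (c y))"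
        proof (rule sum.cong[OF refl])
          fix y assume "y \<in> T"
          then have "hpart (j - D' y) (lookup u y) = single {#} (const (lookup u y))"
            by (auto intro!: poly_mapping_eqI simp: T_def lookup_hpart lookup_single when_def const_def)
          then show "vscale (hpart (j - D' y) (lookup u y)) (c y) = kscale (const (lookup u y)) (c y)"
            by (simp add: kscale_def)
        qed
        finally have "(\<Sum>y\<in>T. kscale (const (lookup u y)) (c y)) =
            - (\<Sum>y\<in>keys u - T. vscale (hpart (j - D' y) (lookup u y)) (c y))"
          by (simp add: eq_neg_iff_add_eq_0)
        moreover have "(\<Sum>y\<in>keys u - T. vscale (hpart (j - D' y) (lookup u y)) (c y)) \<in> N j"
        proof (rule kv.subspace_sum[OF N_sub])
          fix y assume y: "y \<in> keys u - T"
          then have "c y \<in> Mj (j - (j - D' y))" "j - D' y \<noteq> 0"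
            using cM u(1) by (auto simp: free_def T_def)
          then show "vscale (hpart (j - D' y) (lookup u y)) (c y) \<in> N j"
            using pos[OF hpart_homog] by blast
        qed
        ultimately have "(\<Sum>y\<in>T. kscale (const (lookup u y)) (c y)) \<in> N j"
          using kv.subspace_neg[OF N_sub] by simp
        moreover have "inj_on c T"
        proof (rule inj_onI)
          fix y y' assume "y \<in> T" "y' \<in> T" "c y = c y'"
          then have "y \<in> Y" "y' \<in> Y" "from_nat_into GG y = from_nat_into GG y'"
            using u(1) by (auto simp: T_def free_def c_def D'_def prod_eq_iff)
          then show "y = y'" using inj by (auto dest: inj_onD)
        qed
        moreover have "c ` T \<subseteq> G j"
          using cG(1) u(1) by (auto simp: T_def free_def)
        ultimately show ?thesis
          using Gind[of T c j "\<lambda>y. const (lookup u y)" y0] True by (simp add: T_def j_def)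
      next
        case False
        then show ?thesis by (simp add: in_keys_iff)
      qed
    qed
  qed (use cG ch in auto)
qed

text \<open>
  Cover the kernel of the last map minimally, again and again. That the kernel of a minimal cover lies in
  \<open>\<mm>F\<close> makes the next map minimal. The sequence of choices runs over triples of a basis, its degrees and the
  submodule to be covered next.
\<close>

theorem minimal_resolution_exists:
  fixes I :: "('v::finite, 'k::field) mpoly set"
  assumes I: "module.subspace (*) I" "\<And>p j. p \<in> I \<Longrightarrow> hpart j p \<in> I" "\<And>p. p \<in> I \<Longrightarrow> const p = 0"
  obtains X :: "nat \<Rightarrow> nat set" and D c where "minimal_resolution X D c I 0"
proof -
  define P where "P n s = (case s of (X, D, M) \<Rightarrow> (\<forall>b\<in>X. D b \<ge> 0) \<and> vm.subspace M \<and> M \<subseteq> free X \<and>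
      (\<forall>u\<in>M. \<forall>j. hcomp D j u \<in> M) \<and> M \<subseteq> mfree \<and> (n = 0 \<longrightarrow> X = {0} \<and> D 0 = 0 \<and> M = single 0 ` I))"
    for n :: nat and s :: "nat set \<times> (nat \<Rightarrow> int) \<times> ('v, 'k) vec set"
  define Q where "Q s s' = (case s of (X, D, M) \<Rightarrow> case s' of (X', D', M') \<Rightarrow>
      \<exists>c. (\<forall>b\<in>X'. c b \<in> hvec X D (D' b)) \<and> lin c ` free X' = M \<and> M' = {u \<in> free X'. lin c u = 0})"
    for s s' :: "nat set \<times> (nat \<Rightarrow> int) \<times> ('v, 'k) vec set"
  have "\<exists>f. \<forall>n. P n (f n) \<and> Q (f n) (f (Suc n))"
  proof (rule dependent_nat_choice)
    have md: "module ((*) :: ('v, 'k) mpoly \<Rightarrow> _)" by unfold_locales (auto simp: algebra_simps)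
    have "vm.subspace (single (0::nat) ` I)"
    proof (rule vm.subspaceI)
      show "0 \<in> single (0::nat) ` I"
        using module.subspace_0[OF md I(1)] by (intro image_eqI[of _ _ 0]) auto
      fix x y assume "x \<in> single (0::nat) ` I" "y \<in> single (0::nat) ` I"
      then show "x + y \<in> single 0 ` I"
        using module.subspace_add[OF md I(1)] by (auto simp: single_add[symmetric])
    next
      fix p x assume "x \<in> single (0::nat) ` I"
      then show "vscale p x \<in> single 0 ` I"
        using module.subspace_scale[OF md I(1)] by (auto simp: vscale_single)
    qed
    moreover have "hcomp (\<lambda>_. 0) j (single (0::nat) p) = single 0 (hpart j p)" for j and p :: "('v, 'k) mpoly"
      by (rule poly_mapping_eqI) (simp add: lookup_hcomp lookup_single when_def)
    ultimately have "P 0 ({0}, \<lambda>_. 0, single 0 ` I)"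
      using I by (auto simp: P_def single_free mfree_def lookup_single when_def)
    then show "\<exists>s. P 0 s" ..
  next
    fix s n assume "P n s"
    obtain X D M where s: "s = (X, D, M)" by (cases s)
    from \<open>P n s\<close> have M: "vm.subspace M" "M \<subseteq> free X" "\<And>u j. u \<in> M \<Longrightarrow> hcomp D j u \<in> M"
      "\<And>b. b \<in> X \<Longrightarrow> D b \<ge> 0"
      by (auto simp: P_def s)
    obtain Y :: "nat set" and D' c where Y: "\<forall>a\<in>Y. D' a \<ge> 0" "\<forall>a\<in>Y. c a \<in> hvec X D (D' a)"
      "lin c ` free Y = M" "\<forall>u\<in>free Y. lin c u = 0 \<longrightarrow> u \<in> mfree"
      using minimal_graded_cover[OF M] by metis
    have "vm.subspace {u \<in> free Y. lin c u = 0}"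
      by (rule vm.subspaceI) (auto simp: free_rules lin_add lin_vscale)
    moreover have "hcomp D' j u \<in> {u \<in> free Y. lin c u = 0}" if "u \<in> {u \<in> free Y. lin c u = 0}" for j u
      using that hcomp_lin[of u Y c X D D' 0 j] Y(2) by (auto simp: hcomp_free)
    ultimately show "\<exists>s'. P (Suc n) s' \<and> Q s s'"
      using Y by (intro exI[of _ "(Y, D', {u \<in> free Y. lin c u = 0})"]) (auto simp: P_def Q_def s)
  qed
  then obtain f where f: "\<And>n. P n (f n)" "\<And>n. Q (f n) (f (Suc n))" by blast
  define X where "X n = fst (f n)" for n
  define D where "D n = fst (snd (f n))" for n
  define M where "M n = snd (snd (f n))" for n
  have fn: "f n = (X n, D n, M n)" for n by (simp add: X_def D_def M_def)
  define S where "S n c \<longleftrightarrow> (\<forall>b\<in>X (Suc n). c b \<in> hvec (X n) (D n) (D (Suc n) b)) \<and>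
      lin c ` free (X (Suc n)) = M n \<and> M (Suc n) = {u \<in> free (X (Suc n)). lin c u = 0}" for n c
  define c where "c n = (SOME c. S n c)" for n
  have "\<exists>c. S n c" for n
    using f(2)[of n] unfolding Q_def fn prod.case S_def .
  then have "S n (c n)" for n
    unfolding c_def by (rule someI_ex)
  then have c: "\<And>n b. b \<in> X (Suc n) \<Longrightarrow> c n b \<in> hvec (X n) (D n) (D (Suc n) b)"
    "\<And>n. lin (c n) ` free (X (Suc n)) = M n" "\<And>n. M (Suc n) = {u \<in> free (X (Suc n)). lin (c n) u = 0}"
    by (simp_all add: S_def)
  have P0: "X 0 = {0}" "D 0 0 = 0" "M 0 = single 0 ` I" "M n \<subseteq> mfree" for n
    using f(1)[of 0] f(1)[of n] by (auto simp: P_def fn)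
  have cM: "c n b \<in> M n" if "b \<in> X (Suc n)" for n b
  proof -
    have "lin (c n) (single b 1) \<in> M n" unfolding c(2)[symmetric] using that by (intro imageI single_free)
    then show ?thesis by simp
  qed
  have "minimal_resolution X D c I 0"
  proof
    show "lin (c n) (c (Suc n) b) = 0" if "b \<in> X (Suc (Suc n))" for b n
      using cM[OF that] by (simp add: c(3))
    show "\<exists>w\<in>free (X (Suc (Suc n))). lin (c (Suc n)) w = u"
      if "u \<in> free (X (Suc n))" "lin (c n) u = 0" for u n
    proof -
      have "u \<in> M (Suc n)" using that by (simp add: c(3))
      then show ?thesis unfolding c(2)[symmetric] by auto
    qed
    show "lin (c 0) ` free (X 1) = single 0 ` I"
      using c(2)[of 0] P0(3) by simp
    show "c n b \<in> mfree" if "b \<in> X (Suc n)" for b n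
      using cM[OF that] P0(4) by blast
    show "c n b \<in> hvec (X n) (D n) (D (Suc n) b)" if "b \<in> X (Suc n)" for b n
      using that by (rule c(1))
  qed (rule P0(1), rule P0(2))
  then show thesis by (rule that)
qed

section \<open>Monomial ideals\<close>

lemma mult_module: "module ((*) :: 'a::comm_ring_1 \<Rightarrow> _)"
  by unfold_locales (auto simp: algebra_simps)

interpretation rm: module "(*) :: 'a::comm_ring_1 \<Rightarrow> _"
  by (rule mult_module)

text \<open>
  The ideal generated by the monomials \<open>S\<close> (\<open>ideal_gen_monom\<close>), in a form that reads membership off the
  support.
\<close>

definition mono_ideal :: "'v::finite multiset set \<Rightarrow> ('v, 'k::field) mpoly set" where
  "mono_ideal S = {p. \<forall>m\<in>keys p. \<exists>s\<in>S. s \<subseteq># m}"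

lemma mono_ideal_subspace: "rm.subspace (mono_ideal S :: ('v::finite, 'k::field) mpoly set)"
proof (rule rm.subspaceI)
  fix p q :: "('v, 'k) mpoly" assume "p \<in> mono_ideal S" "q \<in> mono_ideal S"
  then show "p + q \<in> mono_ideal S"
    using keys_add[of p q] by (auto simp: mono_ideal_def)
next
  fix r p :: "('v, 'k) mpoly" assume p: "p \<in> mono_ideal S"
  show "r * p \<in> mono_ideal S"
    unfolding mono_ideal_def
  proof (intro CollectI ballI)
    fix m assume "m \<in> keys (r * p)"
    then obtain a b where m: "m = a + b" "b \<in> keys p" using keys_mult[of r p] by auto
    then obtain s where "s \<in> S" "s \<subseteq># b" using p by (auto simp: mono_ideal_def)
    then show "\<exists>s\<in>S. s \<subseteq># m" using m
      by (metis mset_subset_eq_add_right subset_mset.order_trans)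
  qed
qed (simp add: mono_ideal_def)

lemma ideal_gen_monom: "ideal_gen (monom ` S) = (mono_ideal S :: ('v::finite, 'k::field) mpoly set)"
proof
  show "ideal_gen (monom ` S) \<subseteq> (mono_ideal S :: ('v, 'k) mpoly set)"
    unfolding ideal_gen_def
    by (rule rm.span_minimal[OF _ mono_ideal_subspace]) (auto simp: mono_ideal_def monom_def)
  show "mono_ideal S \<subseteq> (ideal_gen (monom ` S) :: ('v, 'k) mpoly set)"
  proof
    fix p :: "('v, 'k) mpoly" assume p: "p \<in> mono_ideal S"
    have "(\<Sum>m\<in>keys p. single m (lookup p m)) \<in> rm.span (monom ` S)"
    proof (rule rm.span_sum)
      fix m assume "m \<in> keys p"
      then obtain s where s: "s \<in> S" "s \<subseteq># m" using p by (auto simp: mono_ideal_def)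
      have "single m (lookup p m) = single (m - s) (lookup p m) * monom s"
        using s(2) by (simp add: monom_def mult_single)
      also have "\<dots> \<in> rm.span (monom ` S)"
        using s(1) by (intro rm.span_scale rm.span_base) auto
      finally show "single m (lookup p m) \<in> rm.span (monom ` S)" .
    qed
    then show "p \<in> ideal_gen (monom ` S)" by (simp add: sum_single_eq ideal_gen_def)
  qed
qed

lemma monom_in_mono_ideal: "(monom m :: ('v::finite, 'k::field) mpoly) \<in> mono_ideal S \<longleftrightarrow> (\<exists>s\<in>S. s \<subseteq># m)"
  by (simp add: mono_ideal_def monom_def)

lemma mono_ideal_eqI:
  assumes "\<And>m. (\<exists>s\<in>S. s \<subseteq># m) \<longleftrightarrow> (\<exists>s\<in>T. s \<subseteq># m)"
  shows "mono_ideal S = mono_ideal T"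
  using assms by (simp add: mono_ideal_def)

lemma mono_ideal_hpart: "p \<in> mono_ideal S \<Longrightarrow> hpart j p \<in> mono_ideal S"
  by (auto simp: mono_ideal_def in_keys_iff lookup_hpart split: if_splits)

lemma mono_ideal_const: "{#} \<notin> S \<Longrightarrow> p \<in> mono_ideal S \<Longrightarrow> const p = 0"
  by (rule ccontr) (auto simp: mono_ideal_def const_def in_keys_iff dest!: bspec[of _ _ "{#}"])

lemma irrelevant_ideal_const:
  fixes p :: "('v::finite, 'k::field) mpoly"
  shows "p \<in> irrelevant_ideal \<longleftrightarrow> const p = 0"
proof -
  have "range (indet :: 'v \<Rightarrow> ('v, 'k) mpoly) = monom ` range (\<lambda>x. {#x#})"
    by (auto simp: indet_def)
  then have "(irrelevant_ideal :: ('v, 'k) mpoly set) = mono_ideal (range (\<lambda>x. {#x#}))"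
    by (simp add: irrelevant_ideal_def ideal_gen_monom)
  moreover have "(\<exists>s\<in>range (\<lambda>x. {#x#}). s \<subseteq># m) \<longleftrightarrow> m \<noteq> {#}" for m :: "'v multiset"
    by (cases m) auto
  ultimately show ?thesis
    by (auto simp: mono_ideal_def const_def not_in_keys_iff_lookup_eq_zero[symmetric])
qed

section \<open>Betti numbers of the quotient ring\<close>

definition quotient_betti :: "('v::finite, 'k::field) mpoly set \<Rightarrow> nat \<Rightarrow> int \<Rightarrow> nat" where
  "quotient_betti I n j = (THE r. \<exists>(X :: nat \<Rightarrow> nat set) D c.
     minimal_resolution X D c I 0 \<and> r = card {b \<in> X n. D n b = j})"

lemma mono_ideal_resolution:
  assumes "{#} \<notin> S"
  obtains X :: "nat \<Rightarrow> nat set" and D c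
  where "minimal_resolution X D c (mono_ideal S :: ('v::finite, 'k::field) mpoly set) 0"
  by (rule minimal_resolution_exists[of "mono_ideal S"])
    (use assms in \<open>auto intro: mono_ideal_subspace mono_ideal_hpart mono_ideal_const\<close>)

text \<open>
  The index type of the given resolution is arbitrary, so a resolution with bases of another type, such as a mapping cone,
  yields the Betti numbers directly.
\<close>

lemma quotient_betti_eq:
  fixes c :: "nat \<Rightarrow> 'b \<Rightarrow> ('b \<Rightarrow>\<^sub>0 ('v::finite multiset \<Rightarrow>\<^sub>0 'k::field))"
  assumes "{#} \<notin> S" and R: "minimal_resolution X D c (mono_ideal S) pt"
  shows "quotient_betti (mono_ideal S :: ('v, 'k) mpoly set) n j = card {b \<in> X n. D n b = j}"
  unfolding quotient_betti_def
proof (rule the_equality)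
  obtain X' :: "nat \<Rightarrow> nat set" and D' c' where R': "minimal_resolution X' D' c' (mono_ideal S :: ('v, 'k) mpoly set) 0"
    using mono_ideal_resolution[OF assms(1)] by blast
  from R' minimal_resolution_rank_unique[OF R R', of n j]
  show "\<exists>(X' :: nat \<Rightarrow> nat set) D' c'. minimal_resolution X' D' c' (mono_ideal S :: ('v, 'k) mpoly set) 0 \<and>
      card {b \<in> X n. D n b = j} = card {b \<in> X' n. D' n b = j}" by blast
next
  fix r assume "\<exists>(X' :: nat \<Rightarrow> nat set) D' c'. minimal_resolution X' D' c' (mono_ideal S :: ('v, 'k) mpoly set) 0 \<and>
      r = card {b \<in> X' n. D' n b = j}"
  then obtain X' :: "nat \<Rightarrow> nat set" and D' c'
    where R': "minimal_resolution X' D' c' (mono_ideal S :: ('v, 'k) mpoly set) 0"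
      and r: "r = card {b \<in> X' n. D' n b = j}" by blast
  show "r = card {b \<in> X n. D n b = j}"
    unfolding r by (rule minimal_resolution_rank_unique[OF R' R])
qed

lemma vec_scale_eq: "vec_scale = vscale"
  by (intro ext) (simp add: vec_scale_def vscale_def)

lemma free_mod_eq: "free_mod = free"
  by (intro ext) (simp add: free_mod_def free_def)

lemma free_homog_eq: "free_homog = hvec"
proof (intro ext set_eqI)
  fix B :: "nat set" and D j and u :: "('v::finite, 'k::field) vec"
  show "u \<in> free_homog B D j \<longleftrightarrow> u \<in> hvec B D j"
    by (auto simp: free_homog_def hvec_def free_mod_eq)
      (metis free_def homog_zero in_keys_iff mem_Collect_eq subsetD)
qed

text \<open>
  Cutting off \<open>F\<^sub>0 = R\<close>; the augmentation is the first boundary map, with \<open>F\<^sub>0\<close> identified with \<open>R\<close>.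
\<close>

lemma resolution_of_ideal:
  fixes I :: "('v::finite, 'k::field) mpoly set"
  assumes "minimal_resolution X D c I (0::nat)"
  shows "minimal_graded_free_resolution I (\<lambda>n. X (Suc n)) (\<lambda>n. D (Suc n))
    (\<lambda>n. lin (c (Suc n))) (\<lambda>u. lookup (lin (c 0) u) 0)"
proof -
  interpret minimal_resolution X D c I 0 by fact
  have c0: "lin (c 0) u = single 0 (lookup (lin (c 0) u) 0)" if "u \<in> free (X 1)" for u
  proof -
    have "lin (c 0) u \<in> single 0 ` I" using that image by auto
    then show ?thesis by auto
  qed
  have c0_zero: "lookup (lin (c 0) u) 0 = 0 \<longleftrightarrow> lin (c 0) u = 0" if "u \<in> free (X 1)" for u
    using c0[OF that] by (metis lookup_zero single_zero)
  show ?thesis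
    unfolding minimal_graded_free_resolution_def vec_scale_eq free_mod_eq free_homog_eq
  proof (intro conjI allI impI subsetI equalityI; (elim CollectE imageE conjE)?)
    show "module_hom vscale (*) (\<lambda>u. lookup (lin (c 0) u) 0)"
      by (simp add: module_hom_iff vscale_module mult_module lin_add lin_vscale lookup_add)
    show "module_hom vscale vscale (lin (c (Suc n)))" for n by (rule lin_hom)
  next
    fix j p u assume "p = lookup (lin (c 0) u) 0" "u \<in> hvec (X (Suc 0)) (D (Suc 0)) j"
    then show "p \<in> homog j"
      using boundary_hvec[of u 0 j] by (auto simp: hvec_def base_degree dest: spec[of _ 0])
  next
    fix n j p u assume "p = lin (c (Suc n)) u" "u \<in> hvec (X (Suc (Suc n))) (D (Suc (Suc n))) j"
    then show "p \<in> hvec (X (Suc n)) (D (Suc n)) j" using boundary_hvec by blast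
  next
    fix p u assume "p = lookup (lin (c 0) u) 0" "u \<in> free (X (Suc 0))"
    moreover from this have "lin (c 0) u \<in> single 0 ` I" using image by auto
    ultimately show "p \<in> I" by auto
  next
    fix p assume "p \<in> I"
    then have "single 0 p \<in> lin (c 0) ` free (X 1)" unfolding image by simp
    then show "p \<in> (\<lambda>u. lookup (lin (c 0) u) 0) ` free (X (Suc 0))"
      by (fastforce simp: image_iff dest: arg_cong[of _ _ "\<lambda>u. lookup u 0"])
  next
    fix u assume "u \<in> free (X (Suc 0))" "lookup (lin (c 0) u) 0 = 0"
    then show "u \<in> lin (c (Suc 0)) ` free (X (Suc 1))"
      using exact[of u 0] c0_zero by auto
  next
    fix u w assume "u = lin (c (Suc 0)) w" "w \<in> free (X (Suc 1))"
    then show "u \<in> {u \<in> free (X (Suc 0)). lookup (lin (c 0) u) 0 = 0}"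
      using boundary_boundary[of w 0] boundary_free[of w 1] by simp
  next
    fix n u assume "u \<in> free (X (Suc (Suc n)))" "lin (c (Suc n)) u = 0"
    then show "u \<in> lin (c (Suc (Suc n))) ` free (X (Suc (Suc (Suc n))))"
      using exact[of u "Suc n"] by auto
  next
    fix n u w assume "u = lin (c (Suc (Suc n))) w" "w \<in> free (X (Suc (Suc (Suc n))))"
    then show "u \<in> {u \<in> free (X (Suc (Suc n))). lin (c (Suc n)) u = 0}"
      using boundary_boundary[of w "Suc n"] boundary_free[of w "Suc (Suc n)"] by simp
  next
    fix n b and u :: "('v, 'k) vec" assume "u \<in> free (X (Suc (Suc n)))"
    from boundary_mfree[OF this] show "lookup (lin (c (Suc n)) u) b \<in> irrelevant_ideal"
      by (simp add: mfree_def irrelevant_ideal_const)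
  qed
qed

text \<open>
  Splicing in \<open>F\<^sub>0 = R\<close>. The augmentation becomes the first boundary map, and the new resolution is minimal
  because \<open>I\<close> is contained in \<open>\<mm>\<close>.
\<close>

lemma resolution_of_quotient:
  fixes I :: "('v::finite, 'k::field) mpoly set"
  assumes "minimal_graded_free_resolution I B D \<delta> \<epsilon>" and I: "\<And>p. p \<in> I \<Longrightarrow> const p = 0"
  shows "minimal_resolution (case_nat {0} B) (case_nat (\<lambda>_. 0) D)
    (case_nat (\<lambda>b. single 0 (\<epsilon> (single b 1))) (\<lambda>n b. \<delta> n (single b 1))) I (0::nat)"
    (is "minimal_resolution ?X ?D ?c I 0")
proof -
  interpret R: minimal_graded_free_resolution I B D \<delta> \<epsilon> by fact
  have d: "lin (?c (Suc n)) u = \<delta> n u" for n u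
    unfolding nat.case by (rule hom_eq_lin[OF R.hom_diff[unfolded vec_scale_eq], symmetric])
  have "module_hom vscale vscale (\<lambda>u. single (0::nat) (\<epsilon> u))"
    using R.hom_aug unfolding vec_scale_eq by (simp add: module_hom_iff vscale_module single_add vscale_single)
  note hom = this
  have e: "lin (?c 0) u = single 0 (\<epsilon> u)" for u
    unfolding nat.case by (rule hom_eq_lin[OF hom, symmetric])
  have one: "(1 :: ('v, 'k) mpoly) \<in> homog 0" by (simp add: homog_iff lookup_one)
  have basis: "(single b 1 :: ('v, 'k) vec) \<in> hvec (B n) (D n) (D n b)" if "b \<in> B n" for b n
    using hvec_single[OF that one, of "D n"] by simp
  show ?thesis
  proof
    fix b n assume b: "b \<in> ?X (Suc n)"
    show "?c n b \<in> hvec (?X n) (?D n) (?D (Suc n) b)"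
    proof (cases n)
      case 0
      have "\<epsilon> (single b 1) \<in> homog (D 0 b)"
        using R.degree_aug[of "D 0 b"] basis[of b 0] b 0 by (auto simp: free_homog_eq)
      from hvec_single[OF _ this, of 0 "{0}" "\<lambda>_. 0"] show ?thesis by (simp add: 0)
    next
      case (Suc k)
      then show ?thesis
        using R.degree_diff[of k "D (Suc k) b"] basis[of b "Suc k"] b by (auto simp: free_homog_eq)
    qed
    show "?c n b \<in> mfree"
    proof (cases n)
      case 0
      have "\<epsilon> (single b 1) \<in> I"
        using R.surj_aug single_free[of b "B 0"] b 0 by (auto simp: free_mod_eq)
      then show ?thesis using I by (simp add: 0 mfree_def lookup_single when_def)
    next
      case (Suc k)
      then show ?thesis
        using R.minimal[of "single b 1" k] b by (simp add: mfree_def free_mod_eq single_free irrelevant_ideal_const)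
    qed
  next
    fix b n assume b: "b \<in> ?X (Suc (Suc n))"
    show "lin (?c n) (?c (Suc n) b) = 0"
    proof (cases n)
      case 0
      have "single b 1 \<in> free_mod (B 1)" using b 0 by (simp add: single_free free_mod_eq)
      then have "\<delta> 0 (single b 1) \<in> {u \<in> free_mod (B 0). \<epsilon> u = 0}"
        unfolding R.exact_aug by (rule imageI)
      then show ?thesis by (simp add: 0 e[unfolded nat.case])
    next
      case (Suc k)
      have "single b 1 \<in> free_mod (B (Suc (Suc k)))" using b Suc by (simp add: single_free free_mod_eq)
      then have "\<delta> (Suc k) (single b 1) \<in> {u \<in> free_mod (B (Suc k)). \<delta> k u = 0}"
        unfolding R.exact_diff by (rule imageI)
      then show ?thesis using d[of k] by (simp add: Suc)
    qed
  next
    show "lin (?c 0) ` free (?X 1) = single 0 ` I"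
      unfolding e using R.surj_aug by (auto simp: free_mod_eq)
  next
    fix u n assume u: "u \<in> free (?X (Suc n))" "lin (?c n) u = 0"
    show "\<exists>w\<in>free (?X (Suc (Suc n))). lin (?c (Suc n)) w = u"
    proof (cases n)
      case 0
      have "\<epsilon> u = 0" using u(2) unfolding 0 e by (metis lookup_single_eq lookup_zero)
      then have "u \<in> {u \<in> free_mod (B 0). \<epsilon> u = 0}" using u(1) 0 by (simp add: free_mod_eq)
      then show ?thesis unfolding R.exact_aug d 0 by (auto simp: free_mod_eq)
    next
      case (Suc k)
      have "\<delta> k u = 0" using u(2) unfolding Suc d .
      then have "u \<in> {u \<in> free_mod (B (Suc k)). \<delta> k u = 0}" using u(1) Suc by (simp add: free_mod_eq)
      then show ?thesis unfolding R.exact_diff d Suc by (auto simp: free_mod_eq)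
    qed
  qed simp_all
qed

theorem betti_quotient_betti:
  assumes "{#} \<notin> S"
  shows "betti (mono_ideal S :: ('v::finite, 'k::field) mpoly set) i j = quotient_betti (mono_ideal S :: ('v, 'k) mpoly set) (Suc i) j"
  unfolding betti_def
proof (rule the_equality)
  obtain X :: "nat \<Rightarrow> nat set" and D c where R: "minimal_resolution X D c (mono_ideal S :: ('v, 'k) mpoly set) 0"
    using mono_ideal_resolution[OF assms] by blast
  show "\<exists>B D \<delta> \<epsilon>. minimal_graded_free_resolution (mono_ideal S :: ('v, 'k) mpoly set) B D \<delta> \<epsilon> \<and>
      quotient_betti (mono_ideal S :: ('v, 'k) mpoly set) (Suc i) j = card {b \<in> B i. D i b = j}"
    using resolution_of_ideal[OF R] quotient_betti_eq[OF assms R, of "Suc i" j] by blast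
next
  fix r assume "\<exists>B D \<delta> \<epsilon>. minimal_graded_free_resolution (mono_ideal S :: ('v, 'k) mpoly set) B D \<delta> \<epsilon> \<and>
      r = card {b \<in> B i. D i b = j}"
  then obtain B D \<delta> \<epsilon> where R: "minimal_graded_free_resolution (mono_ideal S :: ('v, 'k) mpoly set) B D \<delta> \<epsilon>"
    and r: "r = card {b \<in> B i. D i b = j}" by blast
  from quotient_betti_eq[OF assms resolution_of_quotient[OF R mono_ideal_const[OF assms]], of "Suc i" j]
  show "r = quotient_betti (mono_ideal S :: ('v, 'k) mpoly set) (Suc i) j" by (simp add: r)
qed

lemma quotient_betti_0:
  assumes "{#} \<notin> S"
  shows "quotient_betti (mono_ideal S :: ('v::finite, 'k::field) mpoly set) 0 j = (if j = 0 then 1 else 0)"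
proof -
  obtain X :: "nat \<Rightarrow> nat set" and D c where R: "minimal_resolution X D c (mono_ideal S :: ('v, 'k) mpoly set) 0"
    using mono_ideal_resolution[OF assms] by blast
  then interpret minimal_resolution X D c "mono_ideal S :: ('v, 'k) mpoly set" 0 .
  have "{b \<in> X 0. D 0 b = j} = (if j = 0 then {0} else {})"
    by (auto simp: base base_degree)
  then show ?thesis by (simp add: quotient_betti_eq[OF assms R])
qed

section \<open>A Taylor resolution on lists of generators\<close>

lemma mset_diff_chain:
  assumes "q \<subseteq># r" "r \<subseteq># w"
  shows "w - r + (r - q) = w - q"
proof (rule multiset_eqI)
  fix x
  show "count (w - r + (r - q)) x = count (w - q) x"
    using mset_subset_eq_count[OF assms(1), of x] mset_subset_eq_count[OF assms(2), of x] by simp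
qed

fun list_lcm :: "'v multiset list \<Rightarrow> 'v multiset" where
  "list_lcm [] = {#}"
| "list_lcm (a # s) = a \<union># list_lcm s"

lemma list_lcm_le_iff: "list_lcm s \<subseteq># w \<longleftrightarrow> (\<forall>a\<in>set s. a \<subseteq># w)"
  by (induction s) (auto simp: subset_mset.le_sup_iff)

lemma list_lcm_mono: "set r \<subseteq> set s \<Longrightarrow> list_lcm r \<subseteq># list_lcm s"
  using list_lcm_le_iff[of s "list_lcm s"] by (auto simp: list_lcm_le_iff)

abbreviation prepend :: "'a \<Rightarrow> ('a list \<Rightarrow>\<^sub>0 'k::field) \<Rightarrow> ('a list \<Rightarrow>\<^sub>0 'k)" where
  "prepend a z \<equiv> lin (\<lambda>r. single (a # r) 1) z"

text \<open>
  The boundary of an ordered simplex with vertex list \<open>s\<close>, where vertices may be repeated. The usual Taylor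
  complex uses sets of generators; with lists, no order on the generators enters the signs, and every function on
  the generators acts on the complex, also when it is not injective. The complex has infinite length, which is
  harmless for comparison maps. The recursion says that prepending a vertex is a contracting homotopy.
\<close>

fun simplex_boundary :: "'a list \<Rightarrow> ('a list \<Rightarrow>\<^sub>0 'k::field)" where
  "simplex_boundary [] = 0"
| "simplex_boundary (a # s) = single s 1 - prepend a (simplex_boundary s)"

lemma lin_keys: "r \<in> keys (lin f u) \<Longrightarrow> \<exists>b\<in>keys u. r \<in> keys (f b)"
proof -
  assume "r \<in> keys (lin f u)"
  then have "(\<Sum>b\<in>keys u. lookup u b * lookup (f b) r) \<noteq> 0" by (simp add: in_keys_iff lookup_lin)
  then obtain b where "b \<in> keys u" "lookup u b * lookup (f b) r \<noteq> 0" by (meson sum.neutral)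
  then show ?thesis by (auto simp: in_keys_iff intro!: bexI[of _ b])
qed

lemma simplex_boundary_keys: "r \<in> keys (simplex_boundary s :: 'a list \<Rightarrow>\<^sub>0 'k::field) \<Longrightarrow> length s = Suc (length r) \<and> set r \<subseteq> set s"
proof (induction s arbitrary: r)
  case (Cons a s)
  have "r = s \<or> r \<in> keys (prepend a (simplex_boundary s) :: 'a list \<Rightarrow>\<^sub>0 'k)"
    using Cons.prems keys_diff[of "single s (1::'k)" "prepend a (simplex_boundary s)"] by auto
  then show ?case
  proof
    assume "r \<in> keys (prepend a (simplex_boundary s) :: 'a list \<Rightarrow>\<^sub>0 'k)"
    from lin_keys[OF this] show ?thesis using Cons.IH by fastforce
  qed auto
qed simp

lemma simplex_boundary_squared: "lin simplex_boundary (simplex_boundary s) = (0 :: 'a list \<Rightarrow>\<^sub>0 'k::field)"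
proof (induction s)
  case (Cons a s)
  have "lin simplex_boundary (simplex_boundary (a # s)) = (simplex_boundary s :: 'a list \<Rightarrow>\<^sub>0 'k) - lin (\<lambda>r. single r 1 - prepend a (simplex_boundary r)) (simplex_boundary s)"
    by (simp add: lin_diff lin_lin)
  also have "\<dots> = prepend a (lin simplex_boundary (simplex_boundary s))"
    by (simp add: lin_fun_diff lin_lin)
  finally show ?case by (simp add: Cons)
qed simp

lemma simplex_boundary_map: "lin (\<lambda>r. single (map g r) 1) (simplex_boundary s) = (simplex_boundary (map g s) :: 'a list \<Rightarrow>\<^sub>0 'k::field)"
proof (induction s)
  case (Cons a s)
  have "lin (\<lambda>r. single (map g r) 1) (simplex_boundary (a # s)) =
      single (map g s) (1 :: 'k) - prepend (g a) (lin (\<lambda>r. single (map g r) 1) (simplex_boundary s))"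
    by (simp add: lin_diff lin_lin)
  then show ?case by (simp add: Cons)
qed simp

lemma simplex_boundary_prepend: "lin simplex_boundary (prepend a z) = z - prepend a (lin simplex_boundary z)"
  by (simp add: lin_lin lin_fun_diff)

text \<open>
  The Taylor complex is multigraded, with the list \<open>r\<close> in the degree of its least common multiple. A chain \<open>z\<close>
  over the field determines an element of multidegree \<open>w\<close>, provided that the lists in \<open>z\<close> have least common
  multiples dividing \<open>w\<close>.
\<close>

definition homogenize :: "'v multiset \<Rightarrow> ('v multiset list \<Rightarrow>\<^sub>0 'k::field) \<Rightarrow> ('v multiset list \<Rightarrow>\<^sub>0 ('v multiset \<Rightarrow>\<^sub>0 'k))" where
  "homogenize w z = Poly_Mapping.mapp (\<lambda>r a. single (w - list_lcm r) a) z"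

lemma lookup_homogenize: "lookup (homogenize w z) r = single (w - list_lcm r) (lookup z r)"
  by (auto simp: homogenize_def lookup_mapp when_def in_keys_iff)

lemma homogenize_single: "homogenize w (single r a) = single r (single (w - list_lcm r) a)"
  by (rule poly_mapping_eqI) (auto simp: lookup_homogenize lookup_single when_def)

lemma homogenize_zero [simp]: "homogenize w 0 = 0"
  by (rule poly_mapping_eqI) (simp add: lookup_homogenize)

lemma homogenize_sum: "homogenize w (sum f A) = (\<Sum>a\<in>A. homogenize w (f a))"
proof -
  have "homogenize w (x + y) = homogenize w x + homogenize w y" for x y :: "'a multiset list \<Rightarrow>\<^sub>0 'b"
    by (rule poly_mapping_eqI) (simp add: lookup_homogenize lookup_add single_add)
  then show ?thesis
    by (induction A rule: infinite_finite_induct) auto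
qed

lemma lin_homogenize:
  assumes "\<And>r a. r \<in> keys z \<Longrightarrow> vscale (single (w - list_lcm r) a) (F r) = homogenize w' (vscale a (G r))"
  shows "lin F (homogenize w z) = homogenize w' (lin G z)"
proof -
  have "lin F (homogenize w z) = lin F (homogenize w (\<Sum>r\<in>keys z. single r (lookup z r)))"
    by (simp add: sum_single_eq)
  also have "\<dots> = (\<Sum>r\<in>keys z. vscale (single (w - list_lcm r) (lookup z r)) (F r))"
    by (simp add: homogenize_sum homogenize_single lin_sum)
  also have "\<dots> = (\<Sum>r\<in>keys z. homogenize w' (vscale (lookup z r) (G r)))"
    by (rule sum.cong) (auto simp: assms)
  also have "\<dots> = homogenize w' (lin G z)"
    by (simp add: lin_def homogenize_sum)
  finally show ?thesis .
qed

definition taylor_boundary :: "'v multiset list \<Rightarrow> ('v multiset list \<Rightarrow>\<^sub>0 ('v multiset \<Rightarrow>\<^sub>0 'k::field))" where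
  "taylor_boundary s = homogenize (list_lcm s) (simplex_boundary s)"

lemma taylor_boundary_homogenize:
  fixes z :: "'v multiset list \<Rightarrow>\<^sub>0 'k::field"
  assumes "\<And>r. r \<in> keys z \<Longrightarrow> list_lcm r \<subseteq># w"
  shows "lin taylor_boundary (homogenize w z) = homogenize w (lin simplex_boundary z)"
proof (rule lin_homogenize)
  fix r and a :: 'k assume "r \<in> keys z"
  then have r: "list_lcm r \<subseteq># w" by (rule assms)
  show "vscale (single (w - list_lcm r) a) (taylor_boundary r) = homogenize w (vscale a (simplex_boundary r))"
  proof (rule poly_mapping_eqI)
    fix q
    show "lookup (vscale (single (w - list_lcm r) a) (taylor_boundary r)) q = lookup (homogenize w (vscale a (simplex_boundary r))) q"
    proof (cases "q \<in> keys (simplex_boundary r :: 'v multiset list \<Rightarrow>\<^sub>0 'k)")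
      case True
      then have q: "list_lcm q \<subseteq># list_lcm r" using simplex_boundary_keys list_lcm_mono by metis
      have "w - list_lcm r + (list_lcm r - list_lcm q) = w - list_lcm q"
        by (rule mset_diff_chain[OF q r])
      then show ?thesis
        by (simp add: taylor_boundary_def lookup_homogenize mult_single)
    next
      case False
      then have "lookup (simplex_boundary r :: 'v multiset list \<Rightarrow>\<^sub>0 'k) q = 0" by (simp add: in_keys_iff)
      then show ?thesis by (simp add: taylor_boundary_def lookup_homogenize)
    qed
  qed
qed

text \<open>
  The chain over the field that describes the component of \<open>u\<close> of multidegree \<open>w\<close>; it inverts \<open>homogenize w\<close>.
\<close>

definition strand :: "'v multiset \<Rightarrow> ('v multiset list \<Rightarrow>\<^sub>0 ('v multiset \<Rightarrow>\<^sub>0 'k::field)) \<Rightarrow> ('v multiset list \<Rightarrow>\<^sub>0 'k)" where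
  "strand w u = Poly_Mapping.mapp (\<lambda>r p. if list_lcm r \<subseteq># w then lookup p (w - list_lcm r) else 0) u"

lemma lookup_strand: "lookup (strand w u) r = (if list_lcm r \<subseteq># w then lookup (lookup u r) (w - list_lcm r) else 0)"
  by (auto simp: strand_def lookup_mapp when_def in_keys_iff)

lemma strand_zero [simp]: "strand w 0 = 0"
  by (rule poly_mapping_eqI) (simp add: lookup_strand)

lemma strand_sum: "strand w (sum f A) = (\<Sum>a\<in>A. strand w (f a))"
proof -
  have "strand w (x + y) = strand w x + strand w y" for x y :: "'a multiset list \<Rightarrow>\<^sub>0 ('a multiset \<Rightarrow>\<^sub>0 'b)"
    by (rule poly_mapping_eqI) (simp add: lookup_strand lookup_add)
  then show ?thesis
    by (induction A rule: infinite_finite_induct) auto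
qed

lemma strand_homogenize:
  assumes "\<And>r. r \<in> keys z \<Longrightarrow> list_lcm r \<subseteq># v"
  shows "strand w (homogenize v z) = (if w = v then z else 0)"
proof (rule poly_mapping_eqI)
  fix r
  show "lookup (strand w (homogenize v z)) r = lookup (if w = v then z else 0) r"
  proof (cases "r \<in> keys z")
    case True
    then have v: "list_lcm r \<subseteq># v" by (rule assms)
    have "v - list_lcm r = w - list_lcm r \<longleftrightarrow> v = w" if "list_lcm r \<subseteq># w"
      using v that by (metis subset_mset.diff_add)
    then show ?thesis
      using v by (auto simp: lookup_strand lookup_homogenize lookup_single when_def)
  next
    case False
    then have "lookup z r = 0" by (simp add: in_keys_iff)
    then show ?thesis by (auto simp: lookup_strand lookup_homogenize)
  qed
qed

lemma strand_keys: "r \<in> keys (strand w u) \<Longrightarrow> r \<in> keys u \<and> list_lcm r \<subseteq># w"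
  by (auto simp: in_keys_iff lookup_strand split: if_splits)

lemma sum_strands: "\<exists>W. finite W \<and> (\<Sum>w\<in>W. homogenize w (strand w u)) = u \<and> (\<forall>w. w \<notin> W \<longrightarrow> strand w u = 0)"
proof -
  let ?W = "\<Union>r\<in>keys u. (\<lambda>m. m + list_lcm r) ` keys (lookup u r)"
  have fin: "finite ?W" by simp
  have inW: "w \<in> ?W" if "lookup (strand w u) r \<noteq> 0" for w r
  proof -
    have r: "list_lcm r \<subseteq># w" "lookup (lookup u r) (w - list_lcm r) \<noteq> 0"
      using that by (auto simp: lookup_strand split: if_splits)
    then have "r \<in> keys u" by (auto simp: in_keys_iff)
    moreover have "w = (w - list_lcm r) + list_lcm r" using r(1) by simp
    ultimately show ?thesis using r(2) by (metis (no_types, lifting) UN_iff image_iff in_keys_iff)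
  qed
  have "(\<Sum>w\<in>?W. homogenize w (strand w u)) = u"
  proof (intro poly_mapping_eqI)
    fix r m
    have coefficient: "lookup (lookup (homogenize w (strand w u)) r) m =
        (if m + list_lcm r = w then lookup (lookup u r) m else 0)" for w
    proof (cases "list_lcm r \<subseteq># w")
      case True
      then have "w - list_lcm r = m \<longleftrightarrow> m + list_lcm r = w" by auto
      then show ?thesis using True
        by (auto simp: lookup_homogenize lookup_strand lookup_single when_def)
    next
      case False
      then have "m + list_lcm r \<noteq> w" by auto
      then show ?thesis using False by (simp add: lookup_homogenize lookup_strand)
    qed
    have "lookup (lookup (\<Sum>w\<in>?W. homogenize w (strand w u)) r) m =
        (\<Sum>w\<in>?W. if m + list_lcm r = w then lookup (lookup u r) m else 0)"
      unfolding lookup_sum coefficient ..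
    also have "\<dots> = (if m + list_lcm r \<in> ?W then lookup (lookup u r) m else 0)"
      by (rule sum.delta'[OF fin])
    also have "\<dots> = lookup (lookup u r) m"
      using inW[of "m + list_lcm r" r] by (auto simp: lookup_strand)
    finally show "lookup (lookup (\<Sum>w\<in>?W. homogenize w (strand w u)) r) m = lookup (lookup u r) m" .
  qed
  moreover have "strand w u = 0" if "w \<notin> ?W" for w
    using inW that by (intro poly_mapping_eqI) auto
  ultimately show ?thesis using fin by blast
qed

lemma strand_taylor_boundary:
  fixes u :: "'v multiset list \<Rightarrow>\<^sub>0 ('v multiset \<Rightarrow>\<^sub>0 'k::field)"
  shows "strand w (lin taylor_boundary u) = lin simplex_boundary (strand w u)"
proof -
  obtain W where W: "finite W" "(\<Sum>w\<in>W. homogenize w (strand w u)) = u" "\<And>w. w \<notin> W \<Longrightarrow> strand w u = 0"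
    using sum_strands[of u] by blast
  have keys: "list_lcm r \<subseteq># v" if r: "r \<in> keys (lin simplex_boundary (strand v u) :: 'v multiset list \<Rightarrow>\<^sub>0 'k)" for r v
  proof -
    obtain s where s: "s \<in> keys (strand v u)" "r \<in> keys (simplex_boundary s :: 'v multiset list \<Rightarrow>\<^sub>0 'k)"
      using lin_keys[OF r] by blast
    then have "list_lcm r \<subseteq># list_lcm s" "list_lcm s \<subseteq># v"
      using simplex_boundary_keys[OF s(2)] list_lcm_mono strand_keys[OF s(1)] by auto
    then show ?thesis by (rule subset_mset.order_trans)
  qed
  have "strand w (lin taylor_boundary u) = strand w (lin taylor_boundary (\<Sum>v\<in>W. homogenize v (strand v u)))"
    by (simp add: W(2))
  also have "\<dots> = (\<Sum>v\<in>W. strand w (homogenize v (lin simplex_boundary (strand v u))))"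
    by (simp add: lin_sum strand_sum taylor_boundary_homogenize strand_keys)
  also have "\<dots> = (\<Sum>v\<in>W. if w = v then lin simplex_boundary (strand v u) else 0)"
    by (rule sum.cong[OF refl], rule strand_homogenize, rule keys)
  also have "\<dots> = (if w \<in> W then lin simplex_boundary (strand w u) else 0)"
    by (rule sum.delta'[OF W(1)])
  also have "\<dots> = lin simplex_boundary (strand w u)" using W(3) by simp
  finally show ?thesis .
qed

abbreviation "taylor_basis A n \<equiv> {s. length s = n \<and> set s \<subseteq> A}"

abbreviation "taylor_degree n s \<equiv> int (size (list_lcm s))"

text \<open>
  In multidegree \<open>w\<close> the complex is the chain complex of lists of generators dividing \<open>w\<close>. As soon as there is such
  a generator, prepending it is a contracting homotopy, so every strand is exact in positive
  homological degree.
\<close>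

theorem taylor_resolution:
  fixes A :: "'v::finite multiset set"
  shows "graded_resolution (taylor_basis A) taylor_degree (\<lambda>_. taylor_boundary :: _ \<Rightarrow> _ \<Rightarrow>\<^sub>0 ('v, 'k::field) mpoly) (mono_ideal A) []"
proof
  fix s n assume s: "s \<in> taylor_basis A (Suc n)"
  show "(taylor_boundary s :: _ \<Rightarrow>\<^sub>0 ('v, 'k) mpoly) \<in> hvec (taylor_basis A n) (taylor_degree n) (taylor_degree (Suc n) s)"
    unfolding hvec_def
  proof (intro CollectI conjI allI)
    have keys: "r \<in> keys (simplex_boundary s :: _ \<Rightarrow>\<^sub>0 'k)" if "lookup (taylor_boundary s :: _ \<Rightarrow>\<^sub>0 ('v, 'k) mpoly) r \<noteq> 0" for r
      using that by (auto simp: taylor_boundary_def lookup_homogenize in_keys_iff)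
    show "(taylor_boundary s :: _ \<Rightarrow>\<^sub>0 ('v, 'k) mpoly) \<in> free (taylor_basis A n)"
    proof (unfold free_def, intro CollectI subsetI)
      fix r assume "r \<in> keys (taylor_boundary s :: _ \<Rightarrow>\<^sub>0 ('v, 'k) mpoly)"
      then have "r \<in> keys (simplex_boundary s :: _ \<Rightarrow>\<^sub>0 'k)" by (intro keys) (simp add: in_keys_iff)
      from simplex_boundary_keys[OF this] show "length r = n \<and> set r \<subseteq> A" using s by auto
    qed
    fix r
    show "lookup (taylor_boundary s :: _ \<Rightarrow>\<^sub>0 ('v, 'k) mpoly) r \<in> homog (taylor_degree (Suc n) s - taylor_degree n r)"
    proof (cases "lookup (taylor_boundary s :: _ \<Rightarrow>\<^sub>0 ('v, 'k) mpoly) r = 0")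
      case False
      then have le: "list_lcm r \<subseteq># list_lcm s" using simplex_boundary_keys[OF keys[OF False]] list_lcm_mono by blast
      then show ?thesis
        using size_mset_mono[OF le] by (auto simp: taylor_boundary_def lookup_homogenize size_Diff_submset intro!: homog_single)
    qed simp
  qed
next
  fix s n assume "s \<in> taylor_basis A (Suc (Suc n))"
  have "lin taylor_boundary (taylor_boundary s) = homogenize (list_lcm s) (lin simplex_boundary (simplex_boundary s :: _ \<Rightarrow>\<^sub>0 'k))"
    unfolding taylor_boundary_def[of s]
    by (rule taylor_boundary_homogenize) (use simplex_boundary_keys list_lcm_mono in blast)
  then show "lin taylor_boundary (taylor_boundary s) = (0 :: _ \<Rightarrow>\<^sub>0 ('v, 'k) mpoly)"
    by (simp add: simplex_boundary_squared)
next
  show "taylor_basis A 0 = {[]}" by auto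
next
  have tb1: "taylor_boundary [a] = single [] (monom a :: ('v, 'k) mpoly)" for a
    by (simp add: taylor_boundary_def homogenize_single monom_def)
  show "lin taylor_boundary ` free (taylor_basis A 1) = single [] ` (mono_ideal A :: ('v, 'k) mpoly set)"
  proof
    have "lin taylor_boundary u = single [] (\<Sum>s\<in>keys u. lookup u s * lookup (taylor_boundary s) [])"
      "(\<Sum>s\<in>keys u. lookup u s * lookup (taylor_boundary s) []) \<in> mono_ideal A"
      if u: "u \<in> free (taylor_basis A 1)" for u :: "_ \<Rightarrow>\<^sub>0 ('v, 'k) mpoly"
    proof -
      have s: "\<exists>a\<in>A. s = [a]" if "s \<in> keys u" for s
        using that u by (auto simp: free_def length_Suc_conv)
      show "lin taylor_boundary u = single [] (\<Sum>s\<in>keys u. lookup u s * lookup (taylor_boundary s) [])"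
      proof (rule poly_mapping_eqI)
        fix r
        have "lookup (taylor_boundary s :: _ \<Rightarrow>\<^sub>0 ('v, 'k) mpoly) r = 0" if "r \<noteq> []" "s \<in> keys u" for s
          using s[OF that(2)] that(1) by (auto simp: tb1 lookup_single when_def)
        then show "lookup (lin taylor_boundary u) r = lookup (single [] (\<Sum>s\<in>keys u. lookup u s * lookup (taylor_boundary s) [])) r"
          by (cases "r = []") (simp_all add: lookup_lin lookup_single when_def)
      qed
      show "(\<Sum>s\<in>keys u. lookup u s * lookup (taylor_boundary s) []) \<in> mono_ideal A"
        by (intro rm.subspace_sum[OF mono_ideal_subspace] rm.subspace_scale[OF mono_ideal_subspace])
          (use s in \<open>fastforce simp: tb1 monom_in_mono_ideal\<close>)
    qed
    then show "lin taylor_boundary ` free (taylor_basis A 1) \<subseteq> single [] ` (mono_ideal A :: ('v, 'k) mpoly set)"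
      by auto
    show "single [] ` (mono_ideal A :: ('v, 'k) mpoly set) \<subseteq> lin taylor_boundary ` free (taylor_basis A 1)"
    proof clarify
      fix p :: "('v, 'k) mpoly" assume p: "p \<in> mono_ideal A"
      have "(\<Sum>m\<in>keys p. single [] (single m (lookup p m))) \<in> lin taylor_boundary ` free (taylor_basis A 1)"
      proof (rule vm.subspace_sum[OF module_hom.subspace_image[OF lin_hom free_subspace]])
        fix m assume "m \<in> keys p"
        then obtain a where a: "a \<in> A" "a \<subseteq># m" using p by (auto simp: mono_ideal_def)
        have eq: "single [] (single m (lookup p m)) = lin taylor_boundary (single [a] (single (m - a) (lookup p m)))"
          using a(2) by (simp add: tb1 vscale_single monom_def mult_single)
        show "single [] (single m (lookup p m)) \<in> lin taylor_boundary ` free (taylor_basis A 1)"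
          unfolding eq by (intro imageI single_free) (use a in auto)
      qed
      moreover have "(\<Sum>m\<in>B. single [] (single m (lookup p m))) = single ([] :: 'v multiset list) (\<Sum>m\<in>B. single m (lookup p m))" for B
        by (induction B rule: infinite_finite_induct) (auto simp: single_add)
      ultimately show "single [] p \<in> lin taylor_boundary ` free (taylor_basis A 1)"
        by (simp add: sum_single_eq)
    qed
  qed
next
  fix u :: "_ \<Rightarrow>\<^sub>0 ('v, 'k) mpoly" and n
  assume u: "u \<in> free (taylor_basis A (Suc n))" "lin taylor_boundary u = 0"
  obtain W where W: "finite W" "(\<Sum>w\<in>W. homogenize w (strand w u)) = u"
    using sum_strands[of u] by blast
  \<comment> \<open>On a nonzero strand in positive homological degree there is a generator dividing \<open>w\<close>, namely the head of any list that occurs.\<close>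
  define pick where "pick w = (SOME a. a \<in> A \<and> a \<subseteq># w)" for w
  have pick: "pick w \<in> A \<and> pick w \<subseteq># w" if s: "s \<in> keys (strand w u)" for s w
  proof -
    have "s \<in> taylor_basis A (Suc n)" "list_lcm s \<subseteq># w"
      using strand_keys[OF s] u(1) by (auto simp: free_def)
    then obtain a where "a \<in> A \<and> a \<subseteq># w" by (cases s) (auto simp: list_lcm_le_iff)
    then show ?thesis unfolding pick_def by (rule someI)
  qed
  define v where "v = (\<Sum>w\<in>W. homogenize w (prepend (pick w) (strand w u)))"
  have pk: "\<exists>s\<in>keys (strand w u). r = pick w # s" if "r \<in> keys (prepend (pick w) (strand w u))" for r w
    using lin_keys[OF that] by auto
  have "v \<in> free (taylor_basis A (Suc (Suc n)))"
    unfolding v_def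
  proof (rule vm.subspace_sum[OF free_subspace])
    fix w
    have "r \<in> taylor_basis A (Suc (Suc n))"
      if "r \<in> keys (homogenize w (prepend (pick w) (strand w u)))" for r
    proof -
      have "r \<in> keys (prepend (pick w) (strand w u))"
        using that by (auto simp: in_keys_iff lookup_homogenize)
      then obtain s where "s \<in> keys (strand w u)" "r = pick w # s" using pk by blast
      then show ?thesis using pick[of s w] strand_keys[of s w u] u(1) by (auto simp: free_def)
    qed
    then show "homogenize w (prepend (pick w) (strand w u)) \<in> free (taylor_basis A (Suc (Suc n)))"
      unfolding free_def by blast
  qed
  moreover have "lin taylor_boundary v = u"
  proof -
    have bd_pick: "lin simplex_boundary (prepend (pick w) (strand w u)) = strand w u" for w
    proof -
      have "lin simplex_boundary (strand w u) = strand w (lin taylor_boundary u)" by (rule strand_taylor_boundary[symmetric])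
      also have "\<dots> = 0" by (simp add: u(2))
      finally show ?thesis by (simp add: simplex_boundary_prepend)
    qed
    have "lin taylor_boundary v = (\<Sum>w\<in>W. homogenize w (lin simplex_boundary (prepend (pick w) (strand w u))))"
      unfolding v_def lin_sum
    proof (intro sum.cong refl taylor_boundary_homogenize)
      fix w r assume "r \<in> keys (prepend (pick w) (strand w u))"
      then obtain s where "s \<in> keys (strand w u)" "r = pick w # s" using pk by blast
      then show "list_lcm r \<subseteq># w" using pick[of s w] strand_keys[of s w u] by simp
    qed
    also have "\<dots> = (\<Sum>w\<in>W. homogenize w (strand w u))"
      by (simp add: bd_pick)
    finally show ?thesis by (simp add: W(2))
  qed
  ultimately show "\<exists>w\<in>free (taylor_basis A (Suc (Suc n))). lin taylor_boundary w = u" by blast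
qed simp_all

text \<open>
  Applying \<open>g\<close> to all generators in a list commutes with the simplicial boundary; the monomial coefficient
  moves multidegree \<open>w\<close> to \<open>e + w\<close>. On the empty list, \<open>\<theta>\<close> is multiplication by the monomial \<open>e\<close>.
\<close>

lemma taylor_map:
  fixes g :: "'v::finite multiset \<Rightarrow> 'v multiset"
  assumes le: "\<And>s. set s \<subseteq> A \<Longrightarrow> list_lcm (map g s) \<subseteq># e + list_lcm s"
    and s: "set s \<subseteq> A"
  defines "\<theta> \<equiv> \<lambda>s. single (map g s) (monom (e + list_lcm s - list_lcm (map g s)) :: ('v, 'k::field) mpoly)"
  shows "lin \<theta> (taylor_boundary s) = lin taylor_boundary (\<theta> s)"
proof -
  have "lin \<theta> (taylor_boundary s) = homogenize (e + list_lcm s) (lin (\<lambda>r. single (map g r) 1) (simplex_boundary s))"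
    unfolding taylor_boundary_def
  proof (rule lin_homogenize)
    fix r a assume r: "r \<in> keys (simplex_boundary s :: _ \<Rightarrow>\<^sub>0 'k)"
    have rs: "list_lcm r \<subseteq># list_lcm s" "set r \<subseteq> A" using simplex_boundary_keys[OF r] s list_lcm_mono by auto
    have "list_lcm s - list_lcm r + (e + list_lcm r - list_lcm (map g r)) = e + list_lcm s - list_lcm (map g r)"
      using mset_diff_chain[OF le[OF rs(2)], of "e + list_lcm s"] rs(1) by simp
    then show "vscale (single (list_lcm s - list_lcm r) a) (\<theta> r) = homogenize (e + list_lcm s) (vscale a (single (map g r) 1))"
      by (simp add: \<theta>_def vscale_single monom_def mult_single homogenize_single)
  qed
  also have "\<dots> = homogenize (e + list_lcm s) (lin simplex_boundary (single (map g s) 1))"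
    by (simp add: simplex_boundary_map)
  also have "\<dots> = lin taylor_boundary (homogenize (e + list_lcm s) (single (map g s) 1))"
    by (rule taylor_boundary_homogenize[symmetric]) (use le[OF s] in simp)
  also have "homogenize (e + list_lcm s) (single (map g s) 1) = \<theta> s"
    by (simp add: homogenize_single \<theta>_def monom_def)
  finally show ?thesis .
qed

text \<open>
  The ranks are at most those of the Taylor resolution. Finiteness matters because the cardinality of a
  disjoint union is the sum of the cardinalities only for finite sets.
\<close>

lemma minimal_resolution_finite_rank:
  fixes c :: "nat \<Rightarrow> 'b \<Rightarrow> ('b \<Rightarrow>\<^sub>0 ('v::finite multiset \<Rightarrow>\<^sub>0 'k::field))"
  assumes R: "minimal_resolution X D c (mono_ideal S) pt" and S: "finite S"
  shows "finite {b \<in> X n. D n b = j}"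
proof -
  have "finite {s \<in> taylor_basis S n. taylor_degree n s = j}"
    by (rule finite_subset[OF _ finite_lists_length_eq[OF S, of n]]) auto
  from minimal_resolution_rank_le[OF R taylor_resolution this] show ?thesis by simp
qed

section \<open>The mapping cone\<close>

abbreviation inl :: "('b \<Rightarrow>\<^sub>0 'a::comm_ring_1) \<Rightarrow> ('b + 'c \<Rightarrow>\<^sub>0 'a)" where
  "inl \<equiv> lin (\<lambda>b. single (Inl b) 1)"

abbreviation inr :: "('c \<Rightarrow>\<^sub>0 'a::comm_ring_1) \<Rightarrow> ('b + 'c \<Rightarrow>\<^sub>0 'a)" where
  "inr \<equiv> lin (\<lambda>b. single (Inr b) 1)"

abbreviation prl :: "('b + 'c \<Rightarrow>\<^sub>0 'a::comm_ring_1) \<Rightarrow> ('b \<Rightarrow>\<^sub>0 'a)" where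
  "prl \<equiv> lin (case_sum (\<lambda>b. single b 1) (\<lambda>_. 0))"

abbreviation prr :: "('b + 'c \<Rightarrow>\<^sub>0 'a::comm_ring_1) \<Rightarrow> ('c \<Rightarrow>\<^sub>0 'a)" where
  "prr \<equiv> lin (case_sum (\<lambda>_. 0) (\<lambda>b. single b 1))"

lemma pr_in [simp]: "prl (inl x) = x" "prr (inr y) = y" "prl (inr y) = 0" "prr (inl x) = 0"
  by (simp_all add: lin_lin)

lemma in_pr: "inl (prl u) + inr (prr u) = u"
proof -
  have "inl (prl u) + inr (prr u) = lin (\<lambda>b. case_sum (\<lambda>b. single (Inl b) 1) (\<lambda>_. 0) b + case_sum (\<lambda>_. 0) (\<lambda>b. single (Inr b) 1) b) u"
    unfolding lin_lin lin_fun_add by (intro arg_cong2[of _ _ _ _ "(+)"] lin_cong) (auto split: sum.split)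
  also have "\<dots> = lin (\<lambda>b. single b 1) u"
    by (rule lin_cong) (auto split: sum.split)
  finally show ?thesis by simp
qed

text \<open>
  The sequence \<open>0 \<longrightarrow> R/(K : m) \<longrightarrow> R/K \<longrightarrow> R/(K + (m)) \<longrightarrow> 0\<close>, whose first map is multiplication by \<open>m\<close>, is exact, so
  the cone over a lift \<open>f\<close> of this multiplication resolves \<open>R/(K + (m))\<close>. The boundary sends \<open>(x, y)\<close> to
  \<open>(\<partial>x + f y, -\<partial>y)\<close>, where \<open>y\<close> sits one homological degree lower than \<open>x\<close>. Its entries are those of the two
  minimal resolutions and of \<open>f\<close>, hence they lie in \<open>\<mm>\<close>.
\<close>

theorem mapping_cone:
  fixes X :: "nat \<Rightarrow> 'b set" and Y :: "nat \<Rightarrow> 'c set"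
    and c :: "nat \<Rightarrow> 'b \<Rightarrow> ('b \<Rightarrow>\<^sub>0 ('v::finite multiset \<Rightarrow>\<^sub>0 'k::field))"
  assumes P: "minimal_resolution X D c K pt" and Q: "minimal_resolution Y D' c' {p. p * m \<in> K} pt'"
    and f0: "f 0 pt' = single pt m"
    and f: "\<And>n b. b \<in> Y n \<Longrightarrow> f n b \<in> hvec (X n) (D n) (D' n b + e)"
    and chain: "\<And>n b. b \<in> Y (Suc n) \<Longrightarrow> lin (c n) (f (Suc n) b) = lin (f n) (c' n b)"
    and fm: "\<And>n b. b \<in> Y n \<Longrightarrow> f n b \<in> mfree"
  shows "minimal_resolution
    (\<lambda>n. Inl ` X n \<union> (case n of 0 \<Rightarrow> {} | Suc k \<Rightarrow> Inr ` Y k))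
    (\<lambda>n. case_sum (D n) (\<lambda>b. D' (n - 1) b + e))
    (\<lambda>n. case_sum (\<lambda>b. inl (c n b))
        (\<lambda>b. inl (f n b) - (case n of 0 \<Rightarrow> 0 | Suc k \<Rightarrow> inr (c' k b))))
    {p + q * m |p q. p \<in> K} (Inl pt)" (is "minimal_resolution ?Z ?DZ ?c ?I _")
proof -
  interpret P: minimal_resolution X D c K pt by fact
  interpret Q: minimal_resolution Y D' c' "{p. p * m \<in> K}" pt' by fact
  \<comment> \<open>The second component of the boundary, up to sign; there is none in homological degree zero.\<close>
  define r where "r n y = ((case n of 0 \<Rightarrow> 0 | Suc k \<Rightarrow> inr (lin (c' k) y)) :: 'b + 'c \<Rightarrow>\<^sub>0 ('v multiset \<Rightarrow>\<^sub>0 'k))"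
    for n and y :: "'c \<Rightarrow>\<^sub>0 ('v multiset \<Rightarrow>\<^sub>0 'k)"
  have bd: "lin (?c n) (inl x + inr y) = inl (lin (c n) x + lin (f n) y) - r n y" for n x y
    by (cases n) (simp_all add: r_def lin_add lin_lin lin_fun_diff)
  have r_add: "r n (y + y') = r n y + r n y'" for n y y' by (cases n) (simp_all add: r_def lin_add)
  have f_free: "b \<in> Y n \<Longrightarrow> f n b \<in> free (X n)" for n b using f hvec_free by blast
  have one: "(1 :: ('v, 'k) mpoly) \<in> homog 0" by (simp add: homog_iff lookup_one)
  have inl_Z: "inl x \<in> hvec (?Z n) (?DZ n) j" if "x \<in> hvec (X n) (D n) j" for x :: "'b \<Rightarrow>\<^sub>0 ('v multiset \<Rightarrow>\<^sub>0 'k)" and n j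
  proof -
    have "(single (Inl b) 1 :: 'b + 'c \<Rightarrow>\<^sub>0 ('v multiset \<Rightarrow>\<^sub>0 'k)) \<in> hvec (?Z n) (?DZ n) (D n b + 0)" if "b \<in> X n" for b
      using hvec_single[OF _ one, of "Inl b" "?Z n" "?DZ n"] that by simp
    from lin_hvec[OF that this] show ?thesis by simp
  qed
  have inr_Z: "inr y \<in> hvec (?Z (Suc n)) (?DZ (Suc n)) (j + e)" if "y \<in> hvec (Y n) (D' n) j" for y :: "'c \<Rightarrow>\<^sub>0 ('v multiset \<Rightarrow>\<^sub>0 'k)" and n j
  proof -
    have "(single (Inr b) 1 :: 'b + 'c \<Rightarrow>\<^sub>0 ('v multiset \<Rightarrow>\<^sub>0 'k)) \<in> hvec (?Z (Suc n)) (?DZ (Suc n)) (D' n b + e)" if "b \<in> Y n" for b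
      using hvec_single[OF _ one, of "Inr b" "?Z (Suc n)" "?DZ (Suc n)"] that by simp
    from lin_hvec[OF that this] show ?thesis .
  qed
  have inl_free: "inl x \<in> free (?Z n)" if "x \<in> free (X n)" for x :: "'b \<Rightarrow>\<^sub>0 ('v multiset \<Rightarrow>\<^sub>0 'k)" and n
    by (rule lin_free[OF that]) (auto intro!: single_free)
  have inr_free: "inr y \<in> free (?Z (Suc n))" if "y \<in> free (Y n)" for y :: "'c \<Rightarrow>\<^sub>0 ('v multiset \<Rightarrow>\<^sub>0 'k)" and n
    by (rule lin_free[OF that]) (auto intro!: single_free)
  have split: "prl u \<in> free (X (Suc n))" "prr u \<in> free (Y n)" if "u \<in> free (?Z (Suc n))"
    for u :: "'b + 'c \<Rightarrow>\<^sub>0 ('v multiset \<Rightarrow>\<^sub>0 'k)" and n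
    by (rule lin_free[OF that]; auto intro!: single_free free_rules split: sum.split)+
  have chain_lin: "lin (c n) (lin (f (Suc n)) y) = lin (f n) (lin (c' n) y)" if "y \<in> free (Y (Suc n))" for n y
    unfolding lin_lin by (rule lin_free_cong[OF that]) (rule chain)
  have f0_lin: "lin (f 0) y = single pt (lookup y pt' * m)" if "y \<in> free (Y 0)" for y
  proof -
    have "y = single pt' (lookup y pt')"
      using that sum_single_eq[of "{pt'}" y] by (simp add: free_def Q.base)
    then have "lin (f 0) y = lin (f 0) (single pt' (lookup y pt'))" by simp
    then show ?thesis by (simp add: f0 vscale_single)
  qed
  show ?thesis
  proof
    fix b n assume b: "b \<in> ?Z (Suc n)"
    show "?c n b \<in> hvec (?Z n) (?DZ n) (?DZ (Suc n) b)"
    proof (cases b)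
      case (Inl a)
      then show ?thesis using b inl_Z[OF P.column] by auto
    next
      case (Inr a)
      then have a: "a \<in> Y n" using b by auto
      have 1: "inl (f n a) \<in> hvec (?Z n) (?DZ n) (D' n a + e)" by (rule inl_Z[OF f[OF a]])
      show ?thesis
      proof (cases n)
        case 0
        then show ?thesis using 1 Inr by simp
      next
        case (Suc k)
        have "inr (c' k a) \<in> hvec (?Z n) (?DZ n) (D' n a + e)"
          using inr_Z[OF Q.column[of a k]] a Suc by simp
        from hvec_add[OF 1 hvec_minus[OF this]] show ?thesis using Inr Suc by simp
      qed
    qed
    show "?c n b \<in> mfree"
    proof (cases b)
      case (Inl a)
      then show ?thesis using b by (auto intro!: lin_mfree P.minimal_column)
    next
      case (Inr a)
      then have "a \<in> Y n" using b by auto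
      then show ?thesis using Inr
        by (auto intro!: lin_mfree fm Q.minimal_column vm.subspace_diff[OF mfree_subspace]
            vm.subspace_0[OF mfree_subspace] split: nat.split)
    qed
  next
    fix b n assume b: "b \<in> ?Z (Suc (Suc n))"
    show "lin (?c n) (?c (Suc n) b) = 0"
    proof (cases b)
      case (Inl a)
      then have "a \<in> X (Suc (Suc n))" using b by auto
      moreover have "lin (?c n) (?c (Suc n) b) = inl (lin (c n) (c (Suc n) a))"
        using Inl by (simp add: lin_lin)
      ultimately show ?thesis by (simp add: P.column_column)
    next
      case (Inr a)
      then have a: "a \<in> Y (Suc n)" using b by auto
      have "?c (Suc n) b = inl (f (Suc n) a) + inr (- c' n a)"
        using Inr by (simp add: lin_minus)
      then have "lin (?c n) (?c (Suc n) b) =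
          inl (lin (c n) (f (Suc n) a) + lin (f n) (- c' n a)) - r n (- c' n a)"
        by (simp only: bd)
      also have "\<dots> = - r n (- c' n a)"
        by (simp add: chain[OF a] lin_minus)
      also have "\<dots> = 0"
        using a by (cases n) (simp_all add: r_def lin_minus Q.column_column)
      finally show ?thesis .
    qed
  next
    show "?Z 0 = {Inl pt}" by (simp add: P.base)
    show "?DZ 0 (Inl pt) = 0" by (simp add: P.base_degree)
  next
    show "lin (?c 0) ` free (?Z 1) = single (Inl pt) ` ?I"
    proof (intro equalityI subsetI)
      fix v assume "v \<in> lin (?c 0) ` free (?Z 1)"
      then obtain u where u: "u \<in> free (?Z (Suc 0))" "v = lin (?c 0) u" by auto
      have "v = inl (lin (c 0) (prl u) + lin (f 0) (prr u))"
        using bd[of 0 "prl u" "prr u"] by (simp add: in_pr u(2) r_def)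
      moreover have "lin (c 0) (prl u) \<in> single pt ` K"
        using split(1)[OF u(1)] P.image by auto
      ultimately show "v \<in> single (Inl pt) ` ?I"
        by (auto simp: f0_lin[OF split(2)[OF u(1)]] single_add[symmetric] vscale_single intro!: imageI) blast
    next
      fix v assume "v \<in> single (Inl pt :: 'b + 'c) ` ?I"
      then obtain p q where v: "v = single (Inl pt) (p + q * m)" "p \<in> K" by auto
      then have "single pt p \<in> lin (c 0) ` free (X 1)" unfolding P.image by simp
      then obtain x where x: "x \<in> free (X (Suc 0))" "lin (c 0) x = single pt p" by auto
      have y: "single pt' q \<in> free (Y 0)" by (rule single_free) (simp add: Q.base)
      have 1: "inl x + inr (single pt' q) \<in> free (?Z 1)"
        unfolding One_nat_def by (intro free_rules inl_free inr_free x y)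
      have 2: "lin (?c 0) (inl x + inr (single pt' q)) = v"
        unfolding bd by (simp add: v x(2) r_def f0 vscale_single single_add lin_add)
      show "v \<in> lin (?c 0) ` free (?Z 1)"
        unfolding 2[symmetric] by (rule imageI[OF 1])
    qed
  next
    fix u n assume u: "u \<in> free (?Z (Suc n))" "lin (?c n) u = 0"
    let ?x = "prl u" and ?y = "prr u"
    note xy = split[OF u(1)]
    have zero: "inl (lin (c n) ?x + lin (f n) ?y) - r n ?y = 0"
      using bd[of n ?x ?y] u(2) by (simp add: in_pr)
    have zl: "lin (c n) ?x + lin (f n) ?y = 0"
    proof -
      have "prl (r n ?y) = 0" by (cases n) (simp_all add: r_def)
      then show ?thesis using arg_cong[OF zero, of prl] by (simp add: lin_diff)
    qed
    \<comment> \<open>In degree zero it is the definition of the colon ideal that makes \<open>y\<close> a boundary.\<close>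
    have "\<exists>y'\<in>free (Y (Suc n)). lin (c' n) y' = ?y"
    proof (cases n)
      case 0
      have y0: "?y \<in> free (Y 0)" using xy(2) 0 by simp
      have "lin (c 0) ?x \<in> single pt ` K" using xy(1) P.image 0 by auto
      then obtain p where p: "p \<in> K" "lin (c 0) ?x = single pt p" by auto
      have "single pt p + single pt (lookup ?y pt' * m) = 0"
        using zl 0 p(2) f0_lin[OF y0] by simp
      then have "p + lookup ?y pt' * m = 0" by (metis single_add lookup_single_eq lookup_zero)
      then have "lookup ?y pt' * m = - p" by (simp add: eq_neg_iff_add_eq_0 add.commute)
      moreover have "- p \<in> K"
      proof -
        have "vm.subspace (single pt ` K)"
          unfolding P.image[symmetric] by (rule module_hom.subspace_image[OF lin_hom free_subspace])
        from vm.subspace_neg[OF this, of "single pt p"] p(1) show ?thesis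
          by (auto simp: single_uminus[symmetric]) (metis lookup_single_eq)
      qed
      ultimately have "single pt' (lookup ?y pt') \<in> lin (c' 0) ` free (Y 1)"
        unfolding Q.image by simp
      moreover have "single pt' (lookup ?y pt') = ?y"
        using y0 sum_single_eq[of "{pt'}" ?y] by (simp add: free_def Q.base)
      ultimately show ?thesis using 0 by auto
    next
      case (Suc k)
      have "prr (r n ?y) = lin (c' k) ?y" by (simp add: r_def Suc)
      then have "lin (c' k) ?y = 0" using arg_cong[OF zero, of prr] by (simp add: lin_diff)
      then show ?thesis using Q.exact[of ?y k] xy(2) Suc by blast
    qed
    then obtain y' where y': "y' \<in> free (Y (Suc n))" "lin (c' n) y' = ?y" by blast
    have "\<exists>x'\<in>free (X (Suc (Suc n))). lin (c (Suc n)) x' = ?x + lin (f (Suc n)) y'"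
    proof (rule P.exact)
      show "?x + lin (f (Suc n)) y' \<in> free (X (Suc n))"
        by (intro free_rules xy lin_free[OF y'(1)] f_free)
      show "lin (c n) (?x + lin (f (Suc n)) y') = 0"
        using zl by (simp add: lin_add chain_lin[OF y'(1)] y'(2))
    qed
    then obtain x' where x': "x' \<in> free (X (Suc (Suc n)))" "lin (c (Suc n)) x' = ?x + lin (f (Suc n)) y'"
      by blast
    have "inl x' + inr (- y') \<in> free (?Z (Suc (Suc n)))"
      by (intro free_rules inl_free inr_free x' y')
    moreover have "lin (?c (Suc n)) (inl x' + inr (- y')) = u"
      unfolding bd by (simp add: x'(2) r_def lin_minus y'(2) in_pr)
    ultimately show "\<exists>w\<in>free (?Z (Suc (Suc n))). lin (?c (Suc n)) w = u" by blast
  qed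
qed

section \<open>Adding one monomial to a monomial ideal\<close>

lemma mono_ideal_insert:
  "mono_ideal (insert m S) = {p + q * monom m |p q. p \<in> (mono_ideal S :: ('v::finite, 'k::field) mpoly set)}"
proof -
  have "mono_ideal (insert m S) = {x :: ('v, 'k) mpoly. \<exists>q. x - q * monom m \<in> mono_ideal S}"
    using rm.span_insert[of "monom m" "monom ` S :: ('v, 'k) mpoly set"]
    by (simp add: ideal_gen_monom[symmetric] ideal_gen_def)
  then show ?thesis by (auto simp: set_eq_iff) (metis diff_add_cancel, metis add_diff_cancel_right')
qed

lemma keys_mult_monom: "keys (p * monom m) = (\<lambda>u. u + m) ` keys (p :: ('v::finite, 'k::field) mpoly)"
proof -
  have "p * monom m = (\<Sum>u\<in>keys p. single u (lookup p u)) * monom m"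
    by (simp add: sum_single_eq)
  also have "\<dots> = (\<Sum>u\<in>keys p. single (u + m) (lookup p u))"
    by (simp add: sum_distrib_right monom_def mult_single)
  finally have eq: "p * monom m = (\<Sum>u\<in>keys p. single (u + m) (lookup p u))" .
  have "lookup (p * monom m) (u + m) = lookup p u" for u
  proof -
    have "lookup (p * monom m) (u + m) = (\<Sum>v\<in>keys p. if v = u then lookup p v else 0)"
      unfolding eq lookup_sum by (intro sum.cong refl) (auto simp: lookup_single when_def)
    then show ?thesis by (simp add: in_keys_iff)
  qed
  moreover have "keys (p * monom m) \<subseteq> range (\<lambda>u. u + m)"
    using keys_mult[of p "monom m"] by (auto simp: monom_def)
  ultimately show ?thesis
    by (auto simp: in_keys_iff image_iff)
qed

lemma mono_ideal_colon:
  assumes "\<And>u. (\<exists>t\<in>T. t \<subseteq># u) \<longleftrightarrow> (\<exists>s\<in>S. s \<subseteq># u + m)"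
  shows "mono_ideal T = {p :: ('v::finite, 'k::field) mpoly. p * monom m \<in> mono_ideal S}"
  unfolding mono_ideal_def by (auto simp: keys_mult_monom assms)

lemma quotient_betti_insert:
  fixes X :: "nat \<Rightarrow> 'b set" and Y :: "nat \<Rightarrow> 'c set"
  assumes S: "finite S" "{#} \<notin> S" and T: "finite T" "{#} \<notin> T" and m: "m \<noteq> {#}"
    and colon: "\<And>u. (\<exists>t\<in>T. t \<subseteq># u) \<longleftrightarrow> (\<exists>s\<in>S. s \<subseteq># u + m)"
    and P: "minimal_resolution X D c (mono_ideal S :: ('v::finite, 'k::field) mpoly set) pt"
    and Q: "minimal_resolution Y D' c' (mono_ideal T :: ('v, 'k) mpoly set) pt'"
    and f: "f 0 pt' = single pt (monom m)"
      "\<And>n b. b \<in> Y n \<Longrightarrow> f n b \<in> hvec (X n) (D n) (D' n b + int (size m))"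
      "\<And>n b. b \<in> Y (Suc n) \<Longrightarrow> lin (c n) (f (Suc n) b) = lin (f n) (c' n b)"
      "\<And>n b. b \<in> Y n \<Longrightarrow> f n b \<in> mfree"
  shows "quotient_betti (mono_ideal (insert m S) :: ('v, 'k) mpoly set) n j =
    quotient_betti (mono_ideal S :: ('v, 'k) mpoly set) n j +
    (case n of 0 \<Rightarrow> 0 | Suc k \<Rightarrow> quotient_betti (mono_ideal T :: ('v, 'k) mpoly set) k (j - int (size m)))"
proof -
  have eq: "mono_ideal T = {p :: ('v, 'k) mpoly. p * monom m \<in> mono_ideal S}"
    by (rule mono_ideal_colon) (rule colon)
  note R = mapping_cone[OF P Q[unfolded eq] f, folded mono_ideal_insert]
  have "quotient_betti (mono_ideal (insert m S) :: ('v, 'k) mpoly set) n j =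
      card {b \<in> Inl ` X n \<union> (case n of 0 \<Rightarrow> {} | Suc k \<Rightarrow> Inr ` Y k).
        case_sum (D n) (\<lambda>b. D' (n - 1) b + int (size m)) b = j}"
    using quotient_betti_eq[OF _ R, of n j] S(2) m by auto
  also have "{b \<in> Inl ` X n \<union> (case n of 0 \<Rightarrow> {} | Suc k \<Rightarrow> Inr ` Y k).
        case_sum (D n) (\<lambda>b. D' (n - 1) b + int (size m)) b = j} =
      Inl ` {b \<in> X n. D n b = j} \<union>
      (case n of 0 \<Rightarrow> {} | Suc k \<Rightarrow> Inr ` {b \<in> Y k. D' k b = j - int (size m)})"
    by (cases n) auto
  also have "card \<dots> = card {b \<in> X n. D n b = j} +
      (case n of 0 \<Rightarrow> 0 | Suc k \<Rightarrow> card {b \<in> Y k. D' k b = j - int (size m)})"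
  proof (cases n)
    case (Suc k)
    have "card (Inl ` {b \<in> X n. D n b = j} \<union> Inr ` {b \<in> Y k. D' k b = j - int (size m)}) =
        card (Inl ` {b \<in> X n. D n b = j} :: ('b + 'c) set) + card (Inr ` {b \<in> Y k. D' k b = j - int (size m)} :: ('b + 'c) set)"
      using minimal_resolution_finite_rank[OF P S(1)] minimal_resolution_finite_rank[OF Q T(1)]
      by (intro card_Un_disjoint) auto
    then show ?thesis using Suc by (simp add: card_image)
  qed (simp add: card_image)
  finally show ?thesis
    using quotient_betti_eq[OF S(2) P, of n j] quotient_betti_eq[OF T(2) Q, of "n - 1" "j - int (size m)"]
    by (cases n) simp_all
qed

text \<open>
  The generators \<open>a\<close> of the colon ideal \<open>(mono_ideal S : m)\<close> are mapped to generators \<open>g a\<close> of \<open>mono_ideal S\<close>. On Taylor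
  resolutions \<open>g\<close> induces a lift \<open>\<theta>\<close> of multiplication by \<open>m\<close>, and \<open>strict\<close> says that all its coefficients lie in
  \<open>\<mm>\<close>. Composing \<open>\<theta>\<close> with comparison maps from the minimal resolution of the colon ideal and to the minimal
  resolution of \<open>mono_ideal S\<close> keeps the entries in \<open>\<mm>\<close>, whatever the comparison maps are.
\<close>

theorem quotient_betti_splitting:
  fixes S T A G :: "'v::finite multiset set"
  assumes S: "finite S" "{#} \<notin> S" and T: "finite T" "{#} \<notin> T"
    and colon: "\<And>u. (\<exists>t\<in>T. t \<subseteq># u) \<longleftrightarrow> (\<exists>s\<in>S. s \<subseteq># u + m)"
    and G: "mono_ideal G = (mono_ideal S :: ('v, 'k::field) mpoly set)"
    and A: "mono_ideal A = (mono_ideal T :: ('v, 'k) mpoly set)"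
    and g: "\<And>a. a \<in> A \<Longrightarrow> g a \<in> G"
    and strict: "\<And>s. set s \<subseteq> A \<Longrightarrow> list_lcm (map g s) \<subset># m + list_lcm s"
  shows "quotient_betti (mono_ideal (insert m S) :: ('v, 'k) mpoly set) n j =
    quotient_betti (mono_ideal S :: ('v, 'k) mpoly set) n j +
    (case n of 0 \<Rightarrow> 0 | Suc k \<Rightarrow> quotient_betti (mono_ideal T :: ('v, 'k) mpoly set) k (j - int (size m)))"
proof -
  have m: "m \<noteq> {#}" using strict[of "[]"] by auto
  obtain X :: "nat \<Rightarrow> nat set" and D c where P: "minimal_resolution X D c (mono_ideal S :: ('v, 'k) mpoly set) 0"
    using mono_ideal_resolution[OF S(2)] by blast
  obtain Y :: "nat \<Rightarrow> nat set" and D' c' where Q: "minimal_resolution Y D' c' (mono_ideal T :: ('v, 'k) mpoly set) 0"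
    using mono_ideal_resolution[OF T(2)] by blast
  note PG = minimal_resolution.axioms(1)[OF P] and QG = minimal_resolution.axioms(1)[OF Q]
  have TA: "graded_resolution (taylor_basis A) taylor_degree (\<lambda>_. taylor_boundary) (mono_ideal T :: ('v, 'k) mpoly set) []"
    using taylor_resolution[where 'k='k, of A] by (simp add: A)
  have TG: "graded_resolution (taylor_basis G) taylor_degree (\<lambda>_. taylor_boundary) (mono_ideal S :: ('v, 'k) mpoly set) []"
    using taylor_resolution[where 'k='k, of G] by (simp add: G)
  interpret Q: graded_resolution Y D' c' "mono_ideal T :: ('v, 'k) mpoly set" 0 by (rule QG)
  interpret TA: graded_resolution "taylor_basis A" taylor_degree "\<lambda>_. taylor_boundary" "mono_ideal T :: ('v, 'k) mpoly set" "[]"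
    by (rule TA)
  have one: "(1 :: ('v, 'k) mpoly) \<in> homog 0" by (simp add: homog_iff lookup_one)
  obtain \<alpha> where \<alpha>: "\<alpha> 0 0 = single [] (1 :: ('v, 'k) mpoly)"
    "\<And>n b. b \<in> Y n \<Longrightarrow> \<alpha> n b \<in> hvec (taylor_basis A n) (taylor_degree n) (D' n b + 0)"
    "\<And>n b. b \<in> Y (Suc n) \<Longrightarrow> lin taylor_boundary (\<alpha> (Suc n) b) = lin (\<alpha> n) (c' n b)"
    using comparison_map[OF QG TA one] by auto
  obtain \<beta> where \<beta>: "\<beta> 0 [] = single 0 (1 :: ('v, 'k) mpoly)"
    "\<And>n b. b \<in> taylor_basis G n \<Longrightarrow> \<beta> n b \<in> hvec (X n) (D n) (taylor_degree n b + 0)"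
    "\<And>n b. b \<in> taylor_basis G (Suc n) \<Longrightarrow> lin (c n) (\<beta> (Suc n) b) = lin (\<beta> n) (taylor_boundary b)"
    using comparison_map[OF TG PG one] by auto
  define \<theta> where "\<theta> s = single (map g s) (monom (m + list_lcm s - list_lcm (map g s)) :: ('v, 'k) mpoly)" for s
  have le: "list_lcm (map g s) \<subseteq># m + list_lcm s" if "set s \<subseteq> A" for s
    using strict[OF that] by (rule subset_mset.less_imp_le)
  have mapG: "map g s \<in> taylor_basis G n" if "s \<in> taylor_basis A n" for s n
    using that g by auto
  have \<theta>_hvec: "\<theta> s \<in> hvec (taylor_basis G n) (taylor_degree n) (taylor_degree n s + int (size m))"
    if s: "s \<in> taylor_basis A n" for s n
  proof -
    have "list_lcm (map g s) \<subseteq># m + list_lcm s" using le s by simp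
    then have "monom (m + list_lcm s - list_lcm (map g s)) \<in>
        (homog (taylor_degree n s + int (size m) - taylor_degree n (map g s)) :: ('v, 'k) mpoly set)"
      using size_mset_mono[of "list_lcm (map g s)" "m + list_lcm s"]
      unfolding monom_def by (intro homog_single) (simp add: size_Diff_submset)
    from hvec_single[OF mapG[OF s] this, of "taylor_degree n"] show ?thesis by (simp add: \<theta>_def)
  qed
  have \<theta>_m: "\<theta> s \<in> mfree" if "set s \<subseteq> A" for s
  proof -
    have "m + list_lcm s - list_lcm (map g s) \<noteq> {#}"
      using strict[OF that] by (metis Diff_eq_empty_iff_mset subset_mset.less_le_not_le)
    then show ?thesis by (auto simp: mfree_def \<theta>_def lookup_single when_def monom_def const_single)
  qed
  have \<theta>_chain: "lin \<theta> (taylor_boundary s) = lin taylor_boundary (\<theta> s)" if "set s \<subseteq> A" for s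
    unfolding \<theta>_def[abs_def] by (rule taylor_map) (use le that in auto)
  define f where "f n b = lin (\<beta> n) (lin \<theta> (\<alpha> n b))" for n b
  show ?thesis
  proof (rule quotient_betti_insert[OF S T m colon P Q, of f])
    show "f 0 0 = single 0 (monom m)"
      by (simp add: f_def \<alpha>(1) \<theta>_def vscale_single \<beta>(1) del: single_one)
  next
    fix n b assume b: "b \<in> Y n"
    have 1: "lin \<theta> (\<alpha> n b) \<in> hvec (taylor_basis G n) (taylor_degree n) (D' n b + 0 + int (size m))"
      by (rule lin_hvec[OF \<alpha>(2)[OF b]]) (rule \<theta>_hvec)
    from lin_hvec[OF 1 \<beta>(2)]
    show "f n b \<in> hvec (X n) (D n) (D' n b + int (size m))" by (simp add: f_def)
    show "f n b \<in> mfree"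
      unfolding f_def
      by (intro lin_mfree lin_columns_mfree[OF hvec_free[OF \<alpha>(2)[OF b]]] \<theta>_m) simp
  next
    fix n b assume b: "b \<in> Y (Suc n)"
    let ?u = "lin \<theta> (\<alpha> (Suc n) b)"
    have a: "\<alpha> (Suc n) b \<in> free (taylor_basis A (Suc n))" by (rule hvec_free[OF \<alpha>(2)[OF b]])
    have u: "?u \<in> free (taylor_basis G (Suc n))"
      by (rule lin_free[OF a]) (use \<theta>_hvec hvec_free in blast)
    have "lin (c n) (lin (\<beta> (Suc n)) ?u) = lin (\<beta> n) (lin taylor_boundary ?u)"
      unfolding lin_lin[of _ "\<beta> (Suc n)"] lin_lin[of _ taylor_boundary] by (rule lin_free_cong[OF u]) (rule \<beta>(3))
    also have "lin taylor_boundary ?u = lin \<theta> (lin taylor_boundary (\<alpha> (Suc n) b))"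
      unfolding lin_lin by (rule lin_free_cong[OF a, symmetric]) (simp add: \<theta>_chain)
    also have "\<dots> = lin \<theta> (lin (\<alpha> n) (c' n b))" by (simp add: \<alpha>(3)[OF b])
    also have "lin (\<beta> n) \<dots> = lin (f n) (c' n b)"
      unfolding lin_lin f_def ..
    finally show "lin (c n) (f (Suc n) b) = lin (f n) (c' n b)" by (simp add: f_def)
  qed
qed

text \<open>
  The variable \<open>x\<close> is a nonzerodivisor modulo \<open>mono_ideal S\<close>, so the colon ideal is the ideal itself, and multiplication by
  \<open>x\<close> on its minimal resolution is the required chain map.
\<close>

lemma quotient_betti_insert_variable:
  fixes S :: "'v::finite multiset set"
  assumes S: "finite S" "{#} \<notin> S" and x: "\<And>s. s \<in> S \<Longrightarrow> x \<notin># s"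
  shows "quotient_betti (mono_ideal (insert {#x#} S) :: ('v, 'k::field) mpoly set) n j =
    quotient_betti (mono_ideal S :: ('v, 'k) mpoly set) n j +
    (case n of 0 \<Rightarrow> 0 | Suc k \<Rightarrow> quotient_betti (mono_ideal S :: ('v, 'k) mpoly set) k (j - 1))"
proof -
  obtain X :: "nat \<Rightarrow> nat set" and D c where P: "minimal_resolution X D c (mono_ideal S :: ('v, 'k) mpoly set) 0"
    using mono_ideal_resolution[OF S(2)] by blast
  let ?x = "monom {#x#} :: ('v, 'k) mpoly"
  let ?f = "\<lambda>(n::nat) (b::nat). single b ?x"
  have x_homog: "?x \<in> homog 1" by (simp add: monom_def homog_single)
  have colon: "(\<exists>s\<in>S. s \<subseteq># u) \<longleftrightarrow> (\<exists>s\<in>S. s \<subseteq># u + {#x#})" for u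
  proof
    assume "\<exists>s\<in>S. s \<subseteq># u + {#x#}"
    then obtain s where s: "s \<in> S" "s \<subseteq># u + {#x#}" by blast
    have "count s y \<le> count u y" for y
      using mset_subset_eq_count[OF s(2), of y] x[OF s(1)] by (cases "y = x") (auto simp: not_in_iff)
    then show "\<exists>s\<in>S. s \<subseteq># u" using s(1) by (auto simp: subseteq_mset_def)
  qed (meson mset_subset_eq_add_left subset_mset.order_trans)
  have lin_x: "lin (\<lambda>b. single b ?x) u = vscale ?x u" for u :: "('v, 'k) vec"
    using lin_fun_vscale[of ?x "\<lambda>b. single b 1" u] by (simp add: vscale_single)
  have "quotient_betti (mono_ideal (insert {#x#} S) :: ('v, 'k::field) mpoly set) n j =
    quotient_betti (mono_ideal S :: ('v, 'k) mpoly set) n j +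
    (case n of 0 \<Rightarrow> 0 | Suc k \<Rightarrow> quotient_betti (mono_ideal S :: ('v, 'k) mpoly set) k (j - int (size {#x#})))"
  proof (rule quotient_betti_insert[OF S S _ colon P P, of ?f])
    fix n b assume b: "b \<in> X n"
    show "single b ?x \<in> hvec (X n) (D n) (D n b + int (size {#x#}))"
      using hvec_single[OF b x_homog, of "D n"] by (simp add: add.commute)
    show "single b ?x \<in> mfree"
      by (auto simp: mfree_def lookup_single when_def monom_def const_single)
  next
    fix n b
    show "lin (c n) (single b ?x) = lin (\<lambda>b. single b ?x) (c n b)" by (simp add: lin_x)
  qed simp_all
  then show ?thesis by (cases n) simp_all
qed

text \<open>
  Adjoining the variables one at a time, the coefficients satisfy Pascal's recursion.
\<close>

lemma quotient_betti_variables: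
  fixes S :: "'v::finite multiset set"
  assumes S: "finite S" "{#} \<notin> S" and N: "\<And>s x. s \<in> S \<Longrightarrow> x \<in> N \<Longrightarrow> x \<notin># s"
  shows "quotient_betti (mono_ideal (S \<union> (\<lambda>x. {#x#}) ` N) :: ('v, 'k::field) mpoly set) n j =
    (\<Sum>l = 0..n. (card N choose l) * quotient_betti (mono_ideal S :: ('v, 'k) mpoly set) (n - l) (j - int l))"
proof -
  have "finite N" by simp
  then show ?thesis using N
  proof (induction N arbitrary: n j)
    case empty
    have "(\<Sum>l = 0..n. (0 choose l) * quotient_betti (mono_ideal S :: ('v, 'k) mpoly set) (n - l) (j - int l)) =
        (\<Sum>l = 0..n. if l = 0 then quotient_betti (mono_ideal S :: ('v, 'k) mpoly set) n j else 0)"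
      by (intro sum.cong) auto
    then show ?case by simp
  next
    case (insert x N)
    let ?r = "quotient_betti (mono_ideal S :: ('v, 'k) mpoly set)"
    let ?q = "quotient_betti (mono_ideal (S \<union> (\<lambda>x. {#x#}) ` N) :: ('v, 'k) mpoly set)"
    have IH: "?q n j = (\<Sum>l = 0..n. (card N choose l) * ?r (n - l) (j - int l))" for n j
      by (rule insert.IH) (use insert.prems in auto)
    have "quotient_betti (mono_ideal (insert {#x#} (S \<union> (\<lambda>x. {#x#}) ` N)) :: ('v, 'k) mpoly set) n j =
        ?q n j + (case n of 0 \<Rightarrow> 0 | Suc k \<Rightarrow> ?q k (j - 1))"
      by (rule quotient_betti_insert_variable) (use S insert in auto)
    also have "\<dots> = (\<Sum>l = 0..n. (Suc (card N) choose l) * ?r (n - l) (j - int l))"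
    proof (cases n)
      case (Suc k)
      have "?q n j = ?r (Suc k) j + (\<Sum>l = 0..k. (card N choose Suc l) * ?r (k - l) (j - 1 - int l))"
        unfolding IH Suc by (subst sum.atLeast0_atMost_Suc_shift) (simp add: algebra_simps)
      moreover have "(\<Sum>l = 0..n. (Suc (card N) choose l) * ?r (n - l) (j - int l)) =
          ?r (Suc k) j + (\<Sum>l = 0..k. (Suc (card N) choose Suc l) * ?r (k - l) (j - 1 - int l))"
        unfolding Suc by (subst sum.atLeast0_atMost_Suc_shift) (simp add: algebra_simps)
      ultimately show ?thesis
        by (simp add: Suc IH sum.distrib[symmetric] algebra_simps)
    qed (simp add: IH)
    finally show ?case using insert.hyps by simp
  qed
qed

section \<open>Minimal generators\<close>

text \<open>
  The elements of \<open>S\<close> that are minimal for divisibility generate the ideal, and they belong to every set of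
  generating monomials. They are therefore the only irredundant generating set.
\<close>

lemma min_gens_mono_ideal:
  fixes S :: "'v::finite multiset set"
  defines "G \<equiv> min_gens (mono_ideal S :: ('v, 'k::field) mpoly set)"
  shows "G \<subseteq> S" "mono_ideal G = (mono_ideal S :: ('v, 'k) mpoly set)"
proof -
  define M where "M = {s \<in> S. \<forall>t\<in>S. t \<subseteq># s \<longrightarrow> t = s}"
  have below: "\<exists>g\<in>M. g \<subseteq># s" if "s \<in> S" for s
    using that
  proof (induction "size s" arbitrary: s rule: less_induct)
    case less
    show ?case
    proof (cases "s \<in> M")
      case False
      then obtain t where t: "t \<in> S" "t \<subset># s" using less.prems by (auto simp: M_def subset_mset.less_le)
      then obtain g where "g \<in> M" "g \<subseteq># t" using less.hyps[OF mset_subset_size] by blast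
      then show ?thesis using t(2) by (meson subset_mset.less_imp_le subset_mset.order_trans)
    qed auto
  qed
  have M: "mono_ideal M = (mono_ideal S :: ('v, 'k) mpoly set)"
  proof (rule mono_ideal_eqI)
    fix m show "(\<exists>s\<in>M. s \<subseteq># m) = (\<exists>s\<in>S. s \<subseteq># m)"
      using below by (auto simp: M_def) (meson subset_mset.order_trans)
  qed
  have least: "M \<subseteq> G'" if "mono_ideal G' = (mono_ideal S :: ('v, 'k) mpoly set)" for G'
  proof
    fix s assume s: "s \<in> M"
    then have "(monom s :: ('v, 'k) mpoly) \<in> mono_ideal G'"
      unfolding that monom_in_mono_ideal by (auto simp: M_def)
    then obtain t where t: "t \<in> G'" "t \<subseteq># s" by (auto simp: monom_in_mono_ideal)
    have "(monom t :: ('v, 'k) mpoly) \<in> mono_ideal S"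
      unfolding that[symmetric] monom_in_mono_ideal using t by auto
    then obtain r where "r \<in> S" "r \<subseteq># t" by (auto simp: monom_in_mono_ideal)
    then have "t = s" using s t(2) by (auto simp: M_def dest: subset_mset.order_trans subset_mset.antisym)
    then show "s \<in> G'" using t by simp
  qed
  have "G = M"
    unfolding G_def min_gens_def ideal_gen_monom
  proof (rule the_equality)
    show "mono_ideal M = (mono_ideal S :: ('v, 'k) mpoly set) \<and> (\<forall>G'\<subset>M. mono_ideal G' \<noteq> (mono_ideal S :: ('v, 'k) mpoly set))"
      using M least by blast
  next
    fix G' assume "mono_ideal G' = (mono_ideal S :: ('v, 'k) mpoly set) \<and>
      (\<forall>G''\<subset>G'. mono_ideal G'' \<noteq> (mono_ideal S :: ('v, 'k) mpoly set))"
    then show "G' = M" using M least[of G'] by blast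
  qed
  then show "G \<subseteq> S" "mono_ideal G = (mono_ideal S :: ('v, 'k) mpoly set)" using M by (auto simp: M_def)
qed

section \<open>Distances in properly-connected hypergraphs\<close>

lemma chain_seq_length: "length (chain_seq E ps) = 2 * length ps + 1"
  unfolding chain_seq_def by (induction ps) auto

lemma irredundant_subchain:
  assumes "proper_chain d H E F ps"
  shows "\<exists>qs. irredundant_chain d H E F qs \<and> length qs \<le> length ps"
  using assms
proof (induction "length ps" arbitrary: ps rule: less_induct)
  case less
  show ?case
  proof (cases "irredundant_chain d H E F ps")
    case False
    with less.prems obtain qs where qs: "proper_chain d H E F qs"
      "strict_subseq (chain_seq E qs) (chain_seq E ps)"
      by (auto simp: irredundant_chain_def)
    then have sub: "subseq (chain_seq E qs) (chain_seq E ps)" and ne: "chain_seq E qs \<noteq> chain_seq E ps"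
      by auto
    have "length (chain_seq E qs) < length (chain_seq E ps)"
      using list_emb_length[OF sub] subseq_same_length[OF sub] ne by linarith
    then have "length qs < length ps" by (simp add: chain_seq_length)
    from less.hyps[OF this qs(1)] this show ?thesis by (meson less_imp_le order_trans)
  qed auto
qed

text \<open>
  Every proper chain has an irredundant subsequence with the same ends, so the distance is the minimal length of
  proper chains.
\<close>

lemma edge_dist_le_iff:
  "edge_dist d H E F \<le> enat n \<longleftrightarrow> (\<exists>ps. proper_chain d H E F ps \<and> length ps \<le> n)"
proof
  assume le: "edge_dist d H E F \<le> enat n"
  let ?S = "{enat (length ps) |ps. irredundant_chain d H E F ps}"
  have "?S \<noteq> {}"
  proof
    assume "?S = {}"
    then have "edge_dist d H E F = \<infinity>" by (simp add: edge_dist_def top_enat_def)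
    with le show False by simp
  qed
  then obtain k where "k \<in> ?S" by blast
  then have "edge_dist d H E F \<in> ?S"
    unfolding edge_dist_def by (rule wellorder_InfI)
  then show "\<exists>ps. proper_chain d H E F ps \<and> length ps \<le> n"
    using le by (auto simp: irredundant_chain_def)
next
  assume "\<exists>ps. proper_chain d H E F ps \<and> length ps \<le> n"
  then obtain qs where "irredundant_chain d H E F qs" "length qs \<le> n"
    using irredundant_subchain order_trans by metis
  then show "edge_dist d H E F \<le> enat n"
    unfolding edge_dist_def by (intro Inf_lower2[of "enat (length qs)"]) auto
qed

lemma proper_chain_Nil: "proper_chain d H E F [] \<longleftrightarrow> E \<in> H \<and> E = F"
  by (auto simp: proper_chain_def is_chain_def chain_edges_def chain_verts_def)

lemma proper_chain_Cons:
  "proper_chain d H E F ((x, G) # ps) \<longleftrightarrow>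
     E \<in> H \<and> x \<in> E \<inter> G \<and> card (E \<inter> G) = d - 1 \<and> x \<notin> fst ` set ps \<and> E \<noteq> G \<and> E \<notin> snd ` set ps \<and>
     proper_chain d H G F ps"
  unfolding proper_chain_def is_chain_def chain_edges_def chain_verts_def
  by (auto simp: All_less_Suc2)

locale uniform_hypergraph =
  fixes H :: "'v::finite set set" and d :: nat
  assumes uniform: "F \<in> H \<Longrightarrow> card F = d"
begin

lemma chain_source_target: "proper_chain d H E F ps \<Longrightarrow> E \<in> H \<and> F \<in> H"
proof (induction ps arbitrary: E)
  case (Cons p ps)
  then show ?case by (cases p) (simp add: proper_chain_Cons, blast)
qed (simp add: proper_chain_Nil)

lemma step_card: "E \<in> H \<Longrightarrow> G \<in> H \<Longrightarrow> card (E \<inter> G) = d - 1 \<Longrightarrow> d > 0 \<Longrightarrow> card (G - E) = 1"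
  using card_Int_Diff[of G E] uniform[of G] by (simp add: Int_commute)

text \<open>
  Each step of a proper chain adds only one vertex.
\<close>

lemma chain_card_Diff:
  assumes "proper_chain d H E F ps" "d > 0"
  shows "card (F - E) \<le> length ps"
  using assms(1)
proof (induction ps arbitrary: E)
  case (Cons p ps)
  obtain x G where p: "p = (x, G)" by (cases p)
  have *: "E \<in> H" "card (E \<inter> G) = d - 1" "proper_chain d H G F ps"
    using Cons.prems by (auto simp: p proper_chain_Cons)
  then have "card (G - E) = 1" using step_card chain_source_target assms(2) by blast
  moreover have "card (F - E) \<le> card ((F - G) \<union> (G - E))" by (rule card_mono) auto
  moreover have "card ((F - G) \<union> (G - E)) \<le> card (F - G) + card (G - E)" by (rule card_Un_le)
  ultimately show ?case using Cons.IH[OF *(3)] by simp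
qed (simp add: proper_chain_Nil)

text \<open>
  Since each step adds one vertex, a chain of length at most \<open>card (F - E)\<close> adds no vertex that is not in \<open>F\<close>. This holds
  in particular for the first new vertex \<open>b\<close>.
\<close>

lemma geodesic_first_step:
  assumes ch: "proper_chain d H E F ps" and d: "d > 0" and ne: "E \<noteq> F" and len: "length ps \<le> card (F - E)"
  obtains G where "G \<in> H" "card (E \<inter> G) = d - 1" "E \<inter> G \<noteq> {}" "\<exists>b. G - E = {b} \<and> b \<in> F"
proof -
  obtain x G qs where ps: "ps = (x, G) # qs"
    using ch ne by (cases ps) (auto simp: proper_chain_Nil)
  have *: "E \<in> H" "x \<in> E \<inter> G" "card (E \<inter> G) = d - 1" "proper_chain d H G F qs"
    using ch by (auto simp: ps proper_chain_Cons)
  then have "G \<in> H" using chain_source_target by blast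
  then obtain b where b: "G - E = {b}" using step_card[OF *(1) _ *(3) d] by (auto simp: card_1_singleton_iff)
  have "b \<in> F"
  proof (rule ccontr)
    assume "b \<notin> F"
    then have "F - E \<subseteq> F - G" using b by auto
    then have "card (F - E) \<le> card (F - G)" by (intro card_mono) auto
    also have "\<dots> \<le> length qs" by (rule chain_card_Diff[OF *(4) d])
    finally show False using len by (simp add: ps)
  qed
  with that[OF \<open>G \<in> H\<close> *(3)] *(2) b show thesis by blast
qed

lemma chain_tail:
  assumes "proper_chain d H G F ps" "E \<in> insert G (snd ` set ps)"
  shows "\<exists>qs. proper_chain d H E F qs \<and> length qs \<le> length ps"
  using assms
proof (induction ps arbitrary: G)
  case (Cons p ps)
  obtain x G' where p: "p = (x, G')" by (cases p)
  show ?case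
  proof (cases "E = G")
    case False
    then have "E \<in> insert G' (snd ` set ps)" "proper_chain d H G' F ps"
      using Cons.prems by (auto simp: p proper_chain_Cons)
    from Cons.IH[OF this(2,1)] show ?thesis by auto
  qed (use Cons.prems in blast)
qed auto

lemma chain_last_vertex: "proper_chain d H G F ps \<Longrightarrow> ps \<noteq> [] \<Longrightarrow> \<exists>x\<in>fst ` set ps. x \<in> F"
proof (induction ps arbitrary: G)
  case (Cons p ps)
  obtain x G' where p: "p = (x, G')" by (cases p)
  show ?case
  proof (cases "ps = []")
    case True
    then show ?thesis using Cons.prems by (auto simp: p proper_chain_Cons proper_chain_Nil)
  next
    case False
    then show ?thesis using Cons by (auto simp: p proper_chain_Cons)
  qed
qed simp

text \<open>
  Prepending \<open>E\<close> requires a vertex of \<open>E \<inter> G\<close> that the chain has not used. If all \<open>d - 1\<close> vertices of \<open>E \<inter> G\<close> were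
  used, they would be all the vertices of the chain, but the last one of them lies in \<open>F\<close> and hence not in \<open>E\<close>.
\<close>

lemma extend_chain:
  assumes ch: "proper_chain d H G F ps" and len: "length ps < d" and d: "d \<ge> 2"
    and E: "E \<in> H" "card (E \<inter> G) = d - 1" and disj: "E \<inter> F = {}"
  shows "\<exists>qs. proper_chain d H E F qs \<and> length qs \<le> d"
proof (cases "E \<in> insert G (snd ` set ps)")
  case True
  from chain_tail[OF ch True] len show ?thesis by (meson less_imp_le order_trans)
next
  case False
  let ?V = "fst ` set ps"
  have "\<exists>x\<in>E \<inter> G. x \<notin> ?V"
  proof (rule ccontr)
    assume "\<not> (\<exists>x\<in>E \<inter> G. x \<notin> ?V)"
    then have sub: "E \<inter> G \<subseteq> ?V" by blast
    show False
    proof (cases ps)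
      case Nil
      then have "E \<inter> G = {}" using sub by simp
      then show False using E(2) d by simp
    next
      case (Cons p qs)
      then obtain y where y: "y \<in> ?V" "y \<in> F" using chain_last_vertex[OF ch] by auto
      then have "y \<notin> E \<inter> G" using disj by blast
      then have "E \<inter> G \<subset> ?V" using sub y(1) by blast
      then have "card (E \<inter> G) < card ?V" by (intro psubset_card_mono) auto
      also have "card ?V \<le> length ps" by (metis card_length length_map set_map)
      finally show False using E(2) len by simp
    qed
  qed
  then obtain x where "x \<in> E \<inter> G" "x \<notin> ?V" by blast
  then have "proper_chain d H E F ((x, G) # ps)"
    using E ch False by (auto simp: proper_chain_Cons)
  then show ?thesis using len by (intro exI[of _ "(x, G) # ps"]) auto
qed

end

locale properly_connected_edge = uniform_hypergraph +
  fixes E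
  assumes dist: "F \<in> H \<Longrightarrow> G \<in> H \<Longrightarrow> F \<inter> G \<noteq> {} \<Longrightarrow> edge_dist d H F G = enat (d - card (F \<inter> G))"
    and E: "E \<in> H" and d: "d \<ge> 2"
begin

text \<open>
  The chain of minimal length from \<open>E\<close> to \<open>F\<close> is not longer than \<open>card (F - E)\<close>: if the edges meet, by proper
  connectedness, and otherwise because \<open>card (F - E) = d\<close>. Its first step adds a vertex of \<open>F\<close>.
\<close>

lemma near_edge_meets_nbhd:
  assumes F: "F \<in> H" "F \<noteq> E" and near: "edge_dist d H E F \<le> enat d"
  shows "\<exists>b\<in>edge_nbhd d H E. b \<in> F"
proof -
  have "edge_dist d H E F \<le> enat (card (F - E))"
  proof (cases "E \<inter> F = {}")
    case True
    then have "F - E = F" by blast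
    then show ?thesis using near uniform[OF F(1)] by simp
  next
    case False
    have "card (F - E) = d - card (E \<inter> F)"
      using card_Int_Diff[of F E] uniform[OF F(1)] by (simp add: Int_commute)
    then show ?thesis using dist[OF E F(1) False] by simp
  qed
  then obtain ps where "proper_chain d H E F ps" "length ps \<le> card (F - E)"
    by (auto simp: edge_dist_le_iff)
  then obtain G b where G: "G \<in> H" "card (E \<inter> G) = d - 1" "E \<inter> G \<noteq> {}" "G - E = {b}" "b \<in> F"
    using geodesic_first_step[of E F ps] F d by (metis gr0I not_numeral_le_zero)
  have "edge_dist d H E G = 1"
    using dist[OF E G(1,3)] G(2) d by (simp add: one_enat_def)
  then show ?thesis using G by (auto simp: edge_nbhd_def)
qed

lemma nbhd_edge:
  assumes "b \<in> edge_nbhd d H E"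
  shows "\<exists>G\<in>H. G \<noteq> E \<and> G - E = {b} \<and> card (E \<inter> G) = d - 1"
proof -
  from assms obtain G where G: "G \<in> H" "edge_dist d H E G = 1" "b \<in> G - E"
    by (auto simp: edge_nbhd_def)
  have "edge_dist d H E G \<le> enat 1" using G(2) by (simp add: one_enat_def)
  then obtain ps where ps: "proper_chain d H E G ps" "length ps \<le> 1"
    by (auto simp: edge_dist_le_iff)
  have ne: "G \<noteq> E" using G(3) by blast
  then have "ps \<noteq> []" using ps(1) by (auto simp: proper_chain_Nil)
  then obtain x G' where "ps = [(x, G')]" using ps(2) by (cases ps) auto
  then have c: "card (E \<inter> G) = d - 1" using ps(1) by (auto simp: proper_chain_Cons proper_chain_Nil)
  then have "card (G - E) = 1" using step_card[OF E G(1)] d by simp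
  then have "G - E = {b}" using G(3) by (metis card_1_singletonE singletonD)
  then show ?thesis using G(1) ne c by blast
qed

text \<open>
  If \<open>F\<close> contained \<open>b\<close> from the neighbourhood, it would meet the edge \<open>G\<close> at distance one from \<open>E\<close> that adds
  \<open>b\<close>. Then a chain of length less than \<open>d\<close> leads from \<open>G\<close> to \<open>F\<close>, and prepending \<open>E\<close> contradicts the
  distance of \<open>F\<close>.
\<close>

lemma far_edge_disjoint:
  assumes F: "F \<in> H" and far: "edge_dist d H E F \<ge> enat (d + 1)"
  shows "F \<inter> E = {}" "F \<inter> edge_nbhd d H E = {}"
proof -
  show EF: "F \<inter> E = {}"
  proof (rule ccontr)
    assume "F \<inter> E \<noteq> {}"
    then have "edge_dist d H E F = enat (d - card (E \<inter> F))" using dist[OF E F] by (simp add: Int_commute)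
    then show False using far by simp
  qed
  show "F \<inter> edge_nbhd d H E = {}"
  proof (rule ccontr)
    assume "F \<inter> edge_nbhd d H E \<noteq> {}"
    then obtain b where b: "b \<in> F" "b \<in> edge_nbhd d H E" by blast
    then obtain G where G: "G \<in> H" "G - E = {b}" "card (E \<inter> G) = d - 1"
      using nbhd_edge by blast
    then have GF: "G \<inter> F \<noteq> {}" using b(1) by blast
    then have "card (G \<inter> F) > 0" by (simp add: card_gt_0_iff)
    then have "edge_dist d H G F \<le> enat (d - 1)" using dist[OF G(1) F GF] d by simp
    then obtain ps where ps: "proper_chain d H G F ps" "length ps \<le> d - 1"
      by (auto simp: edge_dist_le_iff)
    from extend_chain[OF ps(1) _ d E G(3)] ps(2) d EF
    have "edge_dist d H E F \<le> enat d" by (auto simp: edge_dist_le_iff Int_commute)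
    then show False using far by (metis Suc_eq_plus1 enat_ord_simps(1) not_less_eq_eq order_refl order_trans)
  qed
qed

end

section \<open>Edge ideals\<close>

lemma edge_mono_eq: "edge_mono E = (monom (mset_set E) :: ('v::finite, 'k::field) mpoly)"
proof -
  have "finite E" by simp
  then show ?thesis unfolding edge_mono_def
    by (induction E rule: finite_induct)
      (auto simp: indet_def monom_def mult_single single_one[unfolded zero_multiset_def])
qed

lemma edge_ideal_eq: "edge_ideal H = (mono_ideal (mset_set ` H) :: ('v::finite, 'k::field) mpoly set)"
  by (simp add: edge_ideal_def edge_mono_eq[abs_def] ideal_gen_monom[symmetric] image_image)

section \<open>The splitting formula\<close>

lemma mono_ideal_eqD:
  assumes "mono_ideal S = (mono_ideal T :: ('v::finite, 'k::field) mpoly set)"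
  shows "(\<exists>s\<in>S. s \<subseteq># m) \<longleftrightarrow> (\<exists>t\<in>T. t \<subseteq># m)"
  using monom_in_mono_ideal[where 'k='k, of m S] monom_in_mono_ideal[where 'k='k, of m T] assms by simp

lemma finite_mset_Sup_upper: "finite V \<Longrightarrow> a \<in> V \<Longrightarrow> a \<subseteq># Sup (V :: 'v multiset set)"
proof (rule subset_mset.cSup_upper)
  assume "finite V"
  then have "\<forall>a\<in>V. a \<subseteq># sum (\<lambda>x. x) V"
    by (induction V rule: finite_induct) (auto intro: subset_mset.order_trans)
  then show "subset_mset.bdd_above V" unfolding subset_mset.bdd_above_def by blast
qed

text \<open>
  The divisibility condition of a splitting, transferred from nonempty sets of generators of the intersection
  to lists of generators of the colon ideal. The empty list adds the condition that \<open>e\<close> is not \<open>1\<close>.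
\<close>

lemma splitting_strict_divisor:
  fixes W :: "'v::finite multiset set"
  assumes split: "\<And>V. V \<noteq> {} \<Longrightarrow> V \<subseteq> W \<Longrightarrow> Sup (\<psi> ` V) \<subset># Sup V"
    and s: "\<And>a. a \<in> set s \<Longrightarrow> a + e \<in> W" and e: "e \<noteq> {#}"
  shows "list_lcm (map (\<lambda>a. \<psi> (a + e)) s) \<subset># e + list_lcm s"
proof (cases s)
  case Nil
  then show ?thesis using e by (simp add: subset_mset.zero_less_iff_neq_zero)
next
  case (Cons a s')
  let ?V = "(\<lambda>a. a + e) ` set s"
  have "list_lcm (map (\<lambda>a. \<psi> (a + e)) s) \<subseteq># Sup (\<psi> ` ?V)"
    by (auto simp: list_lcm_le_iff intro!: finite_mset_Sup_upper)
  also have "Sup (\<psi> ` ?V) \<subset># Sup ?V"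
    by (rule split) (use s Cons in auto)
  also have "Sup ?V \<subseteq># e + list_lcm s"
  proof (rule subset_mset.cSup_least)
    fix v assume "v \<in> ?V"
    then obtain a where a: "a \<in> set s" "v = a + e" by blast
    then have "a \<subseteq># list_lcm s" using list_lcm_le_iff[of s "list_lcm s"] by blast
    then show "v \<subseteq># e + list_lcm s" by (simp add: a(2) add.commute)
  qed (use Cons in simp)
  finally show ?thesis .
qed

lemma mono_ideal_inter:
  "mono_ideal {e} \<inter> mono_ideal S = (mono_ideal ((\<lambda>s. e \<union># s) ` S) :: ('v::finite, 'k::field) mpoly set)"
  by (auto simp: mono_ideal_def subset_mset.le_sup_iff)

context properly_connected_edge
begin

text \<open>
  The two sides describe the monomials of the ideals \<open>(x\<^sub>b : b \<in> N(E)) + I(H')\<close> and \<open>(I(H - {E}) : x\<^sup>E)\<close>. An edge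
  at distance at most \<open>d\<close> has a vertex in \<open>N(E)\<close>, so the corresponding variable absorbs it; an edge
  at larger distance is disjoint from \<open>E\<close> and unaffected by the colon.
\<close>

lemma colon_generators:
  defines "H' \<equiv> {F \<in> H. edge_dist d H E F \<ge> enat (d + 1)}"
  shows "(\<exists>t\<in>mset_set ` H' \<union> (\<lambda>x. {#x#}) ` edge_nbhd d H E. t \<subseteq># u) \<longleftrightarrow>
    (\<exists>s\<in>mset_set ` (H - {E}). s \<subseteq># u + mset_set E)"
proof
  assume "\<exists>t\<in>mset_set ` H' \<union> (\<lambda>x. {#x#}) ` edge_nbhd d H E. t \<subseteq># u"
  then consider F where "F \<in> H'" "mset_set F \<subseteq># u" | b where "b \<in> edge_nbhd d H E" "{#b#} \<subseteq># u"
    by blast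
  then show "\<exists>s\<in>mset_set ` (H - {E}). s \<subseteq># u + mset_set E"
  proof cases
    case 1
    then have "F \<in> H" "F \<inter> E = {}" using far_edge_disjoint by (auto simp: H'_def)
    moreover have "F \<noteq> {}" using uniform[OF \<open>F \<in> H\<close>] d by auto
    ultimately have "F \<in> H - {E}" by auto
    then show ?thesis using 1(2) by (meson imageI mset_subset_eq_add_left subset_mset.order_trans)
  next
    case 2
    then obtain G where G: "G \<in> H - {E}" "G - E = {b}" using nbhd_edge by blast
    have "count (mset_set G) y \<le> count (u + mset_set E) y" for y
    proof (cases "y \<in> G \<and> y \<notin> E")
      case True
      then have "y = b" using G(2) by blast
      then show ?thesis using 2(2) by (auto simp: count_mset_set' Suc_le_eq)
    qed (auto simp: count_mset_set')
    then show ?thesis using G(1) by (auto simp: subseteq_mset_def)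
  qed
next
  assume "\<exists>s\<in>mset_set ` (H - {E}). s \<subseteq># u + mset_set E"
  then obtain F where F: "F \<in> H" "F \<noteq> E" "mset_set F \<subseteq># u + mset_set E" by blast
  have out: "1 \<le> count u y" if "y \<in> F" "y \<notin> E" for y
    using mset_subset_eq_count[OF F(3), of y] that by (simp add: count_mset_set')
  show "\<exists>t\<in>mset_set ` H' \<union> (\<lambda>x. {#x#}) ` edge_nbhd d H E. t \<subseteq># u"
  proof (cases "F \<in> H'")
    case True
    then have "F \<inter> E = {}" using far_edge_disjoint by (auto simp: H'_def)
    then have "count (mset_set F) y \<le> count u y" for y
      using out[of y] by (auto simp: count_mset_set')
    then have "mset_set F \<subseteq># u" by (simp add: subseteq_mset_def)
    then show ?thesis using True by blast
  next
    case False
    then have "edge_dist d H E F \<le> enat d"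
      using F(1) by (cases "edge_dist d H E F") (auto simp: H'_def)
    then obtain b where b: "b \<in> edge_nbhd d H E" "b \<in> F" using near_edge_meets_nbhd F by blast
    then have "b \<notin> E" by (auto simp: edge_nbhd_def)
    then have "{#b#} \<subseteq># u" using out[OF b(2)] by (simp add: Suc_le_eq)
    then show ?thesis using b(1) by blast
  qed
qed

end

theorem theorem1p2:
  fixes H H' :: "'v::finite set set" and E :: "'v set" and d t i :: nat and j :: int
  assumes "simple_hypergraph H"
    and "properly_connected H"
    and "splitting_edge TYPE('k::field) H E"
    and "d = card E"
    and "H' = {F \<in> H. edge_dist d H E F \<ge> enat (d + 1)}"
    and "t = card (edge_nbhd d H E)"
    and "i \<ge> 1"
  shows "betti (edge_ideal H :: ('v, 'k) mpoly set) i j =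
         betti (edge_ideal (H - {E}) :: ('v, 'k) mpoly set) i j +
         (\<Sum>l = 0..i. (t choose l) *
            betti_ext (edge_ideal H' :: ('v, 'k) mpoly set) (int i - 1 - int l) (j - int d - int l))"
proof -
  have EH: "E \<in> H" using assms(3) by (simp add: splitting_edge_def)
  obtain d' where d': "uniform d' H"
    "\<And>F G. F \<in> H \<Longrightarrow> G \<in> H \<Longrightarrow> F \<inter> G \<noteq> {} \<Longrightarrow> edge_dist d' H F G = enat (d' - card (F \<inter> G))"
    using assms(2) by (auto simp: properly_connected_def)
  have "d' = d" using d'(1) EH assms(4) by (auto simp: uniform_def)
  have d: "d \<ge> 2" using assms(1,4) EH by (auto simp: simple_hypergraph_def)
  interpret properly_connected_edge H d E
    using d' EH d unfolding \<open>d' = d\<close> by unfold_locales (auto simp: uniform_def)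
  define e where "e = mset_set E"
  define S where "S = mset_set ` (H - {E})"
  define N where "N = edge_nbhd d H E"
  \<comment> \<open>The colon ideal has two sets of generators: \<open>T\<close> comes from the hypergraph and is finite, \<open>A\<close> comes from the splitting.\<close>
  define T where "T = mset_set ` H' \<union> (\<lambda>x. {#x#}) ` N"
  have nonempty: "{#} \<notin> mset_set ` F" if "F \<subseteq> H" for F
    using uniform that d by (fastforce simp: mset_set_empty_iff)
  have H'H: "H' \<subseteq> H" using assms(5) by auto
  have S: "finite S" "{#} \<notin> S" and T: "finite T" "{#} \<notin> T"
    using nonempty[of "H - {E}"] nonempty[OF H'H] by (auto simp: S_def T_def)
  have HS: "mset_set ` H = insert e S" using EH by (auto simp: S_def e_def)
  have e: "e \<noteq> {#}" "size e = d" using d assms(4) by (auto simp: e_def mset_set_empty_iff)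
  have colon: "(\<exists>t\<in>T. t \<subseteq># u) \<longleftrightarrow> (\<exists>s\<in>S. s \<subseteq># u + e)" for u
    using colon_generators[of u] by (simp only: T_def S_def e_def N_def assms(5))
  define U where "U = (\<lambda>s. e \<union># s) ` S"
  define W where "W = min_gens (mono_ideal U :: ('v, 'k) mpoly set)"
  define G where "G = min_gens (mono_ideal S :: ('v, 'k) mpoly set)"
  define A where "A = (\<lambda>w. w - e) ` W"
  have W: "W \<subseteq> U" "mono_ideal W = (mono_ideal U :: ('v, 'k) mpoly set)"
    unfolding W_def by (rule min_gens_mono_ideal)+
  have G: "mono_ideal G = (mono_ideal S :: ('v, 'k) mpoly set)"
    unfolding G_def by (rule min_gens_mono_ideal)
  have eW: "w - e + e = w" if "w \<in> W" for w
    using that W(1) by (intro subset_mset.diff_add) (auto simp: U_def)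
  have A: "mono_ideal A = (mono_ideal T :: ('v, 'k) mpoly set)"
  proof (rule mono_ideal_eqI)
    fix u
    have "(\<exists>a\<in>A. a \<subseteq># u) \<longleftrightarrow> (\<exists>w\<in>W. w \<subseteq># u + e)"
      by (simp add: A_def subset_eq_diff_conv)
    also have "\<dots> \<longleftrightarrow> (\<exists>w\<in>U. w \<subseteq># u + e)"
      by (rule mono_ideal_eqD[OF W(2)])
    also have "\<dots> \<longleftrightarrow> (\<exists>s\<in>S. s \<subseteq># u + e)"
      by (simp add: U_def subset_mset.le_sup_iff)
    finally show "(\<exists>a\<in>A. a \<subseteq># u) \<longleftrightarrow> (\<exists>t\<in>T. t \<subseteq># u)" by (simp add: colon)
  qed
  have "ideal_gen {edge_mono E} \<inter> edge_ideal (H - {E}) = (mono_ideal U :: ('v, 'k) mpoly set)"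
    using mono_ideal_inter[where 'k='k, of e S] ideal_gen_monom[where 'k='k, of "{e}"]
    by (simp add: edge_mono_eq edge_ideal_eq U_def S_def e_def)
  then have W_eq: "min_gens (ideal_gen {edge_mono E} \<inter> edge_ideal (H - {E}) :: ('v, 'k) mpoly set) = W"
    by (simp add: W_def)
  have G_eq: "min_gens (edge_ideal (H - {E}) :: ('v, 'k) mpoly set) = G"
    by (simp add: G_def edge_ideal_eq S_def)
  have "is_splitting (edge_ideal H :: ('v, 'k) mpoly set) (ideal_gen {edge_mono E}) (edge_ideal (H - {E}))"
    using assms(3) by (simp add: splitting_edge_def)
  then obtain \<phi> \<psi> where \<psi>\<phi>: "\<forall>w\<in>W. \<phi> w \<in> min_gens (ideal_gen {edge_mono E} :: ('v, 'k) mpoly set) \<and>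
      \<psi> w \<in> G \<and> w = \<phi> w \<union># \<psi> w"
    "\<forall>V. V \<noteq> {} \<and> V \<subseteq> W \<longrightarrow> Sup (\<phi> ` V) \<subset># Sup V \<and> Sup (\<psi> ` V) \<subset># Sup V"
    unfolding is_splitting_def W_eq G_eq by (elim conjE exE) (rule that)
  have \<psi>: "\<And>w. w \<in> W \<Longrightarrow> \<psi> w \<in> G"
    "\<And>V. V \<noteq> {} \<Longrightarrow> V \<subseteq> W \<Longrightarrow> Sup (\<psi> ` V) \<subset># Sup V"
    using \<psi>\<phi> by simp_all
  have step: "quotient_betti (mono_ideal (insert e S) :: ('v, 'k) mpoly set) (Suc i) j =
    quotient_betti (mono_ideal S :: ('v, 'k) mpoly set) (Suc i) j +
    quotient_betti (mono_ideal T :: ('v, 'k) mpoly set) i (j - int d)"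
  proof -
    have "list_lcm (map (\<lambda>a. \<psi> (a + e)) s) \<subset># e + list_lcm s" if "set s \<subseteq> A" for s
      by (rule splitting_strict_divisor[OF \<psi>(2) _ e(1)]) (use that eW in \<open>auto simp: A_def\<close>)
    moreover have "\<psi> (a + e) \<in> G" if "a \<in> A" for a
      using that \<psi>(1) eW by (auto simp: A_def)
    ultimately show ?thesis
      using quotient_betti_splitting[OF S T colon G A, of "\<lambda>a. \<psi> (a + e)" "Suc i" j]
      by (simp add: e(2))
  qed
  have vars: "quotient_betti (mono_ideal T :: ('v, 'k) mpoly set) i (j - int d) =
    (\<Sum>l = 0..i. (t choose l) * quotient_betti (edge_ideal H' :: ('v, 'k) mpoly set) (i - l) (j - int d - int l))"
    unfolding T_def edge_ideal_eq assms(6) N_def[symmetric]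
  proof (rule quotient_betti_variables[OF _ nonempty[OF H'H]])
    fix s x assume "s \<in> mset_set ` H'" "x \<in> N"
    then obtain F where F: "F \<in> H'" "s = mset_set F" by blast
    then have "F \<inter> N = {}" using far_edge_disjoint(2)[of F] by (simp add: assms(5) N_def)
    then show "x \<notin># s" using \<open>x \<in> N\<close> F(2) by auto
  qed simp
  have ext: "quotient_betti (edge_ideal H' :: ('v, 'k) mpoly set) (i - l) q =
    betti_ext (edge_ideal H' :: ('v, 'k) mpoly set) (int i - 1 - int l) q" if "l \<in> {0..i}" for l q
  proof (cases "l = i")
    case True
    then show ?thesis
      using quotient_betti_0[where 'k='k, OF nonempty[OF H'H]] by (simp add: betti_ext_def edge_ideal_eq)
  next
    case False
    then have "l < i" using that by simp
    then obtain k where "i = Suc (l + k)" by (auto dest: less_imp_Suc_add)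
    then have "int i - 1 - int l = int k" "i - l = Suc k" by auto
    then show ?thesis
      using betti_quotient_betti[where 'k='k, OF nonempty[OF H'H]] by (simp add: betti_ext_def edge_ideal_eq)
  qed
  have "betti (edge_ideal H :: ('v, 'k) mpoly set) i j =
    quotient_betti (mono_ideal (insert e S) :: ('v, 'k) mpoly set) (Suc i) j"
    using betti_quotient_betti[where 'k='k, OF nonempty[of H]] by (simp add: edge_ideal_eq HS)
  also note step
  also have "quotient_betti (mono_ideal S :: ('v, 'k) mpoly set) (Suc i) j =
    betti (edge_ideal (H - {E}) :: ('v, 'k) mpoly set) i j"
    using betti_quotient_betti[where 'k='k, OF S(2)] by (simp add: edge_ideal_eq S_def)
  also note vars
  also have "(\<Sum>l = 0..i. (t choose l) * quotient_betti (edge_ideal H' :: ('v, 'k) mpoly set) (i - l) (j - int d - int l)) =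
    (\<Sum>l = 0..i. (t choose l) * betti_ext (edge_ideal H' :: ('v, 'k) mpoly set) (int i - 1 - int l) (j - int d - int l))"
    by (intro sum.cong refl arg_cong2[of _ _ _ _ "(*)"] ext)
  finally show ?thesis .
qed

end
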